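(* Let $A$ be the generalized Weyl algebra determined by $q$ and $p$, with $q$ not a root of unity and $p$ without multiple roots, and let $\mathcal S$ be the cochain complex in the context. If $p\nsim z$, then bases of $H^0(\mathcal S)$, $H^1(\mathcal S)$, $H^2(\mathcal S)$ are represented respectively by the following sets of cocycles: - $H^0(\mathcal S)$: $\{1\}$; - $H^1(\mathcal S)$: $\{(x,-y,0)^T\}$; - $H^2(\mathcal S)$: $\{(0,\widetilde{zp'},-xz,zy)^T\}\cup\{(z^i,\widetilde{z^i},0,0)^T\mid 0\le i<n,\ i\ne n-\ell\}$. If $p\sim z$, then bases of $H^0(\mathcal S)$, $H^1(\mathcal S)$, $H^2(\mathcal S)$ are represented respectively by the following sets of cocycles: - $H^0(\mathcal S)$: $\{1\}$; - $H^1(\mathcal S)$: $\{(x,-y,0)^T,\ (x,y,2z)^T\}$; - $H^2(\mathcal S)$: $\{(0,\widetilde p,-xz,zy)^T,\ (1,1,0,0)^T\}$. Moreover, in both cases $H^j(\mathcal S)=0$ for all $j\ge3$.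
   Context: Algebra. $k$ is a field of characteristic $\neq 2$; $q\in k^\times$ is not a root of unity; $\sigma$ is the automorphism of $k[z]$ with $\sigma(z)=qz$, and $\widetilde\varphi:=\sigma(\varphi)$ for $\varphi\in k[z]$. $p=\sum_{i=0}^n a_iz^{n-i}\in k[z]$, $a_0\ne0$, has degree $n\ge1$ and no multiple roots (i.e. $p$ is coprime to its derivative $p'$). $\ell:=\min\{j\mid ja_j\ne0 \text{ in } k\}$ (used only when $p\nsim z$). For polynomials, $\varphi\sim\psi$ means $\varphi=c\psi$ for some nonzero $c\in k$. $A=k\langle x,y,z\mid xz=qzx,\ yz=q^{-1}zy,\ yx=p,\ xy=\widetilde p\rangle$. Notation. $\otimes=\otimes_k$, $A^e=A\otimes A^{\mathrm{op}}$ acts on $A$ by $(a\otimes b)m=amb$. Let $\mathfrak d\colon k[z]\to k[z]\otimes k[z]$ be linear with $\mathfrak d(1)=0$, $\mathfrak d(z^i)=\sum_{j=1}^iz^{i-j}\otimes z^{j-1}$ for $i\ge1$; write $\mathfrak d(p)=p_1\otimes p_2$ (summation understood), so e.g. $\widetilde{p_1}\otimes p_2=(\sigma\otimes\mathrm{id})\mathfrak d(p)$. Complex. $\mathcal S$ is the cochain complex $A\xrightarrow{d^0}A^3\xrightarrow{d^1}A^4\xrightarrow{d^2}A^4\xrightarrow{d^3}A^4\to\cdots$ starting in degree $0$ (elements are column vectors, matrices over $A^e$ act by left multiplication), with $$d^0=\begin{bmatrix}x\otimes1-1\otimes x\\ y\otimes1-1\otimes y\\ z\otimes1-1\otimes z\end{bmatrix},\quad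 d^1=\begin{bmatrix}y\otimes1&1\otimes x&-p_1\otimes p_2\\ 1\otimes y&x\otimes1&-q\widetilde{p_1}\otimes\widetilde{p_2}\\ \widetilde z\otimes1-1\otimes z&0&q\otimes x-x\otimes1\\ 0&z\otimes1-1\otimes\widetilde z&1\otimes y-y\otimes q\end{bmatrix},$$ $$d^2=\begin{bmatrix}x\otimes1&-1\otimes x&-\widetilde{p_1}\otimes p_2&0\\ -1\otimes y&y\otimes1&0&-p_1\otimes\widetilde{p_2}\\ z\otimes1-1\otimes z&0&-y\otimes1&-1\otimes x\\ 0&\widetilde z\otimes1-1\otimes\widetilde z&-1\otimes y&-x\otimes1\end{bmatrix},$$ $$d^3=\begin{bmatrix}y\otimes1&1\otimes x&-p_1\otimes p_2&0\\ 1\otimes y&x\otimes1&0&-\widetilde{p_1}\otimes\widetilde{p_2}\\ \widetilde z\otimes1-1\otimes z&0&-x\otimes1&1\otimes x\\ 0&z\otimes1-1\otimes\widetilde z&1\otimes y&-y\otimes1\end{bmatrix},$$ and $d^i=d^{i-2}$ for $i\ge4$. (Its cohomology is the Hochschild cohomology $\mathrm{Ext}^\bullet_{A^e}(A,A)$ of $A$.) *)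

theory Defs
  imports
    "Jordan_Normal_Form.VS_Connect"
    "HOL-Library.Poly_Mapping"
    "HOL-Computational_Algebra.Polynomial_Factorial"
    "HOL-Algebra.QuotRing"
begin

section \<open>Cohomology of a cochain complex of vector spaces\<close>

text \<open>
  Vector spaces over a field type \<open>'k\<close> are module records over \<^const>\<open>class_ring\<close>.
  The fields \<open>mult\<close> and \<open>one\<close>, which module records inherit from ring records, play no role
  in a vector space and are left undefined.
\<close>

definition power_space :: "('k, 'a) module \<Rightarrow> nat \<Rightarrow> ('k, 'a list) module" where
  "power_space A m =
    \<lparr>carrier = {v. length v = m \<and> set v \<subseteq> carrier A},
     monoid.mult = undefined, one = undefined,
     zero = replicate m \<zero>\<^bsub>A\<^esub>,
     add = map2 (\<lambda>a b. a \<oplus>\<^bsub>A\<^esub> b),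
     smult = (\<lambda>c. map (\<lambda>a. c \<odot>\<^bsub>A\<^esub> a))\<rparr>"

definition quotient_space :: "('k, 'v) module \<Rightarrow> 'v set \<Rightarrow> ('k, 'v set) module" where
  "quotient_space V W =
    \<lparr>carrier = a_rcosets\<^bsub>V\<^esub> W,
     monoid.mult = undefined, one = undefined,
     zero = W,
     add = (\<lambda>S T. S <+>\<^bsub>V\<^esub> T),
     smult = (\<lambda>c S. W <+>\<^bsub>V\<^esub> ((\<lambda>v. c \<odot>\<^bsub>V\<^esub> v) ` S))\<rparr>"

text \<open>A cochain complex starting in degree 0 is given by its terms \<open>C i\<close> and its
  differentials \<open>d i : C i \<rightarrow> C (i + 1)\<close>.\<close>

definition cocycles :: "(nat \<Rightarrow> ('k, 'v) module) \<Rightarrow> (nat \<Rightarrow> 'v \<Rightarrow> 'v) \<Rightarrow> nat \<Rightarrow> 'v set" where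
  "cocycles C d i = {v \<in> carrier (C i). d i v = \<zero>\<^bsub>C (Suc i)\<^esub>}"

fun coboundaries :: "(nat \<Rightarrow> ('k, 'v) module) \<Rightarrow> (nat \<Rightarrow> 'v \<Rightarrow> 'v) \<Rightarrow> nat \<Rightarrow> 'v set" where
  "coboundaries C d 0 = {\<zero>\<^bsub>C 0\<^esub>}"
| "coboundaries C d (Suc i) = d i ` carrier (C i)"

definition cohomology ::
    "(nat \<Rightarrow> ('k, 'v) module) \<Rightarrow> (nat \<Rightarrow> 'v \<Rightarrow> 'v) \<Rightarrow> nat \<Rightarrow> ('k, 'v set) module" where
  "cohomology C d i =
    quotient_space ((C i)\<lparr>carrier := cocycles C d i\<rparr>) (coboundaries C d i)"

definition cohomology_class ::
    "(nat \<Rightarrow> ('k, 'v) module) \<Rightarrow> (nat \<Rightarrow> 'v \<Rightarrow> 'v) \<Rightarrow> nat \<Rightarrow> 'v \<Rightarrow> 'v set" where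
  "cohomology_class C d i v = coboundaries C d i +>\<^bsub>C i\<^esub> v"

text \<open>The cocycles in \<open>S\<close> have pairwise different classes, and these form a basis.\<close>

definition represents_basis ::
    "(nat \<Rightarrow> ('k::field, 'v) module) \<Rightarrow> (nat \<Rightarrow> 'v \<Rightarrow> 'v) \<Rightarrow> nat \<Rightarrow> 'v set \<Rightarrow> bool" where
  "represents_basis C d i S \<longleftrightarrow>
    S \<subseteq> cocycles C d i \<and>
    inj_on (cohomology_class C d i) S \<and>
    vectorspace.basis class_ring (cohomology C d i) (cohomology_class C d i ` S)"


section \<open>The generalized Weyl algebra\<close>

text \<open>The free algebra \<open>k\<langle>x, y, z\<rangle>\<close> is the monoid algebra of the free monoid: finitely supported
  functions on words with the convolution product of \<^theory>\<open>HOL-Library.Poly_Mapping\<close>.\<close>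

datatype 'g word = Word (letters: "'g list")

instantiation word :: (type) monoid_add
begin

definition "0 = Word []"

definition "v + w = Word (letters v @ letters w)"

instance
  by standard (auto simp: zero_word_def plus_word_def)

end

datatype gen = GX | GY | GZ

type_synonym 'k falg = "gen word \<Rightarrow>\<^sub>0 'k"

definition falg_gen :: "gen \<Rightarrow> 'k::field falg" where
  "falg_gen g = Poly_Mapping.single (Word [g]) 1"

definition falg_const :: "'k::field \<Rightarrow> 'k falg" where
  "falg_const c = Poly_Mapping.single 0 c"

definition falg_poly :: "'k::field poly \<Rightarrow> 'k falg" where
  "falg_poly f = (\<Sum>i\<le>degree f. falg_const (coeff f i) * falg_gen GZ ^ i)"

definition twist :: "'k::field \<Rightarrow> 'k poly \<Rightarrow> 'k poly" where
  "twist q f = pcompose f [:0, q:]"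

definition gwa_ideal :: "'k::field \<Rightarrow> 'k poly \<Rightarrow> 'k falg set" where
  "gwa_ideal q p =
    (let x = falg_gen GX; y = falg_gen GY; z = falg_gen GZ
     in genideal class_ring
       {x * z - falg_const q * z * x,
        y * z - falg_const (inverse q) * z * y,
        y * x - falg_poly p,
        x * y - falg_poly (twist q p)})"

definition gwa_class :: "'k::field \<Rightarrow> 'k poly \<Rightarrow> 'k falg \<Rightarrow> 'k falg set" where
  "gwa_class q p a = gwa_ideal q p +>\<^bsub>class_ring\<^esub> a"

definition gwa :: "'k::field \<Rightarrow> 'k poly \<Rightarrow> ('k, 'k falg set) module" where
  "gwa q p =
    (let Q = class_ring Quot gwa_ideal q p
     in \<lparr>carrier = carrier Q, monoid.mult = monoid.mult Q, one = one Q, zero = zero Q, add = add Q,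
         smult = (\<lambda>c a. gwa_class q p (falg_const c) \<otimes>\<^bsub>Q\<^esub> a)\<rparr>)"

definition gwa_x :: "'k::field \<Rightarrow> 'k poly \<Rightarrow> 'k falg set" where
  "gwa_x q p = gwa_class q p (falg_gen GX)"

definition gwa_y :: "'k::field \<Rightarrow> 'k poly \<Rightarrow> 'k falg set" where
  "gwa_y q p = gwa_class q p (falg_gen GY)"

definition gwa_z :: "'k::field \<Rightarrow> 'k poly \<Rightarrow> 'k falg set" where
  "gwa_z q p = gwa_class q p (falg_gen GZ)"

text \<open>The image of a polynomial in \<open>z\<close>.\<close>

definition gwa_poly :: "'k::field \<Rightarrow> 'k poly \<Rightarrow> 'k poly \<Rightarrow> 'k falg set" where
  "gwa_poly q p f = gwa_class q p (falg_poly f)"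


section \<open>Tensors and their action\<close>

text \<open>An element of \<open>M \<otimes> N\<close> is written as a formal \<open>k\<close>-linear combination of pairs \<open>(m, n)\<close>, that is,
  by a representative in the free vector space on \<open>M \<times> N\<close> of which \<open>M \<otimes> N\<close> is a quotient. The
  action of \<open>A \<otimes> A\<^sup>o\<^sup>p\<close> on \<open>A\<close> does not depend on the representative.\<close>

type_synonym ('k, 'm, 'n) tensor = "('m \<times> 'n) \<Rightarrow>\<^sub>0 'k"

definition pure_tensor :: "'m \<Rightarrow> 'n \<Rightarrow> ('k::field, 'm, 'n) tensor"  (infix \<open>\<boxtimes>\<close> 75) where
  "m \<boxtimes> n = Poly_Mapping.single (m, n) 1"

definition tensor_map ::
    "('m \<Rightarrow> 'm') \<Rightarrow> ('n \<Rightarrow> 'n') \<Rightarrow> ('k::field, 'm, 'n) tensor \<Rightarrow> ('k, 'm', 'n') tensor" where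
  "tensor_map f g t =
    (\<Sum>(m, n)\<in>Poly_Mapping.keys t. Poly_Mapping.single (f m, g n) (Poly_Mapping.lookup t (m, n)))"

definition tensor_act :: "('k::field, 'a) module \<Rightarrow> ('k, 'a, 'a) tensor \<Rightarrow> 'a \<Rightarrow> 'a" where
  "tensor_act A t m =
    (\<Oplus>\<^bsub>A\<^esub>s\<in>Poly_Mapping.keys t. Poly_Mapping.lookup t s \<odot>\<^bsub>A\<^esub> (fst s \<otimes>\<^bsub>A\<^esub> m \<otimes>\<^bsub>A\<^esub> snd s))"

text \<open>Matrices are lists of rows and act on column vectors from the left.\<close>

definition matrix_act ::
    "('k::field, 'a) module \<Rightarrow> ('k, 'a, 'a) tensor list list \<Rightarrow> 'a list \<Rightarrow> 'a list" where
  "matrix_act A M v =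
    map (\<lambda>row. foldr (\<lambda>a b. a \<oplus>\<^bsub>A\<^esub> b) (map2 (tensor_act A) row v) \<zero>\<^bsub>A\<^esub>) M"

text \<open>The linear map with \<open>z\<^sup>i \<mapsto> \<Sum>j=1..i. z\<^sup>i\<^sup>-\<^sup>j \<otimes> z\<^sup>j\<^sup>-\<^sup>1\<close>.\<close>

definition poly_delta :: "'k::field poly \<Rightarrow> ('k, 'k poly, 'k poly) tensor" where
  "poly_delta f =
    (\<Sum>i\<le>degree f. \<Sum>j=1..i. Poly_Mapping.single (monom 1 (i - j), monom 1 (j - 1)) (coeff f i))"


section \<open>The complex\<close>

context
  fixes q :: "'k::field" and p :: "'k poly"
begin

text \<open>The tensor \<open>f(p\<^sub>1) \<otimes> g(p\<^sub>2)\<close> over the algebra, where \<open>p\<^sub>1 \<otimes> p\<^sub>2\<close> is \<^const>\<open>poly_delta\<close> of \<open>p\<close>.\<close>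

definition delta_tensor ::
    "('k poly \<Rightarrow> 'k poly) \<Rightarrow> ('k poly \<Rightarrow> 'k poly) \<Rightarrow> ('k, 'k falg set, 'k falg set) tensor" where
  "delta_tensor f g =
    tensor_map (\<lambda>a. gwa_poly q p (f a)) (\<lambda>b. gwa_poly q p (g b)) (poly_delta p)"

definition diff0 :: "('k, 'k falg set, 'k falg set) tensor list list" where
  "diff0 =
    (let x = gwa_x q p; y = gwa_y q p; z = gwa_z q p; e = \<one>\<^bsub>gwa q p\<^esub> in
     [[x \<boxtimes> e - e \<boxtimes> x],
      [y \<boxtimes> e - e \<boxtimes> y],
      [z \<boxtimes> e - e \<boxtimes> z]])"

definition diff1 :: "('k, 'k falg set, 'k falg set) tensor list list" where
  "diff1 =
    (let x = gwa_x q p; y = gwa_y q p; z = gwa_z q p; e = \<one>\<^bsub>gwa q p\<^esub>;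
         \<sigma> = twist q; z' = gwa_poly q p (\<sigma> [:0, 1:]); c = gwa_poly q p [:q:] in
     [[y \<boxtimes> e,          e \<boxtimes> x,          - delta_tensor id id],
      [e \<boxtimes> y,          x \<boxtimes> e,          - delta_tensor (\<lambda>f. Polynomial.smult q (\<sigma> f)) \<sigma>],
      [z' \<boxtimes> e - e \<boxtimes> z, 0,              c \<boxtimes> x - x \<boxtimes> e],
      [0,              z \<boxtimes> e - e \<boxtimes> z', e \<boxtimes> y - y \<boxtimes> c]])"

definition diff2 :: "('k, 'k falg set, 'k falg set) tensor list list" where
  "diff2 =
    (let x = gwa_x q p; y = gwa_y q p; z = gwa_z q p; e = \<one>\<^bsub>gwa q p\<^esub>;
         \<sigma> = twist q; z' = gwa_poly q p (\<sigma> [:0, 1:]) in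
     [[x \<boxtimes> e,         - (e \<boxtimes> x),        - delta_tensor \<sigma> id, 0],
      [- (e \<boxtimes> y),     y \<boxtimes> e,            0,                   - delta_tensor id \<sigma>],
      [z \<boxtimes> e - e \<boxtimes> z, 0,                - (y \<boxtimes> e),           - (e \<boxtimes> x)],
      [0,             z' \<boxtimes> e - e \<boxtimes> z',  - (e \<boxtimes> y),           - (x \<boxtimes> e)]])"

definition diff3 :: "('k, 'k falg set, 'k falg set) tensor list list" where
  "diff3 =
    (let x = gwa_x q p; y = gwa_y q p; z = gwa_z q p; e = \<one>\<^bsub>gwa q p\<^esub>;
         \<sigma> = twist q; z' = gwa_poly q p (\<sigma> [:0, 1:]) in
     [[y \<boxtimes> e,          e \<boxtimes> x,          - delta_tensor id id, 0],
      [e \<boxtimes> y,          x \<boxtimes> e,          0,                   - delta_tensor \<sigma> \<sigma>],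
      [z' \<boxtimes> e - e \<boxtimes> z, 0,              - (x \<boxtimes> e),           e \<boxtimes> x],
      [0,              z \<boxtimes> e - e \<boxtimes> z', e \<boxtimes> y,               - (y \<boxtimes> e)]])"

fun S_matrix :: "nat \<Rightarrow> ('k, 'k falg set, 'k falg set) tensor list list" where
  "S_matrix 0 = diff0"
| "S_matrix (Suc 0) = diff1"
| "S_matrix (Suc (Suc 0)) = diff2"
| "S_matrix (Suc (Suc (Suc 0))) = diff3"
| "S_matrix (Suc (Suc (Suc (Suc i)))) = S_matrix (Suc (Suc i))"

definition S_term :: "nat \<Rightarrow> ('k, 'k falg set list) module" where
  "S_term i = power_space (gwa q p) (if i = 0 then 1 else if i = 1 then 3 else 4)"

definition S_diff :: "nat \<Rightarrow> 'k falg set list \<Rightarrow> 'k falg set list" where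
  "S_diff i = matrix_act (gwa q p) (S_matrix i)"

end


section \<open>Polynomials\<close>

definition poly_similar :: "'k::field poly \<Rightarrow> 'k poly \<Rightarrow> bool"  (infix \<open>\<sim>\<^sub>p\<close> 50) where
  "f \<sim>\<^sub>p g \<longleftrightarrow> (\<exists>c. c \<noteq> 0 \<and> f = Polynomial.smult c g)"

text \<open>Here \<open>a\<^sub>j\<close> is the coefficient of \<open>z\<^sup>n\<^sup>-\<^sup>j\<close>; the bound \<open>j \<le> n\<close> keeps the truncated subtraction
  from producing spurious coefficients. A suitable \<open>j\<close> exists if \<open>p\<close> is coprime to its derivative
  and not similar to \<open>z\<close>.\<close>

definition ell :: "'k::field poly \<Rightarrow> nat" where
  "ell p = (LEAST j. j \<le> degree p \<and> of_nat j * coeff p (degree p - j) \<noteq> 0)"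

end

theory Submission
  imports Defs
begin

text \<open>
  Commuting generators past each other shows that the generalized Weyl algebra \<open>A\<close> is spanned over
  \<open>k[z]\<close> by the elements \<open>u\<^sub>m\<close> with \<open>u\<^sub>m = x\<^sup>m\<close> for \<open>m \<ge> 0\<close> and \<open>u\<^sub>m = y\<^sup>-\<^sup>m\<close> for \<open>m < 0\<close>; they are a basis,
  because the free module on them carries commuting left and right actions of \<open>x\<close>, \<open>y\<close>, \<open>z\<close>
  satisfying the relations of \<open>A\<close>. The complex is thereby graded by weight, and its weight \<open>m\<close> part
  consists of copies of \<open>k[z]\<close>.

  In weight \<open>m \<noteq> 0\<close>, the commutator with \<open>z\<close> is multiplication by \<open>(1 - q\<^sup>m)z\<close>, and \<open>x\<close> (if \<open>m > 0\<close>) or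
  \<open>y\<close> (if \<open>m < 0\<close>) acts bijectively. Hence two components of any cocycle can be removed, up to a constant,
  by subtracting a coboundary, and the cocycle condition then kills everything that is left. In
  degrees at least 3 the same argument works in weight 0, where the missing bijectivity is
  replaced by a Bezout relation between \<open>p\<close> and \<open>p'\<close>. In weight 0 and degrees 1 and 2, comparing coefficients in
  \<open>\<sigma>(e) - e\<close> and \<open>q e - \<sigma>(e)\<close> leaves a constant, a multiple of \<open>z\<close>, and in degree 2 the quotient of \<open>k[z]/(p)\<close> by the line
  spanned by \<open>z p'\<close>, whose representative \<open>n p - z p'\<close> modulo \<open>p\<close> has degree \<open>n - \<ell>\<close>.
\<close>

section \<open>Bases of the cohomology of a complex of vector spaces\<close>

text \<open>From degree 2 on, exactness in a fixed weight is obtained by one device. A coboundary is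
  built that matches the given cocycle in two components. Since consecutive differentials compose to
  zero (\<open>wt_complex\<close>), it is a cocycle too, and cocycles that agree in the right two
  components are equal (\<open>wt2_unique\<close>, \<open>wt3_unique\<close>), so the other
  components are never computed. That consecutive differentials compose to zero rests on one
  identity, p - \<sigma>^m(p) = (1 - q^m) z * \<open>delta m\<close>, where \<open>delta m\<close>
  is the q^m-derivative of p. In weight 0 it degenerates to 0 = 0 and \<open>delta 0\<close> is p';
  this is why p' and its coprimality to p matter there. The case split comes from the question
  whether z p' lies in (p). As p' is invertible modulo p, this holds exactly if p divides z. In that
  case z can occur as third component of a cocycle of degree 1, and the line spanned by z p' is
  already zero in k[z]/(p). Degree 2 behaves differently from the higher degrees because its
  incoming differential has one argument \<open>h\<close> where the later ones have two independent
  arguments.\<close>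

lemma submodule_abelian_subgroup:
  assumes "submodule class_ring W (V :: ('k::field, 'v) module)"
  shows "abelian_subgroup W V"
proof -
  interpret W: submodule class_ring W V by fact
  interpret Module.module class_ring V by (rule W.module)
  have neg: "\<ominus>\<^bsub>V\<^esub> w \<in> W" if "w \<in> W" for w
  proof -
    have w: "w \<in> carrier V"
      using that W.subset by blast
    then have "\<ominus>\<^bsub>V\<^esub> w = (-1) \<odot>\<^bsub>V\<^esub> w"
      using smult_l_minus[of 1 w] by (simp only: class_ring_simps smult_one[simplified] UNIV_I)
    moreover have "(-1) \<odot>\<^bsub>V\<^esub> w \<in> W"
      using that by (intro W.smult_closed) auto
    ultimately show ?thesis
      by simp
  qed
  have "additive_subgroup W V"
    by (intro additive_subgroupI subgroup.intro)
      (use W.subset neg in \<open>auto simp: a_inv_def[symmetric]\<close>)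
  then show ?thesis
    by (rule abelian_subgroupI3) (rule abelian_group_axioms)
qed

context
  fixes V :: "('k::field, 'v) module" and W :: "'v set"
  assumes sub: "submodule class_ring W V"
begin

lemma module_ambient: "Module.module class_ring V"
  using sub by (simp add: submodule_def)

text \<open>Adding \<open>W\<close> once more in the scalar multiplication of
  \<open>quotient_space\<close> matters for c = 0: there the scaled coset is a single point, while
  for c nonzero it already is a coset.\<close>

lemma quotient_space_coset:
  "carrier (quotient_space V W) = (\<lambda>v. W +>\<^bsub>V\<^esub> v) ` carrier V"
  "\<zero>\<^bsub>quotient_space V W\<^esub> = W"
  "\<lbrakk>u \<in> carrier V; v \<in> carrier V\<rbrakk> \<Longrightarrow>
    (W +>\<^bsub>V\<^esub> u) \<oplus>\<^bsub>quotient_space V W\<^esub> (W +>\<^bsub>V\<^esub> v) = W +>\<^bsub>V\<^esub> (u \<oplus>\<^bsub>V\<^esub> v)"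
  "v \<in> carrier V \<Longrightarrow> c \<odot>\<^bsub>quotient_space V W\<^esub> (W +>\<^bsub>V\<^esub> v) = W +>\<^bsub>V\<^esub> (c \<odot>\<^bsub>V\<^esub> v)"
proof -
  interpret V: Module.module class_ring V by (rule module_ambient)
  interpret W: abelian_subgroup W V by (rule submodule_abelian_subgroup[OF sub])
  interpret W: submodule class_ring W V by (rule sub)
  show "carrier (quotient_space V W) = (\<lambda>v. W +>\<^bsub>V\<^esub> v) ` carrier V"
    by (auto simp: quotient_space_def A_RCOSETS_defs a_r_coset_defs)
  show "\<zero>\<^bsub>quotient_space V W\<^esub> = W"
    by (simp add: quotient_space_def)
  show "(W +>\<^bsub>V\<^esub> u) \<oplus>\<^bsub>quotient_space V W\<^esub> (W +>\<^bsub>V\<^esub> v) = W +>\<^bsub>V\<^esub> (u \<oplus>\<^bsub>V\<^esub> v)"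
    if "u \<in> carrier V" "v \<in> carrier V"
    using that by (simp add: quotient_space_def W.a_rcos_sum)
  show "c \<odot>\<^bsub>quotient_space V W\<^esub> (W +>\<^bsub>V\<^esub> v) = W +>\<^bsub>V\<^esub> (c \<odot>\<^bsub>V\<^esub> v)"
    if v: "v \<in> carrier V"
  proof -
    have eq: "w \<oplus>\<^bsub>V\<^esub> c \<odot>\<^bsub>V\<^esub> (w' \<oplus>\<^bsub>V\<^esub> v) = (w \<oplus>\<^bsub>V\<^esub> c \<odot>\<^bsub>V\<^esub> w') \<oplus>\<^bsub>V\<^esub> c \<odot>\<^bsub>V\<^esub> v"
      if "w \<in> W" "w' \<in> W" for w w'
      using that v W.subset by (auto simp: V.smult_r_distr V.a_assoc subset_iff)
    have "W <+>\<^bsub>V\<^esub> ((\<lambda>v. c \<odot>\<^bsub>V\<^esub> v) ` (W +>\<^bsub>V\<^esub> v)) = W +>\<^bsub>V\<^esub> (c \<odot>\<^bsub>V\<^esub> v)"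
    proof (intro equalityI subsetI)
      fix a assume "a \<in> W <+>\<^bsub>V\<^esub> ((\<lambda>v. c \<odot>\<^bsub>V\<^esub> v) ` (W +>\<^bsub>V\<^esub> v))"
      then obtain w w' where "w \<in> W" "w' \<in> W" "a = w \<oplus>\<^bsub>V\<^esub> c \<odot>\<^bsub>V\<^esub> (w' \<oplus>\<^bsub>V\<^esub> v)"
        by (auto simp: set_add_def' a_r_coset_def')
      then show "a \<in> W +>\<^bsub>V\<^esub> (c \<odot>\<^bsub>V\<^esub> v)"
        using eq W.m_closed W.smult_closed by (fastforce simp: a_r_coset_def')
    next
      fix a assume "a \<in> W +>\<^bsub>V\<^esub> (c \<odot>\<^bsub>V\<^esub> v)"
      then obtain w where w: "w \<in> W" "a = w \<oplus>\<^bsub>V\<^esub> c \<odot>\<^bsub>V\<^esub> v"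
        by (auto simp: a_r_coset_def')
      then have "a = w \<oplus>\<^bsub>V\<^esub> c \<odot>\<^bsub>V\<^esub> (\<zero>\<^bsub>V\<^esub> \<oplus>\<^bsub>V\<^esub> v)"
        using v by simp
      then show "a \<in> W <+>\<^bsub>V\<^esub> ((\<lambda>v. c \<odot>\<^bsub>V\<^esub> v) ` (W +>\<^bsub>V\<^esub> v))"
        using w W.zero_closed unfolding set_add_def' a_r_coset_def' by blast
    qed
    then show ?thesis
      by (simp add: quotient_space_def)
  qed
qed

lemma vectorspace_quotient_space: "vectorspace class_ring (quotient_space V W)"
proof -
  interpret V: Module.module class_ring V by (rule module_ambient)
  interpret W: abelian_subgroup W V by (rule submodule_abelian_subgroup[OF sub])
  note Q = quotient_space_coset
  have "abelian_group (quotient_space V W)"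
  proof (rule abelian_groupI)
    have W: "W = W +>\<^bsub>V\<^esub> \<zero>\<^bsub>V\<^esub>"
      using W.a_subset V.a_coset_add_zero by simp
    then show "\<zero>\<^bsub>quotient_space V W\<^esub> \<in> carrier (quotient_space V W)"
      by (auto simp: Q)
    show "\<zero>\<^bsub>quotient_space V W\<^esub> \<oplus>\<^bsub>quotient_space V W\<^esub> x = x"
      if "x \<in> carrier (quotient_space V W)" for x
      using that by (subst Q(2), subst W) (auto simp: Q(1,3))
    show "\<exists>y\<in>carrier (quotient_space V W). y \<oplus>\<^bsub>quotient_space V W\<^esub> x = \<zero>\<^bsub>quotient_space V W\<^esub>"
      if x: "x \<in> carrier (quotient_space V W)" for x
    proof -
      obtain v where v: "v \<in> carrier V" "x = W +>\<^bsub>V\<^esub> v"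
        using x by (auto simp: Q)
      then have "(W +>\<^bsub>V\<^esub> (\<ominus>\<^bsub>V\<^esub> v)) \<oplus>\<^bsub>quotient_space V W\<^esub> x = \<zero>\<^bsub>quotient_space V W\<^esub>"
        using W by (simp add: Q V.l_neg)
      then show ?thesis
        using v by (auto simp: Q)
    qed
  qed (auto simp: Q V.a_ac)
  then have "Module.module class_ring (quotient_space V W)"
    by (intro moduleI) (auto simp: Q V.smult_l_distr[simplified] V.smult_r_distr
        V.smult_assoc1[simplified] V.smult_one[simplified] class_cring.is_cring
        V.smult_closed[simplified])
  then show ?thesis
    unfolding vectorspace_def using class_field by blast
qed

lemma quotient_space_finsum:
  assumes "finite I" "\<And>i. i \<in> I \<Longrightarrow> f i \<in> carrier V"
  shows "(\<Oplus>\<^bsub>quotient_space V W\<^esub>i\<in>I. W +>\<^bsub>V\<^esub> f i) = W +>\<^bsub>V\<^esub> (\<Oplus>\<^bsub>V\<^esub>i\<in>I. f i)"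
proof -
  interpret V: Module.module class_ring V by (rule module_ambient)
  interpret W: abelian_subgroup W V by (rule submodule_abelian_subgroup[OF sub])
  interpret Q: vectorspace class_ring "quotient_space V W"
    by (rule vectorspace_quotient_space)
  note Q = quotient_space_coset
  show ?thesis
    using assms
  proof (induction I)
    case empty
    have "W +>\<^bsub>V\<^esub> \<zero>\<^bsub>V\<^esub> = W"
      using W.a_subset V.a_coset_add_zero by blast
    then show ?case
      by (simp add: Q)
  next
    case (insert i I)
    have "f i \<in> carrier V" "f \<in> I \<rightarrow> carrier V"
      using insert.prems by auto
    then show ?case
      using insert by (subst Q.M.finsum_insert) (auto simp: Q)
  qed
qed

end

lemma coset_eq_subgroup_iff:
  assumes "abelian_subgroup W V" "v \<in> carrier V"
  shows "W +>\<^bsub>V\<^esub> v = W \<longleftrightarrow> v \<in> W"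
  using assms abelian_subgroup.a_rcos_const abelian_subgroup.a_rcos_self by metis

text \<open>The representatives are given as an indexed family so that the injectivity of their
  classes can be deduced: if two indices had the same class, the combination with coefficients 1 and
  -1 would be a coboundary, against \<open>indep\<close>.\<close>

lemma represents_basisI:
  fixes C :: "nat \<Rightarrow> ('k::field, 'v) module" and d n
  defines "Z \<equiv> cocycles C d n" and "B \<equiv> coboundaries C d n"
  assumes Z: "submodule class_ring Z (C n)"
    and B: "submodule class_ring B (C n)"
    and BZ: "B \<subseteq> Z"
    and fin: "finite I" and e: "\<And>i. i \<in> I \<Longrightarrow> e i \<in> Z"
    and span: "\<And>v. v \<in> Z \<Longrightarrow>
      \<exists>b\<in>B. \<exists>c. v = b \<oplus>\<^bsub>C n\<^esub> (\<Oplus>\<^bsub>C n\<^esub>i\<in>I. c i \<odot>\<^bsub>C n\<^esub> e i)"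
    and indep: "\<And>c i. (\<Oplus>\<^bsub>C n\<^esub>i\<in>I. c i \<odot>\<^bsub>C n\<^esub> e i) \<in> B \<Longrightarrow> i \<in> I \<Longrightarrow> c i = 0"
  shows "represents_basis C d n (e ` I)"
proof -
  define V where "V = (C n)\<lparr>carrier := Z\<rparr>"
  define Q where "Q = quotient_space V B"
  interpret C: Module.module class_ring "C n"
    using Z by (simp add: submodule_def)
  have C_V: "carrier V = Z" "\<zero>\<^bsub>V\<^esub> = \<zero>\<^bsub>C n\<^esub>" "(\<oplus>\<^bsub>V\<^esub>) = (\<oplus>\<^bsub>C n\<^esub>)" "(\<odot>\<^bsub>V\<^esub>) = (\<odot>\<^bsub>C n\<^esub>)"
    by (simp_all add: V_def)
  have "Module.module class_ring V"
    using C.submodule_is_module[OF Z] by (simp add: V_def)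
  then interpret V: Module.module class_ring V .
  have B_V: "submodule class_ring B V"
    using B BZ \<open>Module.module class_ring V\<close> by (auto simp: submodule_def V_def)
  interpret B: abelian_subgroup B V
    by (rule submodule_abelian_subgroup[OF B_V])
  interpret Q: vectorspace class_ring Q
    unfolding Q_def by (rule vectorspace_quotient_space[OF B_V])
  note coset = quotient_space_coset[OF B_V, folded Q_def]
  define \<pi> where "\<pi> v = B +>\<^bsub>V\<^esub> v" for v
  have coh: "cohomology C d n = Q" "cohomology_class C d n = \<pi>"
    by (simp_all add: fun_eq_iff cohomology_def cohomology_class_def Q_def V_def \<pi>_def Z_def B_def
        a_r_coset_def')
  have ce: "c i \<odot>\<^bsub>V\<^esub> e i \<in> carrier V" if "i \<in> I" for c i
    using V.smult_closed[simplified] that e C_V by auto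
  \<comment> \<open>The value of \<open>finsum\<close> depends on the carrier of the record, so sums
    formed in \<open>C n\<close> and sums formed in its subspace of cocycles have to be identified
    by induction.\<close>
  have finsum_V: "(\<Oplus>\<^bsub>C n\<^esub>i\<in>J. c i \<odot>\<^bsub>C n\<^esub> e i) = (\<Oplus>\<^bsub>V\<^esub>i\<in>J. c i \<odot>\<^bsub>V\<^esub> e i)" if "J \<subseteq> I" for c J
  proof -
    have "finite J"
      using that fin finite_subset by blast
    then show ?thesis
      using that
    proof (induction J)
      case (insert i J)
      have "Z \<subseteq> carrier (C n)"
        using Z by (simp add: submodule_def)
      then show ?case
        using insert ce C_V by (simp add: Pi_iff subset_iff)
    qed (simp add: C_V)
  qed
  have lc: "(\<Oplus>\<^bsub>Q\<^esub>i\<in>I. c i \<odot>\<^bsub>Q\<^esub> \<pi> (e i)) = \<pi> (\<Oplus>\<^bsub>V\<^esub>i\<in>I. c i \<odot>\<^bsub>V\<^esub> e i)" for c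
  proof -
    have "(\<Oplus>\<^bsub>Q\<^esub>i\<in>I. c i \<odot>\<^bsub>Q\<^esub> \<pi> (e i)) = (\<Oplus>\<^bsub>Q\<^esub>i\<in>I. \<pi> (c i \<odot>\<^bsub>V\<^esub> e i))"
      by (rule Q.M.finsum_cong') (use e ce C_V coset in \<open>auto simp: \<pi>_def\<close>)
    then show ?thesis
      using quotient_space_finsum[OF B_V fin ce] by (simp add: \<pi>_def Q_def)
  qed
  have zero: "\<pi> v = \<zero>\<^bsub>Q\<^esub> \<longleftrightarrow> v \<in> B" if "v \<in> Z" for v
    using coset_eq_subgroup_iff[OF B.abelian_subgroup_axioms] that C_V by (simp add: \<pi>_def coset)
  have lin: "c i = 0" if "(\<Oplus>\<^bsub>Q\<^esub>i\<in>I. c i \<odot>\<^bsub>Q\<^esub> \<pi> (e i)) = \<zero>\<^bsub>Q\<^esub>" "i \<in> I" for c i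
  proof -
    have "(\<Oplus>\<^bsub>V\<^esub>i\<in>I. c i \<odot>\<^bsub>V\<^esub> e i) \<in> B"
      using that(1) ce V.M.finsum_closed[of _ I] unfolding lc
      by (subst zero[symmetric]) (auto simp: C_V)
    then show ?thesis
      using indep finsum_V that(2) by auto
  qed
  have car: "\<pi> (e k) \<in> carrier Q" if "k \<in> I" for k
    using that e C_V coset by (auto simp: \<pi>_def)
  have inj: "inj_on (\<lambda>i. \<pi> (e i)) I"
  proof (rule inj_onI, rule ccontr)
    fix i j assume ij: "i \<in> I" "j \<in> I" "\<pi> (e i) = \<pi> (e j)" "i \<noteq> j"
    define c where "c k = (if k = i then 1 else if k = j then -1 else 0 :: 'k)" for k
    have car': "c k \<odot>\<^bsub>Q\<^esub> \<pi> (e k) \<in> carrier Q" if "k \<in> I" for k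
      using Q.smult_closed[simplified] car that by auto
    define J where "J = I - {i, j}"
    define g where "g k = c k \<odot>\<^bsub>Q\<^esub> \<pi> (e k)" for k
    have g: "g k \<in> carrier Q" if "k \<in> I" for k
      using car' that by (simp add: g_def)
    have J: "I = insert i (insert j J)" "finite J" "i \<notin> insert j J" "j \<notin> J" "J \<subseteq> I"
      using ij fin by (auto simp: J_def)
    have "finsum Q g I = finsum Q g (insert i (insert j J))"
      using J(1) by simp
    also have "\<dots> = g i \<oplus>\<^bsub>Q\<^esub> finsum Q g (insert j J)"
      by (rule Q.M.finsum_insert) (use J ij g in auto)
    also have "finsum Q g (insert j J) = g j \<oplus>\<^bsub>Q\<^esub> finsum Q g J"
      by (rule Q.M.finsum_insert) (use J ij g in auto)
    also have "finsum Q g J = (\<Oplus>\<^bsub>Q\<^esub>k\<in>J. \<zero>\<^bsub>Q\<^esub>)"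
      using car Q.smult_l_null[simplified]
      by (intro Q.M.finsum_cong') (auto simp: c_def g_def J_def)
    also have "g i = \<pi> (e j)"
      using ij(3) Q.smult_one[OF car[OF ij(2)]] by (simp add: g_def c_def)
    also have "g j = \<ominus>\<^bsub>Q\<^esub> \<pi> (e j)"
    proof -
      have "g j = (-1) \<odot>\<^bsub>Q\<^esub> \<pi> (e j)"
        using ij(4) by (auto simp: g_def c_def)
      then show ?thesis
        using Q.smult_l_minus[of 1 "\<pi> (e j)"] Q.smult_one[OF car[OF ij(2)]] car[OF ij(2)]
        by (simp only: class_ring_simps UNIV_I)
    qed
    also have "\<pi> (e j) \<oplus>\<^bsub>Q\<^esub> (\<ominus>\<^bsub>Q\<^esub> \<pi> (e j) \<oplus>\<^bsub>Q\<^esub> (\<Oplus>\<^bsub>Q\<^esub>k\<in>J. \<zero>\<^bsub>Q\<^esub>)) = \<zero>\<^bsub>Q\<^esub>"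
      using car[OF ij(2)] by (simp add: Q.M.r_neg)
    finally have "(\<Oplus>\<^bsub>Q\<^esub>k\<in>I. c k \<odot>\<^bsub>Q\<^esub> \<pi> (e k)) = \<zero>\<^bsub>Q\<^esub>"
      by (simp add: g_def[abs_def])
    from lin[OF this ij(1)] show False
      by (simp add: c_def)
  qed
  have inj': "inj_on \<pi> (e ` I)"
    using inj by (auto simp: inj_on_def)
  have lincomb: "Q.lincomb a (\<pi> ` e ` I) = (\<Oplus>\<^bsub>Q\<^esub>i\<in>I. a (\<pi> (e i)) \<odot>\<^bsub>Q\<^esub> \<pi> (e i))" for a
    unfolding Q.lincomb_def image_image
    using inj car Q.smult_closed[simplified]
    by (subst Q.M.finsum_reindex) auto
  have sub: "\<pi> ` e ` I \<subseteq> carrier Q"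
    using e C_V coset by (auto simp: \<pi>_def)
  have "Q.basis (\<pi> ` e ` I)"
    unfolding Q.basis_def
  proof (intro conjI)
    show "Q.lin_indpt (\<pi> ` e ` I)"
      using fin sub lin unfolding lincomb by (intro Q.finite_lin_indpt2) (auto simp: lincomb)
    have "\<pi> v \<in> Q.span (\<pi> ` e ` I)" if v: "v \<in> Z" for v
    proof -
      obtain b c where bc: "b \<in> B" "v = b \<oplus>\<^bsub>C n\<^esub> (\<Oplus>\<^bsub>C n\<^esub>i\<in>I. c i \<odot>\<^bsub>C n\<^esub> e i)"
        using span[OF v] by blast
      define s where "s = (\<Oplus>\<^bsub>V\<^esub>i\<in>I. c i \<odot>\<^bsub>V\<^esub> e i)"
      have s: "s \<in> carrier V"
        unfolding s_def using ce by (intro V.M.finsum_closed) auto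
      have "v = b \<oplus>\<^bsub>V\<^esub> s"
        using bc finsum_V by (simp add: s_def C_V)
      then have "\<pi> v = \<pi> b \<oplus>\<^bsub>Q\<^esub> \<pi> s"
        using bc s BZ C_V coset(3)[of b s] by (auto simp: \<pi>_def)
      also have "\<pi> b = \<zero>\<^bsub>Q\<^esub>"
        using bc BZ zero by auto
      also have "\<zero>\<^bsub>Q\<^esub> \<oplus>\<^bsub>Q\<^esub> \<pi> s = \<pi> s"
        using s coset by (intro Q.M.l_zero) (auto simp: \<pi>_def)
      \<comment> \<open>Coefficients in \<open>lincomb\<close> are indexed by vectors; injectivity
        of the classes allows them to be read off from the indices.\<close>
      also have "\<pi> s = Q.lincomb (\<lambda>w. c (the_inv_into I (\<lambda>i. \<pi> (e i)) w)) (\<pi> ` e ` I)"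
        unfolding lincomb s_def lc[symmetric]
        using car the_inv_into_f_f[OF inj] Q.smult_closed[simplified]
        by (intro Q.M.finsum_cong') auto
      finally show ?thesis
        using fin unfolding Q.span_def by (auto simp: class_ring_simps)
    qed
    then show "Q.gen_set (\<pi> ` e ` I)"
      using Q.span_is_subset2[OF sub] C_V coset by (auto simp: \<pi>_def)
    show "\<pi> ` e ` I \<subseteq> carrier Q"
      by (rule sub)
  qed
  then show ?thesis
    using e inj' unfolding represents_basis_def coh by (auto simp: Z_def)
qed

lemma cohomology_trivialI:
  fixes C :: "nat \<Rightarrow> ('k::field, 'v) module"
  assumes B: "submodule class_ring (coboundaries C d n) (C n)"
    and eq: "cocycles C d n \<subseteq> coboundaries C d n"
    and zero: "\<zero>\<^bsub>C n\<^esub> \<in> cocycles C d n"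
  shows "carrier (cohomology C d n) = {\<zero>\<^bsub>cohomology C d n\<^esub>}"
proof -
  interpret B: abelian_subgroup "coboundaries C d n" "C n"
    by (rule submodule_abelian_subgroup[OF B])
  have "coboundaries C d n +>\<^bsub>C n\<^esub> v = coboundaries C d n" if "v \<in> cocycles C d n" for v
    using B.a_rcos_const that eq by auto
  moreover have "carrier (cohomology C d n) = (\<lambda>v. coboundaries C d n +>\<^bsub>C n\<^esub> v) ` cocycles C d n"
    by (auto simp: cohomology_def quotient_space_def A_RCOSETS_defs a_r_coset_defs)
  moreover have "\<zero>\<^bsub>cohomology C d n\<^esub> = coboundaries C d n"
    by (simp add: cohomology_def quotient_space_def)
  ultimately show ?thesis
    using zero by auto
qed

section \<open>The graded model\<close>

lemma twist_simps [simp]: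
  "twist q 0 = 0" "twist q 1 = 1" "twist q [:c:] = [:c:]"
  "twist q (f + g) = twist q f + twist q g"
  "twist q (f - g) = twist q f - twist q g"
  "twist q (- f) = - twist q f"
  "twist q (f * g) = twist q f * twist q g"
  "twist q (Polynomial.smult c f) = Polynomial.smult c (twist q f)"
  by (simp_all add: twist_def pcompose_1 pcompose_add pcompose_diff pcompose_uminus pcompose_mult
      pcompose_smult)

lemma coeff_twist [simp]: "coeff (twist q f) i = q ^ i * coeff f i"
  by (simp add: twist_def coeff_pcompose_linear)

lemma twist_twist [simp]: "twist a (twist b f) = twist (b * a) f"
  by (rule poly_eqI) (simp add: power_mult_distrib)

lemma twist_one [simp]: "twist 1 f = f"
  by (rule poly_eqI) simp

lemma poly_mapping_induct [case_names single add]: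
  assumes "\<And>k c. P (Poly_Mapping.single k c)" "\<And>a b. P a \<Longrightarrow> P b \<Longrightarrow> P (a + b)"
  shows "P (a :: 'a \<Rightarrow>\<^sub>0 'b::comm_monoid_add)"
proof -
  have zero: "P 0"
    using assms(1)[of undefined 0] by simp
  have "a = (\<Sum>k\<in>Poly_Mapping.keys a. Poly_Mapping.single k (Poly_Mapping.lookup a k))"
    by (rule poly_mapping_eqI)
      (simp add: lookup_sum lookup_single when_def in_keys_iff)
  moreover have "P (\<Sum>k\<in>K. Poly_Mapping.single k (Poly_Mapping.lookup a k))" if "finite K" for K
    using that by (induction K) (auto intro: assms zero)
  ultimately show ?thesis
    by (metis finite_keys)
qed

text \<open>The test for 0 keeps the support finite for every \<phi>. It disappears in
  \<open>lookup_graded_map\<close>, where \<phi> is assumed to preserve 0.\<close>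

lift_definition graded_map ::
    "int \<Rightarrow> (int \<Rightarrow> 'a::zero \<Rightarrow> 'b::zero) \<Rightarrow> (int \<Rightarrow>\<^sub>0 'a) \<Rightarrow> (int \<Rightarrow>\<^sub>0 'b)"
  is "\<lambda>j \<phi> F m. if F (m - j) = 0 then 0 else \<phi> m (F (m - j))"
proof -
  fix j :: int and \<phi> :: "int \<Rightarrow> 'a \<Rightarrow> 'b" and F :: "int \<Rightarrow> 'a"
  assume "finite {m. F m \<noteq> 0}"
  moreover have "{m. (if F (m - j) = 0 then 0 else \<phi> m (F (m - j))) \<noteq> 0} \<subseteq> (\<lambda>m. m + j) ` {m. F m \<noteq> 0}"
    by (auto split: if_splits intro!: image_eqI[of _ _ "_ - j"])
  ultimately show "finite {m. (if F (m - j) = 0 then 0 else \<phi> m (F (m - j))) \<noteq> 0}"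
    by (meson finite_imageI finite_subset)
qed

lemma lookup_graded_map:
  assumes "\<And>m. \<phi> m 0 = 0"
  shows "Poly_Mapping.lookup (graded_map j \<phi> F) m = \<phi> m (Poly_Mapping.lookup F (m - j))"
  using assms by transfer auto

text \<open>The free left \<open>k[z]\<close>-module on \<open>u\<^sub>m\<close> (\<open>m \<in> \<int>\<close>), where \<open>u\<^sub>m\<close> stands for \<open>x\<^sup>m\<close>
  if \<open>m \<ge> 0\<close> and for \<open>y\<^sup>-\<^sup>m\<close> otherwise.\<close>

type_synonym 'k graded = "int \<Rightarrow>\<^sub>0 'k poly"

locale gwa_data =
  fixes q :: "'k::field" and p :: "'k poly"
  assumes q_nonzero: "q \<noteq> 0"
begin

text \<open>This is the power \<sigma>^m with an integer exponent, as needed for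
  \<open>u_m f = \<sigma>^m(f) u_m\<close> with m of either sign.\<close>

definition tw :: "int \<Rightarrow> 'k poly \<Rightarrow> 'k poly" where
  "tw m = twist (q powi m)"

lemma tw_simps [simp]:
  "tw m 0 = 0" "tw m 1 = 1" "tw m [:c:] = [:c:]"
  "tw m (f + g) = tw m f + tw m g"
  "tw m (f - g) = tw m f - tw m g"
  "tw m (- f) = - tw m f"
  "tw m (f * g) = tw m f * tw m g"
  "tw m (Polynomial.smult c f) = Polynomial.smult c (tw m f)"
  "tw 0 f = f"
  "tw m (tw n f) = tw (m + n) f"
  by (simp_all add: tw_def power_int_add[of q m n] q_nonzero mult.commute)

lemma twist_eq_tw: "twist q = tw 1"
  by (simp add: tw_def)

text \<open>The products \<open>x u\<^sub>m\<^sub>-\<^sub>1 = \<sigma>(x_coeff m) u\<^sub>m\<close> and \<open>y u\<^sub>m\<^sub>+\<^sub>1 = y_coeff m u\<^sub>m\<close>.\<close>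

definition x_coeff :: "int \<Rightarrow> 'k poly" where
  "x_coeff m = (if m \<ge> 1 then 1 else p)"

definition y_coeff :: "int \<Rightarrow> 'k poly" where
  "y_coeff m = (if m \<le> -1 then 1 else p)"

text \<open>Of the two steps from weight m to m + 1 by x and back by y, exactly one cancels a pair
  of opposite letters and thereby produces p.\<close>

lemma x_coeff_y_coeff: "x_coeff (m + 1) * y_coeff m = p"
  by (simp add: x_coeff_def y_coeff_def)

definition left_x :: "'k graded \<Rightarrow> 'k graded" where
  "left_x = graded_map 1 (\<lambda>m f. tw 1 (f * x_coeff m))"

definition left_y :: "'k graded \<Rightarrow> 'k graded" where
  "left_y = graded_map (-1) (\<lambda>m f. y_coeff m * tw (-1) f)"

definition left_poly :: "'k poly \<Rightarrow> 'k graded \<Rightarrow> 'k graded" where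
  "left_poly g = graded_map 0 (\<lambda>m f. g * f)"

text \<open>When a right factor cancels against \<open>u_m\<close>, the resulting polynomial must be
  moved to the left: \<open>u_m p = \<sigma>^m(p) u_m\<close> for the product yx, and
  \<open>u_m \<sigma>(p) = \<sigma>^(m+1)(p) u_m\<close> for xy. This is the origin of the exponents
  m here and m + 1 in \<open>right_y\<close>.\<close>

definition right_x :: "'k graded \<Rightarrow> 'k graded" where
  "right_x = graded_map 1 (\<lambda>m f. f * tw m (x_coeff m))"

definition right_y :: "'k graded \<Rightarrow> 'k graded" where
  "right_y = graded_map (-1) (\<lambda>m f. f * tw (m + 1) (y_coeff m))"

definition right_poly :: "'k poly \<Rightarrow> 'k graded \<Rightarrow> 'k graded" where
  "right_poly g = graded_map 0 (\<lambda>m f. f * tw m g)"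

lemma lookup_action [simp]:
  "Poly_Mapping.lookup (left_x F) m = tw 1 (Poly_Mapping.lookup F (m - 1) * x_coeff m)"
  "Poly_Mapping.lookup (left_y F) m = y_coeff m * tw (-1) (Poly_Mapping.lookup F (m + 1))"
  "Poly_Mapping.lookup (left_poly g F) m = g * Poly_Mapping.lookup F m"
  "Poly_Mapping.lookup (right_x F) m = Poly_Mapping.lookup F (m - 1) * tw m (x_coeff m)"
  "Poly_Mapping.lookup (right_y F) m = Poly_Mapping.lookup F (m + 1) * tw (m + 1) (y_coeff m)"
  "Poly_Mapping.lookup (right_poly g F) m = Poly_Mapping.lookup F m * tw m g"
  by (simp_all add: left_x_def left_y_def left_poly_def right_x_def right_y_def right_poly_def
      lookup_graded_map)

lemma left_poly_simps [simp]:
  "left_poly 1 F = F" "left_poly 0 F = 0"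
  "left_poly g (left_poly h F) = left_poly (g * h) F"
  "left_poly (g + h) F = left_poly g F + left_poly h F"
  "left_poly (- g) F = - left_poly g F"
  "left_poly [:- 1:] F = - F"
  by (rule poly_mapping_eqI; simp add: lookup_add algebra_simps)+

text \<open>This is linearity over k, the scalars acting as constant polynomials.\<close>

definition graded_linear :: "('k graded \<Rightarrow> 'k graded) \<Rightarrow> bool" where
  "graded_linear T \<longleftrightarrow>
    (\<forall>F G. T (F + G) = T F + T G) \<and> (\<forall>c F. T (left_poly [:c:] F) = left_poly [:c:] (T F))"

lemma graded_linear_action:
  "graded_linear left_x" "graded_linear left_y" "graded_linear (left_poly g)"
  "graded_linear right_x" "graded_linear right_y" "graded_linear (right_poly g)"
  unfolding graded_linear_def
  by (auto intro!: poly_mapping_eqI simp: lookup_add algebra_simps)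

lemma graded_linear_comp: "graded_linear S \<Longrightarrow> graded_linear T \<Longrightarrow> graded_linear (\<lambda>F. S (T F))"
  by (simp add: graded_linear_def)

lemma graded_linear_id: "graded_linear (\<lambda>F. F)"
  by (simp add: graded_linear_def)

lemma graded_linear_add: "graded_linear T \<Longrightarrow> T (F + G) = T F + T G"
  and graded_linear_scale: "graded_linear T \<Longrightarrow> T (left_poly [:c:] F) = left_poly [:c:] (T F)"
  by (simp_all add: graded_linear_def)

lemma graded_linear_zero: "graded_linear T \<Longrightarrow> T 0 = 0"
  using graded_linear_scale[of T 0 0] by simp

lemma graded_linear_sum: "graded_linear T \<Longrightarrow> T (sum f I) = (\<Sum>i\<in>I. T (f i))"
  by (induction I rule: infinite_finite_induct) (auto simp: graded_linear_add graded_linear_zero)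

text \<open>These are the defining relations of A, with the commutation of x and y past z extended
  to all polynomials; by them the ideal of relations acts as zero.\<close>

lemma commutation_left:
  "left_x (left_poly g F) = left_poly (tw 1 g) (left_x F)"
  "left_y (left_poly g F) = left_poly (tw (-1) g) (left_y F)"
  "left_y (left_x F) = left_poly p F"
  "left_x (left_y F) = left_poly (tw 1 p) F"
proof -
  have 1: "y_coeff m * (f * x_coeff (m + 1)) = p * f" for m f
    using x_coeff_y_coeff[of m] by (metis mult.commute mult.left_commute)
  have 2: "tw a (y_coeff (m - 1)) * (f * tw a (x_coeff m)) = tw a p * f" for m a f
  proof -
    have "tw a (x_coeff m * y_coeff (m - 1)) = tw a p"
      using x_coeff_y_coeff[of "m - 1"] by simp
    then have "tw a (x_coeff m) * tw a (y_coeff (m - 1)) = tw a p"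
      by (simp only: tw_simps)
    then show ?thesis
      by (metis mult.commute mult.left_commute)
  qed
  show "left_x (left_poly g F) = left_poly (tw 1 g) (left_x F)"
    and "left_y (left_poly g F) = left_poly (tw (-1) g) (left_y F)"
    by (rule poly_mapping_eqI; simp add: algebra_simps)+
  show "left_y (left_x F) = left_poly p F"
    by (rule poly_mapping_eqI) (simp add: 1)
  show "left_x (left_y F) = left_poly (tw 1 p) F"
    by (rule poly_mapping_eqI) (simp add: 2 mult.assoc)
qed

text \<open>This is associativity of the multiplication to be transported: left and right
  multiplications commute.\<close>

lemma commutation_left_right:
  "left_x (right_x F) = right_x (left_x F)"
  "left_x (right_y F) = right_y (left_x F)"
  "left_x (right_poly g F) = right_poly g (left_x F)"
  "left_y (right_x F) = right_x (left_y F)"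
  "left_y (right_y F) = right_y (left_y F)"
  "left_y (right_poly g F) = right_poly g (left_y F)"
  "left_poly h (right_x F) = right_x (left_poly h F)"
  "left_poly h (right_y F) = right_y (left_poly h F)"
  "left_poly h (right_poly g F) = right_poly g (left_poly h F)"
  \<comment> \<open>In general weight both sides carry the same factors. Only at -1, 0 and 1 do
    neighbouring structure coefficients change between 1 and p, and there the twists have to be
    compared separately.\<close>
  by (rule poly_mapping_eqI; rename_tac m; case_tac "m = 0"; case_tac "m = 1"; case_tac "m = -1";
    simp add: x_coeff_def y_coeff_def mult_ac add.commute)+

text \<open>The linear extension of a map on basis elements is needed twice: for words in the free
  algebra and for pairs in formal tensors.\<close>

definition graded_extend :: "('s \<Rightarrow> 'k graded) \<Rightarrow> ('s \<Rightarrow>\<^sub>0 'k) \<Rightarrow> 'k graded" where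
  "graded_extend \<phi> t =
    (\<Sum>s\<in>Poly_Mapping.keys t. left_poly [:Poly_Mapping.lookup t s:] (\<phi> s))"

lemma graded_extend_add: "graded_extend \<phi> (s + t) = graded_extend \<phi> s + graded_extend \<phi> t"
  unfolding graded_extend_def
  by (rule setsum_keys_plus_distrib)
    (auto intro!: poly_mapping_eqI simp: lookup_add smult_add_left)

lemma graded_extend_single: "graded_extend \<phi> (Poly_Mapping.single s c) = left_poly [:c:] (\<phi> s)"
  by (simp add: graded_extend_def)

lemma graded_extend_zero: "graded_extend \<phi> 0 = 0"
  by (simp add: graded_extend_def)

lemma graded_extend_uminus: "graded_extend \<phi> (- t) = - graded_extend \<phi> t"
  using graded_extend_add[of \<phi> "- t" t] by (simp add: graded_extend_zero eq_neg_iff_add_eq_0)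

lemma graded_extend_diff: "graded_extend \<phi> (s - t) = graded_extend \<phi> s - graded_extend \<phi> t"
  using graded_extend_add[of \<phi> s "- t"] by (simp add: graded_extend_uminus)

lemma graded_extend_sum: "graded_extend \<phi> (sum t I) = (\<Sum>i\<in>I. graded_extend \<phi> (t i))"
  by (induction I rule: infinite_finite_induct)
    (auto simp: graded_extend_add graded_extend_zero)

section \<open>The free algebra acting on the graded model\<close>

fun gen_act :: "gen \<Rightarrow> 'k graded \<Rightarrow> 'k graded" where
  "gen_act GX = left_x"
| "gen_act GY = left_y"
| "gen_act GZ = left_poly [:0, 1:]"

lemma graded_linear_gen_act: "graded_linear (gen_act g)"
  by (cases g) (simp_all add: graded_linear_action)

definition word_act :: "gen word \<Rightarrow> 'k graded \<Rightarrow> 'k graded" where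
  "word_act w = foldr gen_act (letters w)"

lemma word_act_add: "word_act (v + w) F = word_act v (word_act w F)"
  by (simp add: word_act_def plus_word_def)

lemma word_act_simps [simp]: "word_act 0 F = F" "word_act (Word [g]) F = gen_act g F"
  by (simp_all add: word_act_def zero_word_def)

lemma graded_linear_word_act: "graded_linear (word_act w)"
proof -
  have "graded_linear (foldr gen_act gs)" for gs
  proof (induction gs)
    case Nil
    show ?case
      by (simp only: foldr_Nil id_def graded_linear_id)
  next
    case (Cons g gs)
    show ?case
      unfolding foldr_Cons comp_def
      by (rule graded_linear_comp[OF graded_linear_gen_act Cons.IH])
  qed
  then show ?thesis
    by (simp only: word_act_def)
qed

definition falg_act :: "'k falg \<Rightarrow> 'k graded \<Rightarrow> 'k graded" where
  "falg_act a F = graded_extend (\<lambda>w. word_act w F) a"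

lemma falg_act_simps:
  "falg_act (a + b) F = falg_act a F + falg_act b F"
  "falg_act (- a) F = - falg_act a F"
  "falg_act (a - b) F = falg_act a F - falg_act b F"
  "falg_act 0 F = 0"
  "falg_act (sum f I) F = (\<Sum>i\<in>I. falg_act (f i) F)"
  by (simp_all add: falg_act_def graded_extend_add graded_extend_uminus graded_extend_diff
      graded_extend_zero graded_extend_sum)

lemma falg_act_single: "falg_act (Poly_Mapping.single w c) F = left_poly [:c:] (word_act w F)"
  by (simp add: falg_act_def graded_extend_single)

lemma falg_act_gen: "falg_act (falg_gen g) F = gen_act g F"
  and falg_act_const: "falg_act (falg_const c) F = left_poly [:c:] F"
  by (simp_all add: falg_gen_def falg_const_def falg_act_single flip: one_pCons)

lemma falg_act_one: "falg_act 1 F = F"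
  using falg_act_const[of 1 F] by (simp add: falg_const_def flip: one_pCons)

lemma graded_linear_falg_act: "graded_linear (falg_act a)"
proof (induction a rule: poly_mapping_induct)
  case (single w c)
  have "graded_linear (\<lambda>F. left_poly [:c:] (word_act w F))"
    by (rule graded_linear_comp[OF graded_linear_action(3) graded_linear_word_act])
  then show ?case
    by (simp add: falg_act_single[abs_def])
next
  case (add a b)
  then show ?case
    by (auto simp: graded_linear_def falg_act_simps intro!: poly_mapping_eqI
        simp: lookup_add algebra_simps)
qed

lemma falg_act_mult: "falg_act (a * b) F = falg_act a (falg_act b F)"
proof (induction a rule: poly_mapping_induct)
  case (single v c)
  show ?case
  proof (induction b rule: poly_mapping_induct)
    case (single w d)
    then show ?case
      by (simp add: mult_single falg_act_single word_act_add
          graded_linear_scale[OF graded_linear_word_act] mult.commute)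
  next
    case (add a b)
    then show ?case
      by (simp add: distrib_left falg_act_simps graded_linear_add[OF graded_linear_falg_act])
  qed
next
  case (add a b)
  then show ?case
    by (simp add: distrib_right falg_act_simps)
qed

text \<open>Commuting with the three generators suffices, since words are products of generators and
  \<open>R\<close> is linear. This applies to the right multiplications.\<close>

lemma falg_act_right:
  assumes "graded_linear R" "\<And>g F. R (gen_act g F) = gen_act g (R F)"
  shows "falg_act a (R F) = R (falg_act a F)"
proof (induction a rule: poly_mapping_induct)
  case (single w c)
  have "foldr gen_act gs (R F) = R (foldr gen_act gs F)" for gs
    by (induction gs) (simp_all add: assms(2))
  then show ?case
    by (simp add: falg_act_single word_act_def graded_linear_scale[OF assms(1)])
next
  case (add a b)
  then show ?case
    by (simp add: falg_act_simps graded_linear_add[OF assms(1)])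
qed

end

section \<open>Normal forms in the generalized Weyl algebra\<close>

lemma falg_const_simps:
  "falg_const (a + b) = falg_const a + falg_const b"
  "falg_const (a * b) = falg_const a * falg_const b"
  "falg_const 0 = 0" "falg_const 1 = 1"
  by (simp_all add: falg_const_def single_add mult_single)

lemma falg_const_commute: "falg_const c * a = a * falg_const c"
proof (induction a rule: poly_mapping_induct)
  case (single w d)
  then show ?case
    by (simp add: falg_const_def mult_single mult.commute)
qed (simp add: distrib_left distrib_right)

lemma falg_poly_eq_sum:
  assumes "degree f \<le> n"
  shows "falg_poly f = (\<Sum>i\<le>n. falg_const (coeff f i) * falg_gen GZ ^ i)"
  unfolding falg_poly_def using assms
  by (intro sum.mono_neutral_left) (auto simp: falg_const_simps coeff_eq_0)

lemma falg_poly_add: "falg_poly (f + g) = falg_poly f + falg_poly g"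
proof -
  define n where "n = max (degree f) (degree g)"
  have "degree f \<le> n" "degree g \<le> n" "degree (f + g) \<le> n"
    using degree_add_le_max[of f g] by (auto simp: n_def)
  then show ?thesis
    by (simp add: falg_poly_eq_sum[of _ n] falg_const_simps distrib_right sum.distrib)
qed

lemma falg_poly_const: "falg_poly [:c:] = falg_const c"
  by (simp add: falg_poly_def)

lemma falg_poly_pCons: "falg_poly (pCons c f) = falg_const c + falg_poly f * falg_gen GZ"
proof -
  have "degree (pCons c f) \<le> Suc (degree f)"
    by (rule degree_pCons_le)
  then have "falg_poly (pCons c f) =
      (\<Sum>i\<le>Suc (degree f). falg_const (coeff (pCons c f) i) * falg_gen GZ ^ i)"
    by (rule falg_poly_eq_sum)
  also have "\<dots> = falg_const c + (\<Sum>i\<le>degree f. falg_const (coeff f i) * falg_gen GZ ^ Suc i)"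
    by (subst sum.atMost_Suc_shift) simp
  finally show ?thesis
    by (simp add: falg_poly_def sum_distrib_right mult.assoc power_commutes)
qed

lemma falg_poly_simps:
  "falg_poly 0 = 0" "falg_poly 1 = 1" "falg_poly [:0, 1:] = falg_gen GZ"
  by (simp_all add: falg_poly_pCons falg_poly_const falg_const_simps one_pCons
      falg_poly_const[of 0, simplified])

lemma falg_poly_gen_commute: "falg_gen GZ * falg_poly f = falg_poly f * falg_gen GZ"
proof (induction f)
  case (pCons c f)
  have "falg_gen GZ * (falg_poly f * falg_gen GZ) = falg_poly f * falg_gen GZ * falg_gen GZ"
    using pCons.IH by (simp add: mult.assoc[symmetric])
  then show ?case
    by (simp add: falg_poly_pCons distrib_left distrib_right falg_const_commute)
qed (simp add: falg_poly_simps)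

lemma falg_poly_smult: "falg_poly (Polynomial.smult c f) = falg_const c * falg_poly f"
  by (induction f)
    (simp_all add: falg_poly_simps falg_poly_pCons falg_const_simps distrib_left mult.assoc)

lemma falg_poly_mult: "falg_poly (f * g) = falg_poly f * falg_poly g"
proof (induction f)
  case (pCons c f)
  have "falg_poly (pCons c f * g) = falg_const c * falg_poly g + falg_poly f * falg_poly g * falg_gen GZ"
    by (simp add: falg_poly_add falg_poly_smult falg_poly_pCons pCons.IH falg_const_simps)
  also have "\<dots> = (falg_const c + falg_poly f * falg_gen GZ) * falg_poly g"
    by (simp add: distrib_right mult.assoc falg_poly_gen_commute)
  finally show ?case
    by (simp add: falg_poly_pCons)
qed (simp add: falg_poly_simps)

context gwa_data
begin

lemma ideal_gwa_ideal: "ideal (gwa_ideal q p) class_ring"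
  unfolding gwa_ideal_def Let_def by (rule ring.genideal_ideal[OF class_ring.ring_axioms]) auto

definition falg_cong :: "'k falg \<Rightarrow> 'k falg \<Rightarrow> bool"  (infix \<open>\<approx>\<close> 50) where
  "a \<approx> b \<longleftrightarrow> a - b \<in> gwa_ideal q p"

lemma gwa_ideal_closed:
  "0 \<in> gwa_ideal q p"
  "a \<in> gwa_ideal q p \<Longrightarrow> b \<in> gwa_ideal q p \<Longrightarrow> a + b \<in> gwa_ideal q p"
  "a \<in> gwa_ideal q p \<Longrightarrow> - a \<in> gwa_ideal q p"
  "a \<in> gwa_ideal q p \<Longrightarrow> c * a \<in> gwa_ideal q p"
  "a \<in> gwa_ideal q p \<Longrightarrow> a * c \<in> gwa_ideal q p"
proof -
  interpret I: ideal "gwa_ideal q p" "class_ring :: 'k falg ring"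
    by (rule ideal_gwa_ideal)
  show "0 \<in> gwa_ideal q p"
    using I.zero_closed by simp
  show "a \<in> gwa_ideal q p \<Longrightarrow> b \<in> gwa_ideal q p \<Longrightarrow> a + b \<in> gwa_ideal q p"
    using I.a_closed[of a b] by simp
  show "a \<in> gwa_ideal q p \<Longrightarrow> c * a \<in> gwa_ideal q p" for c
    using I.I_l_closed[of a c] by simp
  from this[of "-1"] show "a \<in> gwa_ideal q p \<Longrightarrow> - a \<in> gwa_ideal q p"
    by simp
  show "a \<in> gwa_ideal q p \<Longrightarrow> a * c \<in> gwa_ideal q p"
    using I.I_r_closed[of a c] by simp
qed

lemma falg_cong_refl [simp]: "a \<approx> a"
  by (simp add: falg_cong_def gwa_ideal_closed)

lemma falg_cong_trans [trans]: "a \<approx> b \<Longrightarrow> b \<approx> c \<Longrightarrow> a \<approx> c"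
  using gwa_ideal_closed(2)[of "a - b" "b - c"] by (simp add: falg_cong_def)

lemma falg_cong_add: "a \<approx> b \<Longrightarrow> c \<approx> d \<Longrightarrow> a + c \<approx> b + d"
  using gwa_ideal_closed(2)[of "a - b" "c - d"] by (simp add: falg_cong_def algebra_simps)

lemma falg_cong_left: "a \<approx> b \<Longrightarrow> c * a \<approx> c * b"
  using gwa_ideal_closed(4)[of "a - b" c] by (simp add: falg_cong_def algebra_simps)

lemma falg_cong_right: "a \<approx> b \<Longrightarrow> a * c \<approx> b * c"
  using gwa_ideal_closed(5)[of "a - b" c] by (simp add: falg_cong_def algebra_simps)

lemma falg_relations:
  "falg_gen GX * falg_gen GZ \<approx> falg_const q * falg_gen GZ * falg_gen GX"
  "falg_gen GY * falg_gen GZ \<approx> falg_const (inverse q) * falg_gen GZ * falg_gen GY"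
  "falg_gen GY * falg_gen GX \<approx> falg_poly p"
  "falg_gen GX * falg_gen GY \<approx> falg_poly (tw 1 p)"
  unfolding falg_cong_def gwa_ideal_def Let_def twist_eq_tw[symmetric]
  by (rule subsetD[OF ring.genideal_self[OF class_ring.ring_axioms]]; simp)+

lemma falg_twist_pCons:
  "falg_poly (tw m (pCons c f)) =
    falg_const c + falg_poly (tw m f) * (falg_const (q powi m) * falg_gen GZ)"
proof -
  have "tw m (pCons c f) = [:c:] + tw m f * Polynomial.smult (q powi m) [:0, 1:]"
    unfolding tw_def by (rule poly_eqI) (simp add: coeff_pCons split: nat.split)
  then show ?thesis
    by (simp only: falg_poly_add falg_poly_mult falg_poly_smult falg_poly_simps falg_poly_const)
qed

text \<open>Stated for a general exponent so that it serves x with m = 1 and y with m = -1.\<close>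

lemma falg_gen_poly:
  assumes "falg_gen g * falg_gen GZ \<approx> falg_const (q powi m) * falg_gen GZ * falg_gen g"
  shows "falg_gen g * falg_poly f \<approx> falg_poly (tw m f) * falg_gen g"
proof (induction f)
  case (pCons c f)
  let ?c = "falg_const (q powi m)"
  have "falg_gen g * falg_poly (pCons c f) =
      falg_const c * falg_gen g + (falg_gen g * falg_poly f) * falg_gen GZ"
    by (simp add: falg_poly_pCons distrib_left falg_const_commute mult.assoc)
  also have "\<dots> \<approx> falg_const c * falg_gen g + (falg_poly (tw m f) * falg_gen g) * falg_gen GZ"
    by (intro falg_cong_add falg_cong_refl falg_cong_right pCons.IH)
  also have "(falg_poly (tw m f) * falg_gen g) * falg_gen GZ = falg_poly (tw m f) * (falg_gen g * falg_gen GZ)"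
    by (simp add: mult.assoc)
  also have "falg_const c * falg_gen g + \<dots> \<approx>
      falg_const c * falg_gen g + falg_poly (tw m f) * (?c * falg_gen GZ * falg_gen g)"
    by (intro falg_cong_add falg_cong_refl falg_cong_left assms)
  also have "\<dots> = falg_poly (tw m (pCons c f)) * falg_gen g"
    by (simp add: falg_twist_pCons distrib_right mult.assoc)
  finally show ?case .
qed (simp add: falg_poly_simps)

lemma falg_x_poly: "falg_gen GX * falg_poly f \<approx> falg_poly (tw 1 f) * falg_gen GX"
  and falg_y_poly: "falg_gen GY * falg_poly f \<approx> falg_poly (tw (-1) f) * falg_gen GY"
  using falg_relations(1,2) by (auto intro!: falg_gen_poly simp: power_int_minus)

section \<open>The basis theorem for A: normal forms span and are independent\<close>

definition normal_word :: "int \<Rightarrow> 'k falg" where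
  "normal_word m = (if m \<ge> 0 then falg_gen GX ^ nat m else falg_gen GY ^ nat (- m))"

lemma normal_word_simps:
  "normal_word 0 = 1"
  "m \<ge> 1 \<Longrightarrow> normal_word m = falg_gen GX * normal_word (m - 1)"
  "m \<le> -1 \<Longrightarrow> normal_word m = falg_gen GY * normal_word (m + 1)"
proof -
  show "normal_word m = falg_gen GX * normal_word (m - 1)" if "m \<ge> 1"
  proof -
    have "nat m = Suc (nat (m - 1))"
      using that by simp
    then show ?thesis
      using that by (simp add: normal_word_def)
  qed
  show "normal_word m = falg_gen GY * normal_word (m + 1)" if "m \<le> -1"
  proof -
    have "nat (- m) = Suc (nat (- (m + 1)))"
      using that by simp
    then show ?thesis
      using that by (cases "m = -1") (simp_all add: normal_word_def)
  qed
qed (simp add: normal_word_def)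

lemma gen_normal_word:
  "falg_gen GX * normal_word m \<approx> falg_poly (tw 1 (x_coeff (m + 1))) * normal_word (m + 1)"
  "falg_gen GY * normal_word m \<approx> falg_poly (y_coeff (m - 1)) * normal_word (m - 1)"
proof -
  show "falg_gen GX * normal_word m \<approx> falg_poly (tw 1 (x_coeff (m + 1))) * normal_word (m + 1)"
    using falg_cong_right[OF falg_relations(4), of "normal_word (m + 1)"]
    by (cases "m \<ge> 0")
      (simp_all add: normal_word_simps(2)[of "m + 1"] normal_word_simps(3)[of m] x_coeff_def
        falg_poly_simps mult.assoc)
  show "falg_gen GY * normal_word m \<approx> falg_poly (y_coeff (m - 1)) * normal_word (m - 1)"
    using falg_cong_right[OF falg_relations(3), of "normal_word (m - 1)"]
    by (cases "m \<ge> 1")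
      (simp_all add: normal_word_simps(3)[of "m - 1"] normal_word_simps(2)[of m] y_coeff_def
        falg_poly_simps mult.assoc)
qed

definition normal_form :: "'k graded \<Rightarrow> 'k falg" where
  "normal_form F = (\<Sum>m\<in>Poly_Mapping.keys F. falg_poly (Poly_Mapping.lookup F m) * normal_word m)"

lemma normal_form_add: "normal_form (F + G) = normal_form F + normal_form G"
  unfolding normal_form_def
  by (rule setsum_keys_plus_distrib) (auto simp: falg_poly_simps falg_poly_add distrib_right)

lemma normal_form_single: "normal_form (Poly_Mapping.single m f) = falg_poly f * normal_word m"
  by (simp add: normal_form_def falg_poly_simps)

lemma gen_act_single:
  "left_x (Poly_Mapping.single m f) = Poly_Mapping.single (m + 1) (tw 1 (f * x_coeff (m + 1)))"
  "left_y (Poly_Mapping.single m f) = Poly_Mapping.single (m - 1) (y_coeff (m - 1) * tw (-1) f)"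
  "left_poly g (Poly_Mapping.single m f) = Poly_Mapping.single m (g * f)"
  by (rule poly_mapping_eqI; auto simp: lookup_single when_def)+

text \<open>This is the spanning half of the basis theorem: modulo the relations, normal forms are
  stable under the generators, and they contain 1.\<close>

lemma gen_normal_form: "falg_gen g * normal_form F \<approx> normal_form (gen_act g F)"
proof (induction F rule: poly_mapping_induct)
  case (single m f)
  show ?case
  proof (cases g)
    case GX
    have "falg_gen GX * (falg_poly f * normal_word m) \<approx> falg_poly (tw 1 f) * falg_gen GX * normal_word m"
      unfolding mult.assoc[symmetric] by (intro falg_cong_right falg_x_poly)
    also have "\<dots> = falg_poly (tw 1 f) * (falg_gen GX * normal_word m)"
      by (simp add: mult.assoc)
    also have "\<dots> \<approx> falg_poly (tw 1 f) * (falg_poly (tw 1 (x_coeff (m + 1))) * normal_word (m + 1))"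
      by (intro falg_cong_left gen_normal_word)
    finally show ?thesis
      by (simp add: GX normal_form_single gen_act_single falg_poly_mult mult.assoc)
  next
    case GY
    have "falg_gen GY * (falg_poly f * normal_word m) \<approx> falg_poly (tw (-1) f) * falg_gen GY * normal_word m"
      unfolding mult.assoc[symmetric] by (intro falg_cong_right falg_y_poly)
    also have "\<dots> = falg_poly (tw (-1) f) * (falg_gen GY * normal_word m)"
      by (simp add: mult.assoc)
    also have "\<dots> \<approx> falg_poly (tw (-1) f) * (falg_poly (y_coeff (m - 1)) * normal_word (m - 1))"
      by (intro falg_cong_left gen_normal_word)
    also have "\<dots> = falg_poly (y_coeff (m - 1) * tw (-1) f) * normal_word (m - 1)"
      by (simp add: mult.commute[of "y_coeff _"] falg_poly_mult mult.assoc)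
    finally show ?thesis
      by (simp only: GY normal_form_single gen_act.simps gen_act_single)
  next
    case GZ
    then show ?thesis
      by (simp only: gen_act.simps normal_form_single gen_act_single falg_poly_mult falg_poly_simps
          mult.assoc falg_cong_refl)
  qed
next
  case (add F G)
  then show ?case
    by (simp add: normal_form_add distrib_left graded_linear_add[OF graded_linear_gen_act]
        falg_cong_add)
qed

definition graded_one :: "'k graded" where
  "graded_one = Poly_Mapping.single 0 1"

lemma normal_form_scale: "normal_form (left_poly [:c:] F) = falg_const c * normal_form F"
proof (induction F rule: poly_mapping_induct)
  case (single m f)
  then show ?case
    by (simp add: gen_act_single normal_form_single falg_poly_smult mult.assoc)
next
  case (add F G)
  then show ?case
    by (simp add: normal_form_add distrib_left graded_linear_add[OF graded_linear_action(3)])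
qed

lemma normal_form_falg_act: "a * normal_form F \<approx> normal_form (falg_act a F)"
proof (induction a rule: poly_mapping_induct)
  case (single w c)
  have "Poly_Mapping.single (Word gs) 1 * normal_form F \<approx> normal_form (foldr gen_act gs F)" for gs
  proof (induction gs)
    case Nil
    then show ?case
      by (simp flip: zero_word_def)
  next
    case (Cons g gs)
    have "Poly_Mapping.single (Word (g # gs)) 1 = falg_gen g * Poly_Mapping.single (Word gs) (1::'k)"
      by (simp add: falg_gen_def mult_single plus_word_def)
    then have "Poly_Mapping.single (Word (g # gs)) 1 * normal_form F =
        falg_gen g * (Poly_Mapping.single (Word gs) 1 * normal_form F)"
      by (simp add: mult.assoc)
    also have "\<dots> \<approx> falg_gen g * normal_form (foldr gen_act gs F)"
      by (intro falg_cong_left Cons.IH)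
    also have "\<dots> \<approx> normal_form (foldr gen_act (g # gs) F)"
      using gen_normal_form by simp
    finally show ?case .
  qed
  from falg_cong_left[OF this[of "letters w"], of "falg_const c"] show ?case
    by (simp add: falg_act_single normal_form_scale word_act_def falg_const_def mult_single
        flip: mult.assoc)
next
  case (add a b)
  then show ?case
    by (simp add: distrib_right falg_act_simps normal_form_add falg_cong_add)
qed

lemma falg_act_poly: "falg_act (falg_poly f) F = left_poly f F"
proof (induction f arbitrary: F)
  case (pCons c f)
  have "pCons c f = [:c:] + f * [:0, 1:]"
    by simp
  then show ?case
    using left_poly_simps(3)[of f "[:0, 1:]" F] left_poly_simps(4)[of "[:c:]" "f * [:0, 1:]" F]
    by (simp add: falg_poly_pCons falg_act_simps falg_act_mult falg_act_const falg_act_gen pCons.IH)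
qed (simp add: falg_poly_simps falg_act_simps)

text \<open>The elements acting as zero form a two-sided ideal, and it contains the four relations
  by \<open>commutation_left\<close>; hence it contains the ideal that they generate.\<close>

lemma falg_act_cong:
  assumes "a \<approx> b"
  shows "falg_act a F = falg_act b F"
proof -
  define J where "J = {a. \<forall>F. falg_act a F = 0}"
  have "ideal J (class_ring :: 'k falg ring)"
  proof (rule idealI)
    show "ring (class_ring :: 'k falg ring)"
      by (rule class_ring.ring_axioms)
    show "subgroup J (add_monoid (class_ring :: 'k falg ring))"
    proof (rule subgroup.intro)
      fix a assume "a \<in> J"
      moreover have "inv\<^bsub>add_monoid class_ring\<^esub> a = - a"
        unfolding a_inv_def[symmetric] by (simp only: class_ring_simps)
      ultimately show "inv\<^bsub>add_monoid class_ring\<^esub> a \<in> J"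
        by (simp only: J_def falg_act_simps mem_Collect_eq neg_equal_0_iff_equal simp_thms)
    qed (auto simp: J_def falg_act_simps)
  qed (auto simp: J_def falg_act_mult graded_linear_zero[OF graded_linear_falg_act])
  then have "gwa_ideal q p \<subseteq> J"
    unfolding gwa_ideal_def Let_def
  proof (rule ring.genideal_minimal[OF class_ring.ring_axioms])
    have "left_poly [:inverse q:] (left_poly [:0, 1:] F) = left_poly (tw (-1) [:0, 1:]) F"
      "left_poly [:q:] (left_poly [:0, 1:] F) = left_poly (tw 1 [:0, 1:]) F" for F
      by (simp_all add: tw_def twist_def pcompose_pCons power_int_minus)
    then show "{falg_gen GX * falg_gen GZ - falg_const q * falg_gen GZ * falg_gen GX,
          falg_gen GY * falg_gen GZ - falg_const (inverse q) * falg_gen GZ * falg_gen GY,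
          falg_gen GY * falg_gen GX - falg_poly p,
          falg_gen GX * falg_gen GY - falg_poly (twist q p)} \<subseteq> J"
      by (auto simp: J_def falg_act_simps falg_act_mult falg_act_gen falg_act_const
          falg_act_poly commutation_left twist_eq_tw)
  qed
  then have "falg_act (a - b) F = 0"
    using assms by (auto simp: falg_cong_def J_def)
  then show ?thesis
    by (simp add: falg_act_simps)
qed

lemma falg_act_normal_word: "falg_act (normal_word m) graded_one = Poly_Mapping.single m 1"
proof -
  have "falg_act (normal_word (int n)) graded_one = Poly_Mapping.single (int n) 1" for n
    by (induction n)
      (simp_all add: normal_word_simps falg_act_one graded_one_def falg_act_mult falg_act_gen
        gen_act_single x_coeff_def add.commute)
  moreover have "falg_act (normal_word (- int n)) graded_one = Poly_Mapping.single (- int n) 1" for n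
  proof (induction n)
    case (Suc n)
    have eq: "- int (Suc n) = - int n - 1"
      by simp
    show ?case
      unfolding eq using Suc
      by (simp add: normal_word_simps(3)[of "- int n - 1"] falg_act_mult falg_act_gen
          gen_act_single y_coeff_def)
  qed (simp add: normal_word_simps falg_act_one graded_one_def)
  ultimately show ?thesis
    by (metis int_cases2)
qed

text \<open>This is the independence half: acting on the unit vector recovers all coefficients of a
  normal form, and by \<open>falg_act_cong\<close> the result depends only on the class modulo the
  relations.\<close>

lemma falg_act_normal_form: "falg_act (normal_form F) graded_one = F"
proof (induction F rule: poly_mapping_induct)
  case (single m f)
  then show ?case
    by (simp add: normal_form_single falg_act_mult falg_act_poly falg_act_normal_word gen_act_single)
next
  case (add F G)
  then show ?case
    by (simp add: normal_form_add falg_act_simps)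
qed

lemma normal_form_one: "normal_form graded_one = 1"
  by (simp only: graded_one_def normal_form_single falg_poly_simps normal_word_simps mult_1)

lemma normal_form_surj: "a \<approx> normal_form (falg_act a graded_one)"
  using normal_form_falg_act[of a graded_one] by (simp add: normal_form_one)


section \<open>Transport of the operations of A to the graded model\<close>

definition gwa_of :: "'k graded \<Rightarrow> 'k falg set" where
  "gwa_of F = gwa_class q p (normal_form F)"

lemma gwa_class_eq_iff: "gwa_class q p a = gwa_class q p b \<longleftrightarrow> a \<approx> b"
proof -
  interpret I: ideal "gwa_ideal q p" "class_ring :: 'k falg ring"
    by (rule ideal_gwa_ideal)
  have "a = (a - b) + b"
    by simp
  then have "a \<approx> b \<longleftrightarrow> a \<in> gwa_class q p b"
    unfolding falg_cong_def gwa_class_def a_r_coset_def'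
    by (auto intro: bexI[of _ "a - b"])
  moreover have "a \<in> gwa_class q p b \<longleftrightarrow> gwa_class q p a = gwa_class q p b"
    unfolding gwa_class_def
    using I.a_repr_independence'[of a b] I.a_rcos_self[of a] by auto
  ultimately show ?thesis
    by simp
qed

lemma gwa_ops:
  "carrier (gwa q p) = range (gwa_class q p)"
  "\<zero>\<^bsub>gwa q p\<^esub> = gwa_class q p 0"
  "\<one>\<^bsub>gwa q p\<^esub> = gwa_class q p 1"
  "gwa_class q p a \<oplus>\<^bsub>gwa q p\<^esub> gwa_class q p b = gwa_class q p (a + b)"
  "gwa_class q p a \<otimes>\<^bsub>gwa q p\<^esub> gwa_class q p b = gwa_class q p (a * b)"
  "c \<odot>\<^bsub>gwa q p\<^esub> gwa_class q p a = gwa_class q p (falg_const c * a)"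
proof -
  interpret I: ideal "gwa_ideal q p" "class_ring :: 'k falg ring"
    by (rule ideal_gwa_ideal)
  show "carrier (gwa q p) = range (gwa_class q p)"
    by (auto simp: gwa_def gwa_class_def[abs_def] FactRing_def A_RCOSETS_defs a_r_coset_defs)
  have "gwa_ideal q p +>\<^bsub>class_ring\<^esub> 0 = gwa_ideal q p"
    using I.a_rcos_const[of 0] gwa_ideal_closed by simp
  then show "\<zero>\<^bsub>gwa q p\<^esub> = gwa_class q p 0"
    by (simp add: gwa_def gwa_class_def FactRing_def)
  show "\<one>\<^bsub>gwa q p\<^esub> = gwa_class q p 1"
    by (simp add: gwa_def gwa_class_def FactRing_def)
  show "gwa_class q p a \<oplus>\<^bsub>gwa q p\<^esub> gwa_class q p b = gwa_class q p (a + b)"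
    using I.a_rcos_sum[of a b] by (simp add: gwa_def gwa_class_def FactRing_def)
  show *: "gwa_class q p a \<otimes>\<^bsub>gwa q p\<^esub> gwa_class q p b = gwa_class q p (a * b)" for a b
    using I.rcoset_mult_add[of a b] by (simp add: gwa_def gwa_class_def FactRing_def)
  show "c \<odot>\<^bsub>gwa q p\<^esub> gwa_class q p a = gwa_class q p (falg_const c * a)"
    using *[of "falg_const c" a] by (simp add: gwa_def Let_def)
qed

lemma bij_gwa_of: "bij_betw gwa_of UNIV (carrier (gwa q p))"
  unfolding bij_betw_def
proof
  show "inj gwa_of"
    by (rule injI) (metis gwa_of_def gwa_class_eq_iff falg_act_cong falg_act_normal_form)
  have "gwa_class q p a \<in> range gwa_of" for a
    using normal_form_surj[of a] by (auto simp: gwa_of_def gwa_class_eq_iff)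
  then show "range gwa_of = carrier (gwa q p)"
    by (auto simp: gwa_ops gwa_of_def)
qed

lemma gwa_of_inject [simp]: "gwa_of F = gwa_of G \<longleftrightarrow> F = G"
  using bij_gwa_of by (auto simp: bij_betw_def inj_def)

lemma carrier_gwa: "carrier (gwa q p) = range gwa_of"
  using bij_gwa_of by (auto simp: bij_betw_def)

lemma gwa_of_add: "gwa_of F \<oplus>\<^bsub>gwa q p\<^esub> gwa_of G = gwa_of (F + G)"
  by (simp add: gwa_of_def gwa_ops normal_form_add)

lemma gwa_of_zero: "\<zero>\<^bsub>gwa q p\<^esub> = gwa_of 0"
  by (simp add: gwa_of_def gwa_ops normal_form_def)

lemma gwa_of_scale: "c \<odot>\<^bsub>gwa q p\<^esub> gwa_of F = gwa_of (left_poly [:c:] F)"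
  by (simp add: gwa_of_def gwa_ops normal_form_scale)

lemma gwa_of_left: "gwa_class q p a \<otimes>\<^bsub>gwa q p\<^esub> gwa_of F = gwa_of (falg_act a F)"
  by (simp add: gwa_of_def gwa_ops gwa_class_eq_iff normal_form_falg_act)

lemma gwa_class_eq_gwa_of: "gwa_class q p a = gwa_of (falg_act a graded_one)"
  using normal_form_surj[of a] by (simp add: gwa_of_def gwa_class_eq_iff)

text \<open>An operator that commutes with the left action is determined by its value at
  \<open>graded_one\<close>, so right multiplication by b is recognized from that single
  value.\<close>

lemma gwa_of_right:
  assumes "graded_linear R" "\<And>g F. R (gen_act g F) = gen_act g (R F)"
    and "R graded_one = falg_act b graded_one"
  shows "gwa_of F \<otimes>\<^bsub>gwa q p\<^esub> gwa_class q p b = gwa_of (R F)"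
proof -
  have "falg_act (normal_form F * b) graded_one = falg_act (normal_form F) (R graded_one)"
    by (simp add: falg_act_mult assms(3))
  also have "\<dots> = R F"
    by (simp add: falg_act_right[OF assms(1,2)] falg_act_normal_form)
  finally have "gwa_class q p (normal_form F * b) = gwa_of (R F)"
    by (simp only: gwa_class_eq_gwa_of)
  then show ?thesis
    by (simp add: gwa_of_def[of F] gwa_ops)
qed

lemma gwa_of_elements:
  "\<one>\<^bsub>gwa q p\<^esub> = gwa_of graded_one"
  "gwa_x q p = gwa_of (Poly_Mapping.single 1 1)"
  "gwa_y q p = gwa_of (Poly_Mapping.single (-1) 1)"
  "gwa_z q p = gwa_of (Poly_Mapping.single 0 [:0, 1:])"
  "gwa_poly q p f = gwa_of (Poly_Mapping.single 0 f)"
  by (simp_all only: gwa_ops gwa_x_def gwa_y_def gwa_z_def gwa_poly_def gwa_class_eq_gwa_of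
      falg_act_one falg_act_gen falg_act_poly graded_one_def gen_act.simps gen_act_single)
    (simp_all add: x_coeff_def y_coeff_def)

lemma gwa_poly_const: "gwa_poly q p [:0, 1:] = gwa_z q p" "gwa_poly q p 1 = \<one>\<^bsub>gwa q p\<^esub>"
  by (simp_all add: gwa_poly_def gwa_z_def gwa_ops falg_poly_simps)

lemma gwa_of_mult:
  "gwa_x q p \<otimes>\<^bsub>gwa q p\<^esub> gwa_of F = gwa_of (left_x F)"
  "gwa_y q p \<otimes>\<^bsub>gwa q p\<^esub> gwa_of F = gwa_of (left_y F)"
  "gwa_poly q p f \<otimes>\<^bsub>gwa q p\<^esub> gwa_of F = gwa_of (left_poly f F)"
  "gwa_of F \<otimes>\<^bsub>gwa q p\<^esub> gwa_x q p = gwa_of (right_x F)"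
  "gwa_of F \<otimes>\<^bsub>gwa q p\<^esub> gwa_y q p = gwa_of (right_y F)"
  "gwa_of F \<otimes>\<^bsub>gwa q p\<^esub> gwa_poly q p f = gwa_of (right_poly f F)"
proof -
  have comm: "right_x (gen_act g F) = gen_act g (right_x F)"
    "right_y (gen_act g F) = gen_act g (right_y F)"
    "right_poly f (gen_act g F) = gen_act g (right_poly f F)" for g F
    by (cases g; simp add: commutation_left_right)+
  have one: "right_x graded_one = left_x graded_one" "right_y graded_one = left_y graded_one"
    "right_poly f graded_one = left_poly f graded_one"
    by (rule poly_mapping_eqI;
      simp add: graded_one_def lookup_single lookup_one x_coeff_def y_coeff_def when_def)+
  show "gwa_x q p \<otimes>\<^bsub>gwa q p\<^esub> gwa_of F = gwa_of (left_x F)"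
    and "gwa_y q p \<otimes>\<^bsub>gwa q p\<^esub> gwa_of F = gwa_of (left_y F)"
    and "gwa_poly q p f \<otimes>\<^bsub>gwa q p\<^esub> gwa_of F = gwa_of (left_poly f F)"
    by (simp_all add: gwa_x_def gwa_y_def gwa_poly_def gwa_of_left falg_act_gen falg_act_poly)
  show "gwa_of F \<otimes>\<^bsub>gwa q p\<^esub> gwa_x q p = gwa_of (right_x F)"
    and "gwa_of F \<otimes>\<^bsub>gwa q p\<^esub> gwa_y q p = gwa_of (right_y F)"
    and "gwa_of F \<otimes>\<^bsub>gwa q p\<^esub> gwa_poly q p f = gwa_of (right_poly f F)"
    unfolding gwa_x_def gwa_y_def gwa_poly_def
    by (intro gwa_of_right graded_linear_action comm;
      simp add: one falg_act_gen falg_act_poly)+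
qed

lemma module_gwa: "Module.module class_ring (gwa q p)"
proof (rule module_criteria)
  show "cring (class_ring :: 'k ring)"
    by (rule class_cring.cring_axioms)
  show "\<forall>v\<in>carrier (gwa q p). \<exists>w\<in>carrier (gwa q p). v \<oplus>\<^bsub>gwa q p\<^esub> w = \<zero>\<^bsub>gwa q p\<^esub>"
    by (auto simp: carrier_gwa gwa_of_add gwa_of_zero intro: exI[of _ "- _"])
qed (auto simp: carrier_gwa gwa_of_add gwa_of_zero gwa_of_scale algebra_simps
    graded_linear_add[OF graded_linear_action(3)] simp flip: left_poly_simps(4) one_pCons)

lemma gwa_of_uminus: "\<ominus>\<^bsub>gwa q p\<^esub> gwa_of F = gwa_of (- F)"
proof -
  interpret Module.module class_ring "gwa q p"
    by (rule module_gwa)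
  show ?thesis
    by (rule M.minus_equality) (auto simp: carrier_gwa gwa_of_add gwa_of_zero)
qed

end

section \<open>The differentials in the graded model\<close>

lemma carrier_power_space: "carrier (power_space A n) = {v. length v = n \<and> set v \<subseteq> carrier A}"
  and zero_power_space: "\<zero>\<^bsub>power_space A n\<^esub> = replicate n \<zero>\<^bsub>A\<^esub>"
  and add_power_space: "v \<oplus>\<^bsub>power_space A n\<^esub> w = map2 (\<lambda>a b. a \<oplus>\<^bsub>A\<^esub> b) v w"
  and smult_power_space: "c \<odot>\<^bsub>power_space A n\<^esub> v = map (\<lambda>a. c \<odot>\<^bsub>A\<^esub> a) v"
  by (simp_all add: power_space_def)

lemma module_power_space:
  fixes A :: "('k::field, 'a) module"
  assumes "Module.module class_ring A"
  shows "Module.module class_ring (power_space A n)"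
proof -
  interpret A: Module.module class_ring A by fact
  have car: "v \<in> carrier (power_space A n) \<longleftrightarrow> length v = n \<and> (\<forall>i<n. v ! i \<in> carrier A)" for v
    by (auto simp: carrier_power_space set_conv_nth)
  note simps = car zero_power_space add_power_space smult_power_space
  show ?thesis
  proof (rule module_criteria)
    show "cring (class_ring :: 'k ring)"
      by (rule class_cring.cring_axioms)
    show "\<forall>v\<in>carrier (power_space A n). \<exists>w\<in>carrier (power_space A n).
        v \<oplus>\<^bsub>power_space A n\<^esub> w = \<zero>\<^bsub>power_space A n\<^esub>"
    proof
      fix v assume v: "v \<in> carrier (power_space A n)"
      then have "v \<oplus>\<^bsub>power_space A n\<^esub> map (a_inv A) v = \<zero>\<^bsub>power_space A n\<^esub>"
        by (intro nth_equalityI) (auto simp: simps A.M.r_neg)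
      then show "\<exists>w\<in>carrier (power_space A n). v \<oplus>\<^bsub>power_space A n\<^esub> w = \<zero>\<^bsub>power_space A n\<^esub>"
        using v by (intro bexI[of _ "map (a_inv A) v"]) (auto simp: car)
    qed
  qed (auto simp: simps in_set_conv_nth A.M.a_ac A.smult_l_distr[simplified] A.smult_r_distr[simplified]
      A.smult_assoc1[simplified] A.smult_one[simplified] A.smult_closed[simplified] intro!: nth_equalityI)
qed

lemma keys_uminus_eq: "Poly_Mapping.keys (- t) = Poly_Mapping.keys (t :: 's \<Rightarrow>\<^sub>0 'b::ab_group_add)"
  by (auto simp: in_keys_iff)

context gwa_data
begin

section \<open>Powers of A and the action of tensors, in the model\<close>

lemma range_map_gwa_of:
  "carrier (power_space (gwa q p) n) = {map gwa_of Fs | Fs. length Fs = n}"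
proof -
  have "\<exists>Fs. v = map gwa_of Fs" if "set v \<subseteq> range gwa_of" for v
    using that by (induction v) (auto intro: exI[of _ "_ # _"] simp: Cons_eq_map_conv)
  then show ?thesis
    by (fastforce simp: carrier_power_space carrier_gwa)
qed

lemma map_gwa_of_add:
  "map gwa_of Fs \<oplus>\<^bsub>power_space (gwa q p) n\<^esub> map gwa_of Gs = map gwa_of (map2 (+) Fs Gs)"
  by (simp add: add_power_space zip_map_map gwa_of_add case_prod_unfold)

lemma map_gwa_of_scale:
  "c \<odot>\<^bsub>power_space (gwa q p) n\<^esub> map gwa_of Fs = map gwa_of (map (left_poly [:c:]) Fs)"
  by (simp add: smult_power_space gwa_of_scale)

lemma map_gwa_of_zero: "\<zero>\<^bsub>power_space (gwa q p) n\<^esub> = map gwa_of (replicate n 0)"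
  by (simp add: zero_power_space gwa_of_zero)

lemma inj_map_gwa_of: "map gwa_of Fs = map gwa_of Gs \<longleftrightarrow> Fs = Gs"
  by (simp add: inj_map_eq_map inj_def)

text \<open>The factors are cosets without a chosen representative, so the map
  \<open>F \<mapsto> a F b\<close> is pulled back along \<open>gwa_of\<close>; this is meaningful
  when both factors lie in the carrier.\<close>

definition sandwich :: "'k falg set \<times> 'k falg set \<Rightarrow> 'k graded \<Rightarrow> 'k graded" where
  "sandwich s F =
    inv_into UNIV gwa_of (fst s \<otimes>\<^bsub>gwa q p\<^esub> gwa_of F \<otimes>\<^bsub>gwa q p\<^esub> snd s)"

lemma sandwich_eqI:
  "a \<otimes>\<^bsub>gwa q p\<^esub> gwa_of F \<otimes>\<^bsub>gwa q p\<^esub> b = gwa_of G \<Longrightarrow> sandwich (a, b) F = G"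
  by (simp add: sandwich_def inv_into_f_f inj_def)

lemma gwa_of_sandwich:
  assumes "s \<in> carrier (gwa q p) \<times> carrier (gwa q p)"
  shows "gwa_of (sandwich s F) = fst s \<otimes>\<^bsub>gwa q p\<^esub> gwa_of F \<otimes>\<^bsub>gwa q p\<^esub> snd s"
proof -
  obtain a b where "s = (gwa_class q p a, gwa_class q p b)"
    using assms by (auto simp: gwa_ops)
  then have "fst s \<otimes>\<^bsub>gwa q p\<^esub> gwa_of F \<otimes>\<^bsub>gwa q p\<^esub> snd s = gwa_class q p (a * normal_form F * b)"
    by (simp add: gwa_of_def gwa_ops)
  then have "fst s \<otimes>\<^bsub>gwa q p\<^esub> gwa_of F \<otimes>\<^bsub>gwa q p\<^esub> snd s \<in> range gwa_of"
    by (simp add: gwa_class_eq_gwa_of)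
  then show ?thesis
    by (simp add: sandwich_def f_inv_into_f)
qed

definition tensor_lift :: "('k, 'k falg set, 'k falg set) tensor \<Rightarrow> 'k graded \<Rightarrow> 'k graded" where
  "tensor_lift t F = graded_extend (\<lambda>s. sandwich s F) t"

text \<open>The type of the tensor factors contains all subsets of the free algebra, not only cosets
  of the ideal.\<close>

definition gwa_tensor :: "('k, 'k falg set, 'k falg set) tensor \<Rightarrow> bool" where
  "gwa_tensor t \<longleftrightarrow> Poly_Mapping.keys t \<subseteq> carrier (gwa q p) \<times> carrier (gwa q p)"

lemma finsum_gwa_of:
  "finite I \<Longrightarrow> (\<Oplus>\<^bsub>gwa q p\<^esub>i\<in>I. gwa_of (f i)) = gwa_of (\<Sum>i\<in>I. f i)"
proof (induction I rule: finite_induct)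
  case empty
  interpret Module.module class_ring "gwa q p"
    by (rule module_gwa)
  show ?case
    by (simp add: gwa_of_zero)
next
  case (insert i I)
  interpret Module.module class_ring "gwa q p"
    by (rule module_gwa)
  show ?case
    using insert by (subst M.finsum_insert) (auto simp: carrier_gwa gwa_of_add)
qed

lemma tensor_act_gwa_of:
  assumes "gwa_tensor t"
  shows "tensor_act (gwa q p) t (gwa_of F) = gwa_of (tensor_lift t F)"
proof -
  interpret Module.module class_ring "gwa q p"
    by (rule module_gwa)
  have "tensor_act (gwa q p) t (gwa_of F) =
      (\<Oplus>\<^bsub>gwa q p\<^esub>s\<in>Poly_Mapping.keys t. gwa_of (left_poly [:Poly_Mapping.lookup t s:] (sandwich s F)))"
    unfolding tensor_act_def
  proof (rule M.finsum_cong')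
    fix s assume "s \<in> Poly_Mapping.keys t"
    then have "s \<in> carrier (gwa q p) \<times> carrier (gwa q p)"
      using assms by (auto simp: gwa_tensor_def)
    then show "Poly_Mapping.lookup t s \<odot>\<^bsub>gwa q p\<^esub> (fst s \<otimes>\<^bsub>gwa q p\<^esub> gwa_of F \<otimes>\<^bsub>gwa q p\<^esub> snd s) =
        gwa_of (left_poly [:Poly_Mapping.lookup t s:] (sandwich s F))"
      by (simp add: gwa_of_sandwich[symmetric] gwa_of_scale)
  qed (auto simp: carrier_gwa)
  then show ?thesis
    by (simp add: finsum_gwa_of tensor_lift_def graded_extend_def)
qed

lemma gwa_carrier_elements:
  "gwa_x q p \<in> carrier (gwa q p)" "gwa_y q p \<in> carrier (gwa q p)" "gwa_z q p \<in> carrier (gwa q p)"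
  "gwa_poly q p f \<in> carrier (gwa q p)" "\<one>\<^bsub>gwa q p\<^esub> \<in> carrier (gwa q p)"
  by (auto simp: carrier_gwa gwa_of_elements)

lemma gwa_tensor_simps:
  "gwa_tensor 0"
  "gwa_tensor s \<Longrightarrow> gwa_tensor t \<Longrightarrow> gwa_tensor (s + t)"
  "gwa_tensor s \<Longrightarrow> gwa_tensor t \<Longrightarrow> gwa_tensor (s - t)"
  "gwa_tensor t \<Longrightarrow> gwa_tensor (- t)"
  "a \<in> carrier (gwa q p) \<Longrightarrow> b \<in> carrier (gwa q p) \<Longrightarrow> gwa_tensor (a \<boxtimes> b)"
proof -
  show *: "gwa_tensor s \<Longrightarrow> gwa_tensor t \<Longrightarrow> gwa_tensor (s + t)" for s t
    using keys_add[of s t] by (auto simp: gwa_tensor_def)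
  show **: "gwa_tensor t \<Longrightarrow> gwa_tensor (- t)" for t
    by (simp add: gwa_tensor_def keys_uminus_eq)
  show "gwa_tensor s \<Longrightarrow> gwa_tensor t \<Longrightarrow> gwa_tensor (s - t)"
    using *[of s "- t"] ** by simp
qed (auto simp: gwa_tensor_def pure_tensor_def)

lemma tensor_lift_simps:
  "tensor_lift 0 F = 0"
  "tensor_lift (s - t) F = tensor_lift s F - tensor_lift t F"
  "tensor_lift (- t) F = - tensor_lift t F"
  "tensor_lift (a \<boxtimes> b) F = sandwich (a, b) F"
  by (simp_all add: tensor_lift_def graded_extend_zero graded_extend_diff graded_extend_uminus
      pure_tensor_def graded_extend_single flip: one_pCons)

lemma right_poly_one [simp]: "right_poly 1 F = F"
  by (rule poly_mapping_eqI) simp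

lemma sandwich_simps:
  defines "x \<equiv> gwa_x q p" and "y \<equiv> gwa_y q p" and "z \<equiv> gwa_z q p" and "e \<equiv> \<one>\<^bsub>gwa q p\<^esub>"
  shows "sandwich (x, e) F = left_x F" "sandwich (e, x) F = right_x F"
    "sandwich (y, e) F = left_y F" "sandwich (e, y) F = right_y F"
    "sandwich (z, e) F = left_poly [:0, 1:] F" "sandwich (e, z) F = right_poly [:0, 1:] F"
    "sandwich (gwa_poly q p f, e) F = left_poly f F"
    "sandwich (e, gwa_poly q p g) F = right_poly g F"
    "sandwich (gwa_poly q p f, gwa_poly q p g) F = right_poly g (left_poly f F)"
    "sandwich (gwa_poly q p f, x) F = right_x (left_poly f F)"
    "sandwich (y, gwa_poly q p g) F = right_poly g (left_y F)"
  unfolding x_def y_def z_def e_def gwa_poly_const[symmetric]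
  by (rule sandwich_eqI, simp add: gwa_of_mult)+

text \<open>This is \<open>p\<^sub>1 \<sigma>\<^sup>m(p\<^sub>2)\<close> in the notation \<open>p\<^sub>1 \<otimes> p\<^sub>2\<close> for \<^term>\<open>poly_delta p\<close>.\<close>

definition delta :: "int \<Rightarrow> 'k poly" where
  "delta m = (\<Sum>i\<le>degree p. \<Sum>j=1..i.
    Polynomial.smult (coeff p i) (monom 1 (i - j) * tw m (monom 1 (j - 1))))"

lemma tensor_map_eq_sum:
  "tensor_map f g t =
    (\<Sum>s\<in>Poly_Mapping.keys t. Poly_Mapping.single (f (fst s), g (snd s)) (Poly_Mapping.lookup t s))"
  by (simp add: tensor_map_def case_prod_unfold)

lemma gwa_tensor_delta: "gwa_tensor (delta_tensor q p f g)"
proof -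
  have *: "gwa_tensor (\<Sum>s\<in>I. Poly_Mapping.single (gwa_poly q p (f' s), gwa_poly q p (g' s)) (c s))" for I f' g' c
    by (induction I rule: infinite_finite_induct)
      (auto simp: gwa_tensor_simps intro!: gwa_tensor_simps(2), auto simp: gwa_tensor_def gwa_carrier_elements)
  show ?thesis
    unfolding delta_tensor_def tensor_map_eq_sum by (rule *)
qed

text \<open>Distinct keys of \<open>poly_delta p\<close> may be sent to the same pair by
  \<open>tensor_map\<close>. Such collisions do no harm because \<open>graded_extend\<close> is
  additive.\<close>

lemma tensor_lift_delta:
  "tensor_lift (delta_tensor q p f g) F = (\<Sum>i\<le>degree p. \<Sum>j=1..i.
    left_poly [:coeff p i:] (right_poly (g (monom 1 (j - 1))) (left_poly (f (monom 1 (i - j))) F)))"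
proof -
  define \<phi> where "\<phi> s = right_poly (g (snd s)) (left_poly (f (fst s)) F)" for s
  have "tensor_lift (delta_tensor q p f g) F = graded_extend \<phi> (poly_delta p)"
    unfolding tensor_lift_def delta_tensor_def tensor_map_eq_sum graded_extend_sum graded_extend_single
      graded_extend_def[of \<phi>]
    by (simp add: sandwich_simps \<phi>_def)
  then show ?thesis
    by (simp add: poly_delta_def graded_extend_sum graded_extend_single \<phi>_def)
qed

text \<open>In weight m, moving the right factor across \<open>u_m\<close> gives
  \<open>\<sigma>^a(p_1) f \<sigma>^(m+b)(p_2)\<close>, which equals
  \<open>\<sigma>^a(p_1 \<sigma>^(m+b-a)(p_2)) f\<close>.\<close>

definition delta_act :: "int \<Rightarrow> int \<Rightarrow> 'k graded \<Rightarrow> 'k graded" where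
  "delta_act a b = graded_map 0 (\<lambda>m f. tw a (delta (m + b - a)) * f)"

lemma lookup_delta_act [simp]:
  "Poly_Mapping.lookup (delta_act a b F) m = tw a (delta (m + b - a)) * Poly_Mapping.lookup F m"
  by (simp add: delta_act_def lookup_graded_map)

lemma tw_sum: "tw m (sum f I) = (\<Sum>i\<in>I. tw m (f i))"
  by (induction I rule: infinite_finite_induct) auto

lemma tensor_lift_delta_tw:
  "tensor_lift (delta_tensor q p (tw a) (tw b)) F = delta_act a b F"
  unfolding tensor_lift_delta
  by (rule poly_mapping_eqI)
    (simp add: lookup_sum delta_def tw_sum sum_distrib_left sum_distrib_right add.commute mult_ac)

lemma tensor_lift_delta_cases:
  "tensor_lift (delta_tensor q p id id) F = delta_act 0 0 F"
  "tensor_lift (delta_tensor q p (twist q) id) F = delta_act 1 0 F"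
  "tensor_lift (delta_tensor q p id (twist q)) F = delta_act 0 1 F"
  "tensor_lift (delta_tensor q p (twist q) (twist q)) F = delta_act 1 1 F"
  "tensor_lift (delta_tensor q p (\<lambda>f. Polynomial.smult q (twist q f)) (twist q)) F =
    left_poly [:q:] (delta_act 1 1 F)"
proof -
  have id: "id = tw 0"
    by (simp add: fun_eq_iff)
  show "tensor_lift (delta_tensor q p id id) F = delta_act 0 0 F"
    "tensor_lift (delta_tensor q p (twist q) id) F = delta_act 1 0 F"
    "tensor_lift (delta_tensor q p id (twist q)) F = delta_act 0 1 F"
    "tensor_lift (delta_tensor q p (twist q) (twist q)) F = delta_act 1 1 F"
    unfolding id twist_eq_tw by (rule tensor_lift_delta_tw)+
  show "tensor_lift (delta_tensor q p (\<lambda>f. Polynomial.smult q (twist q f)) (twist q)) F =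
      left_poly [:q:] (delta_act 1 1 F)"
    unfolding tensor_lift_delta_tw[symmetric] twist_eq_tw tensor_lift_delta
      graded_linear_sum[OF graded_linear_action(3)]
    by (intro sum.cong refl poly_mapping_eqI) (simp add: mult.commute)
qed

definition model_diff0 :: "'k graded \<Rightarrow> 'k graded list" where
  "model_diff0 F =
    [left_x F - right_x F, left_y F - right_y F, left_poly [:0, 1:] F - right_poly [:0, 1:] F]"

definition model_diff1 :: "'k graded \<Rightarrow> 'k graded \<Rightarrow> 'k graded \<Rightarrow> 'k graded list" where
  "model_diff1 F G H =
    [left_y F + right_x G - delta_act 0 0 H,
     right_y F + left_x G - left_poly [:q:] (delta_act 1 1 H),
     left_poly [:0, q:] F - right_poly [:0, 1:] F + (right_x (left_poly [:q:] H) - left_x H),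
     left_poly [:0, 1:] G - right_poly [:0, q:] G + (right_y H - right_poly [:q:] (left_y H))]"

definition model_diff2 ::
    "'k graded \<Rightarrow> 'k graded \<Rightarrow> 'k graded \<Rightarrow> 'k graded \<Rightarrow> 'k graded list" where
  "model_diff2 F G H L =
    [left_x F - right_x G - delta_act 1 0 H,
     - right_y F + left_y G - delta_act 0 1 L,
     left_poly [:0, 1:] F - right_poly [:0, 1:] F - left_y H - right_x L,
     left_poly [:0, q:] G - right_poly [:0, q:] G - right_y H - left_x L]"

definition model_diff3 ::
    "'k graded \<Rightarrow> 'k graded \<Rightarrow> 'k graded \<Rightarrow> 'k graded \<Rightarrow> 'k graded list" where
  "model_diff3 F G H L =
    [left_y F + right_x G - delta_act 0 0 H,
     right_y F + left_x G - delta_act 1 1 L,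
     left_poly [:0, q:] F - right_poly [:0, 1:] F - left_x H + right_x L,
     left_poly [:0, 1:] G - right_poly [:0, q:] G + right_y H - left_y L]"

lemma twist_z: "twist q [:0, 1:] = [:0, q:]"
  by (simp add: twist_def pcompose_pCons)

lemma S_matrix_ge_2: "n \<ge> 2 \<Longrightarrow> S_matrix q p n = (if even n then diff2 q p else diff3 q p)"
proof (induction n rule: less_induct)
  case (less n)
  consider "n = 2" | "n = 3" | "n \<ge> 4"
    using less.prems by linarith
  then show ?case
  proof cases
    case 1
    then show ?thesis
      using S_matrix.simps(3)[of q p] by (simp flip: numeral_2_eq_2)
  next
    case 2
    then show ?thesis
      using S_matrix.simps(4)[of q p] by (simp flip: numeral_3_eq_3)
  next
    case 3
    define k where "k = n - 4"
    have n: "n = Suc (Suc (Suc (Suc k)))"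
      using 3 by (simp add: k_def)
    show ?thesis
      using less.IH[of "Suc (Suc k)"] unfolding n by simp
  qed
qed

lemmas row_simps = matrix_act_def tensor_act_gwa_of gwa_tensor_simps gwa_tensor_delta
  gwa_carrier_elements tensor_lift_simps sandwich_simps tensor_lift_delta_cases gwa_of_add
  gwa_of_zero twist_z

lemma S_diff_0: "S_diff q p 0 [gwa_of F] = map gwa_of (model_diff0 F)"
  by (simp add: S_diff_def diff0_def Let_def row_simps model_diff0_def)

lemma S_diff_1: "S_diff q p (Suc 0) [gwa_of F, gwa_of G, gwa_of H] = map gwa_of (model_diff1 F G H)"
  by (simp add: S_diff_def diff1_def Let_def row_simps model_diff1_def)

lemma S_diff_even:
  "n \<ge> 2 \<Longrightarrow> even n \<Longrightarrow> S_diff q p n [gwa_of F, gwa_of G, gwa_of H, gwa_of L] =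
    map gwa_of (model_diff2 F G H L)"
  by (simp add: S_diff_def S_matrix_ge_2 diff2_def Let_def row_simps model_diff2_def)

lemma S_diff_odd:
  "n \<ge> 2 \<Longrightarrow> odd n \<Longrightarrow> S_diff q p n [gwa_of F, gwa_of G, gwa_of H, gwa_of L] =
    map gwa_of (model_diff3 F G H L)"
  by (simp add: S_diff_def S_matrix_ge_2 diff3_def Let_def row_simps model_diff3_def)

end

section \<open>Exactness in a single weight\<close>

text \<open>By division with remainder, a nonzero combination of least degree divides every
  combination, in particular \<open>a\<close> and \<open>b\<close>; by coprimality it is a
  unit.\<close>

lemma coprime_poly_bezout:
  fixes a b :: "'k::field poly"
  assumes "coprime a b"
  obtains u v where "u * a + v * b = 1"
proof -
  define I where "I = {u * a + v * b | u v. u * a + v * b \<noteq> 0}"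
  have "a \<noteq> 0 \<or> b \<noteq> 0"
    using assms by auto
  then have "a \<in> I \<or> b \<in> I"
    unfolding I_def by (metis (mono_tags, lifting) CollectI add.left_neutral add.right_neutral
        mult_1 mult_zero_left)
  then obtain d where d: "d \<in> I" "\<And>e. e \<in> I \<Longrightarrow> degree d \<le> degree e"
    using ex_has_least_nat[of "\<lambda>e. e \<in> I" _ degree] by metis
  then obtain u v where uv: "d = u * a + v * b" "d \<noteq> 0"
    by (auto simp: I_def)
  have "d dvd c" if c: "c = s * a + t * b" for c s t
  proof (rule ccontr)
    assume "\<not> d dvd c"
    then have "c mod d \<noteq> 0"
      by (simp add: dvd_eq_mod_eq_0)
    moreover have "c mod d = (s - (c div d) * u) * a + (t - (c div d) * v) * b"
      unfolding minus_div_mult_eq_mod[symmetric] using c uv(1) by (simp add: algebra_simps)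
    ultimately have "c mod d \<in> I"
      unfolding I_def by (metis (mono_tags, lifting) CollectI)
    then show False
      using d(2) \<open>c mod d \<noteq> 0\<close> degree_mod_less[OF uv(2), of c] by fastforce
  qed
  from this[of a 1 0] this[of b 0 1] have "d dvd a" "d dvd b"
    by simp_all
  then have "d dvd 1"
    using assms coprime_common_divisor by blast
  then obtain e where "1 = d * e" ..
  then have "(e * u) * a + (e * v) * b = 1"
    by (simp add: uv algebra_simps)
  then show thesis
    by (rule that)
qed

context gwa_data
begin

section \<open>The differentials in a single weight\<close>

lemma tw_monom: "tw m (monom c i) = monom (c * (q powi m) ^ i) i"
  unfolding tw_def by (rule poly_eqI) simp

text \<open>Multiplying out the two tensor factors, with the second one twisted, yields the
  q^m-derivative of p: z^i goes to (1 + q^m + ... + q^(m(i-1))) z^(i-1).\<close>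

lemma coeff_delta: "coeff (delta m) k = coeff p (Suc k) * (\<Sum>j<Suc k. (q powi m) ^ j)"
proof -
  have inner: "(\<Sum>j=1..i. Polynomial.smult (coeff p i) (monom 1 (i - j) * tw m (monom 1 (j - 1)))) =
      monom (coeff p i * (\<Sum>j<i. (q powi m) ^ j)) (i - 1)" for i
  proof -
    have "(\<Sum>j=1..i. Polynomial.smult (coeff p i) (monom 1 (i - j) * tw m (monom 1 (j - 1)))) =
        (\<Sum>j=1..i. monom (coeff p i * (q powi m) ^ (j - 1)) (i - 1))"
      by (intro sum.cong) (auto simp: tw_monom mult_monom smult_monom)
    also have "\<dots> = (\<Sum>j<i. monom (coeff p i * (q powi m) ^ j) (i - 1))"
      by (rule sum.reindex_bij_witness[of _ Suc "\<lambda>j. j - 1"]) auto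
    also have "\<dots> = monom (\<Sum>j<i. coeff p i * (q powi m) ^ j) (i - 1)"
      by (simp add: monom_sum)
    finally show ?thesis
      by (simp add: sum_distrib_left)
  qed
  have "coeff (delta m) k =
      (\<Sum>i\<le>degree p. if i = Suc k then coeff p i * (\<Sum>j<i. (q powi m) ^ j) else 0)"
    unfolding delta_def inner coeff_sum
  proof (intro sum.cong refl)
    fix i
    \<comment> \<open>For \<open>i = 0\<close> truncated subtraction gives the exponent 0 instead of
      -1, but the monomial is zero because the sum of powers is empty.\<close>
    show "coeff (monom (coeff p i * (\<Sum>j<i. (q powi m) ^ j)) (i - 1)) k =
        (if i = Suc k then coeff p i * (\<Sum>j<i. (q powi m) ^ j) else 0)"
      by (cases i) auto
  qed
  also have "\<dots> = coeff p (Suc k) * (\<Sum>j<Suc k. (q powi m) ^ j)"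
    by (simp add: coeff_eq_0)
  finally show ?thesis .
qed

text \<open>This is the factor in \<open>z f u_m - f u_m z = zeta m f u_m\<close>.\<close>

definition zeta :: "int \<Rightarrow> 'k poly" where
  "zeta m = [:0, 1 - q powi m:]"

text \<open>An opaque name lets ring normalization treat the constant polynomial q as an atom
  instead of turning it into a scalar multiplication.\<close>

definition q_const :: "'k poly" where
  "q_const = [:q:]"

lemma zeta_0 [simp]: "zeta 0 = 0"
  by (simp add: zeta_def)

lemma tw_zeta: "tw 1 (zeta m) = q_const * zeta m" "q_const * tw (-1) (zeta m) = zeta m"
  by (simp_all add: zeta_def tw_def twist_def pcompose_pCons q_const_def power_int_minus q_nonzero)

lemma tw_q_const [simp]: "tw m q_const = q_const"
  by (simp add: q_const_def)

lemma q_const_nonzero [simp]: "q_const \<noteq> 0"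
  by (simp add: q_const_def q_nonzero)

lemma delta_0: "delta 0 = pderiv p"
  by (rule poly_eqI) (simp add: coeff_delta coeff_pderiv mult.commute)

text \<open>Coefficientwise this is the formula for a geometric sum. It is the identity behind
  \<open>wt_complex\<close>.\<close>

lemma delta_zeta: "delta m * zeta m = p - tw m p"
proof (rule poly_eqI)
  fix k
  show "coeff (delta m * zeta m) k = coeff (p - tw m p) k"
  proof (cases k)
    case 0
    then show ?thesis
      by (simp add: zeta_def tw_def)
  next
    case (Suc i)
    have "coeff (delta m * zeta m) k = (1 - q powi m) * coeff (delta m) i"
      by (simp add: zeta_def Suc)
    also have "\<dots> = coeff p k * ((1 - q powi m) * (\<Sum>j<k. (q powi m) ^ j))"
      by (simp only: coeff_delta Suc mult_ac)
    also have "(1 - q powi m) * (\<Sum>j<k. (q powi m) ^ j) = 1 - (q powi m) ^ k"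
      by (simp add: one_diff_power_eq)
    finally show ?thesis
      by (simp add: tw_def algebra_simps)
  qed
qed

text \<open>\<open>wt0\<close> to \<open>wt3\<close> are the differentials in weight \<open>m\<close>. They act on coefficients of \<open>u\<^sub>m\<close>, except that the
  first two arguments of \<open>wt1\<close> and \<open>wt3\<close> belong to \<open>u\<^sub>m\<^sub>+\<^sub>1\<close> and \<open>u\<^sub>m\<^sub>-\<^sub>1\<close>, and so do the last two
  arguments of \<open>wt2\<close>.\<close>

definition wt0 :: "int \<Rightarrow> 'k poly \<Rightarrow> 'k poly \<times> 'k poly \<times> 'k poly" where
  "wt0 m f =
    (tw 1 (f * x_coeff (m + 1)) - f * tw (m + 1) (x_coeff (m + 1)),
     y_coeff (m - 1) * tw (-1) f - f * tw m (y_coeff (m - 1)),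
     zeta m * f)"

definition wt1 :: "int \<Rightarrow> 'k poly \<Rightarrow> 'k poly \<Rightarrow> 'k poly \<Rightarrow> 'k poly \<times> 'k poly \<times> 'k poly \<times> 'k poly" where
  "wt1 m f g h =
    (y_coeff m * tw (-1) f + g * tw m (x_coeff m) - delta m * h,
     f * tw (m + 1) (y_coeff m) + tw 1 (g * x_coeff m) - q_const * tw 1 (delta m) * h,
     q_const * zeta m * f + q_const * h * tw (m + 1) (x_coeff (m + 1)) - tw 1 (h * x_coeff (m + 1)),
     zeta m * g + h * tw m (y_coeff (m - 1)) - q_const * y_coeff (m - 1) * tw (-1) h)"

definition wt2 ::
    "int \<Rightarrow> 'k poly \<Rightarrow> 'k poly \<Rightarrow> 'k poly \<Rightarrow> 'k poly \<Rightarrow> 'k poly \<times> 'k poly \<times> 'k poly \<times> 'k poly" where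
  "wt2 m f g h l =
    (tw 1 (f * x_coeff (m + 1)) - g * tw (m + 1) (x_coeff (m + 1)) - tw 1 (delta m) * h,
     y_coeff (m - 1) * tw (-1) g - f * tw m (y_coeff (m - 1)) - delta m * l,
     zeta m * f - y_coeff m * tw (-1) h - l * tw m (x_coeff m),
     q_const * zeta m * g - h * tw (m + 1) (y_coeff m) - tw 1 (l * x_coeff m))"

definition wt3 ::
    "int \<Rightarrow> 'k poly \<Rightarrow> 'k poly \<Rightarrow> 'k poly \<Rightarrow> 'k poly \<Rightarrow> 'k poly \<times> 'k poly \<times> 'k poly \<times> 'k poly" where
  "wt3 m f g h l =
    (y_coeff m * tw (-1) f + g * tw m (x_coeff m) - delta m * h,
     f * tw (m + 1) (y_coeff m) + tw 1 (g * x_coeff m) - tw 1 (delta m) * l,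
     q_const * zeta m * f - tw 1 (h * x_coeff (m + 1)) + l * tw (m + 1) (x_coeff (m + 1)),
     zeta m * g + h * tw m (y_coeff (m - 1)) - y_coeff (m - 1) * tw (-1) l)"

lemma weight_cases: obtains "m \<ge> 1" | "m = 0" | "m \<le> (-1 :: int)"
  by linarith

text \<open>Once the structure coefficients are 1 or p according to the sign of m, and the twists of
  p by m and m + 1 are eliminated, only identities between commuting atoms remain.\<close>

lemma wt_complex:
  "wt0 m e = (f, g, h) \<Longrightarrow> wt1 m f g h = (0, 0, 0, 0)"
  "wt1 m f g h = (f', g', h', l') \<Longrightarrow> wt2 m f' g' h' l' = (0, 0, 0, 0)"
  "wt2 m f g h l = (f', g', h', l') \<Longrightarrow> wt3 m f' g' h' l' = (0, 0, 0, 0)"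
  "wt3 m f g h l = (f', g', h', l') \<Longrightarrow> wt2 m f' g' h' l' = (0, 0, 0, 0)"
proof -
  \<comment> \<open>The lowest twist of \<open>zeta m\<close> is taken as the atom:
    \<open>zeta m\<close> and \<open>tw 1 (zeta m)\<close> are its multiples by q and q^2, so no
    inverse of q appears.\<close>
  define Z' where "Z' = tw (-1) (zeta m)"
  have Z: "zeta m = q_const * Z'"
    by (simp only: Z'_def tw_zeta)
  \<comment> \<open>Here and in \<open>tw_p'\<close> the identity \<open>delta_zeta\<close>, plain
    and twisted by \<sigma>, expresses the twists of p through p, \<open>tw 1 p\<close> and
    multiples of the atom.\<close>
  have tw_p: "tw m p = p - delta m * (q_const * Z')"
    using delta_zeta[of m] by (simp add: Z algebra_simps)
  have "tw 1 (delta m * zeta m) = tw 1 (p - tw m p)"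
    by (simp only: delta_zeta)
  then have "tw 1 (delta m) * (q_const * zeta m) = tw 1 p - tw (m + 1) p"
    by (simp only: tw_simps tw_zeta add.commute[of 1 m])
  then have tw_p': "tw (m + 1) p = tw 1 p - tw 1 (delta m) * (q_const * (q_const * Z'))"
    by (simp add: Z algebra_simps)
  note defs = wt0_def wt1_def wt2_def wt3_def prod.inject
  have C: "x_coeff (m + 1) = 1" "y_coeff m = p" "x_coeff m = 1" "y_coeff (m - 1) = p" if "m \<ge> 1"
    using that by (auto simp: x_coeff_def y_coeff_def)
  have C0: "x_coeff (m + 1) = 1" "y_coeff m = p" "x_coeff m = p" "y_coeff (m - 1) = 1" if "m = 0"
    using that by (auto simp: x_coeff_def y_coeff_def)
  have Z'_0: "Z' = 0" if "m = 0"
    using that by (simp add: Z'_def)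
  have C': "x_coeff (m + 1) = p" "y_coeff m = 1" "x_coeff m = p" "y_coeff (m - 1) = 1" if "m \<le> -1"
    using that by (auto simp: x_coeff_def y_coeff_def)
  have ar: "1 + -1 = (0::int)" "-1 + 1 = (0::int)" "-1 + (m + 1) = m" "1 + m = m + 1"
    "-1 + m = m - 1" "m + 1 - 1 = m" "1 + (m - 1) = m" "1 + (m + -1) = m" by auto
  note tws = tw_simps(2,4,5,6,7,9,10) tw_zeta(1) tw_q_const mult_1_left mult_1_right Z'_def[symmetric]
  show "wt1 m f g h = (0, 0, 0, 0)"
    if "wt0 m e = (f, g, h)"
  proof (cases rule: weight_cases[of m])
    case 1
    note K = C[OF 1]
    show ?thesis
      using that unfolding defs K
      apply (elim conjE)
      apply hypsubst
      apply (simp only: K tws ar)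
      apply (simp only: Z tw_p tw_p')
      apply (simp add: algebra_simps)
      done
  next
    case 2
    note K = C0[OF 2]
    show ?thesis
      using that unfolding defs K
      by - (elim conjE, hypsubst, simp only: K tws ar, simp only: Z tw_p tw_p',
        simp add: Z'_0[OF 2] algebra_simps)
  next
    case 3
    note K = C'[OF 3]
    show ?thesis
      using that unfolding defs K
      apply (elim conjE)
      apply hypsubst
      apply (simp only: K tws ar)
      apply (simp only: Z tw_p tw_p')
      apply (simp add: algebra_simps)
      done
  qed
  show "wt2 m f' g' h' l' = (0, 0, 0, 0)"
    if "wt1 m f g h = (f', g', h', l')"
  proof (cases rule: weight_cases[of m])
    case 1
    note K = C[OF 1]
    show ?thesis
      using that unfolding defs K
      apply (elim conjE)
      apply hypsubst
      apply (simp only: K tws ar)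
      apply (simp only: Z tw_p tw_p')
      apply (simp add: algebra_simps)
      done
  next
    case 2
    note K = C0[OF 2]
    show ?thesis
      using that unfolding defs K
      by - (elim conjE, hypsubst, simp only: K tws ar, simp only: Z tw_p tw_p',
        simp add: Z'_0[OF 2] algebra_simps)
  next
    case 3
    note K = C'[OF 3]
    show ?thesis
      using that unfolding defs K
      apply (elim conjE)
      apply hypsubst
      apply (simp only: K tws ar)
      apply (simp only: Z tw_p tw_p')
      apply (simp add: algebra_simps)
      done
  qed
  show "wt3 m f' g' h' l' = (0, 0, 0, 0)"
    if "wt2 m f g h l = (f', g', h', l')"
  proof (cases rule: weight_cases[of m])
    case 1
    note K = C[OF 1]
    show ?thesis
      using that unfolding defs K
      apply (elim conjE)
      apply hypsubst
      apply (simp only: K tws ar)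
      apply (simp only: Z tw_p tw_p')
      apply (simp add: algebra_simps)
      done
  next
    case 2
    note K = C0[OF 2]
    show ?thesis
      using that unfolding defs K
      by - (elim conjE, hypsubst, simp only: K tws ar, simp only: Z tw_p tw_p',
        simp add: Z'_0[OF 2] algebra_simps)
  next
    case 3
    note K = C'[OF 3]
    show ?thesis
      using that unfolding defs K
      apply (elim conjE)
      apply hypsubst
      apply (simp only: K tws ar)
      apply (simp only: Z tw_p tw_p')
      apply (simp add: algebra_simps)
      done
  qed
  show "wt2 m f' g' h' l' = (0, 0, 0, 0)"
    if "wt3 m f g h l = (f', g', h', l')"
  proof (cases rule: weight_cases[of m])
    case 1
    note K = C[OF 1]
    show ?thesis
      using that unfolding defs K
      apply (elim conjE)
      apply hypsubst
      apply (simp only: K tws ar)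
      apply (simp only: Z tw_p tw_p')
      apply (simp add: algebra_simps)
      done
  next
    case 2
    note K = C0[OF 2]
    show ?thesis
      using that unfolding defs K
      by - (elim conjE, hypsubst, simp only: K tws ar, simp only: Z tw_p tw_p',
        simp add: Z'_0[OF 2] algebra_simps)
  next
    case 3
    note K = C'[OF 3]
    show ?thesis
      using that unfolding defs K
      apply (elim conjE)
      apply hypsubst
      apply (simp only: K tws ar)
      apply (simp only: Z tw_p tw_p')
      apply (simp add: algebra_simps)
      done
  qed
qed


lemma wt1_cocycleD:
  assumes "wt1 m f g h = (0, 0, 0, 0)"
  shows "y_coeff m * tw (-1) f + g * tw m (x_coeff m) - delta m * h = 0"
    "f * tw (m + 1) (y_coeff m) + tw 1 (g * x_coeff m) - q_const * tw 1 (delta m) * h = 0"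
    "q_const * zeta m * f + q_const * h * tw (m + 1) (x_coeff (m + 1)) - tw 1 (h * x_coeff (m + 1)) = 0"
    "zeta m * g + h * tw m (y_coeff (m - 1)) - q_const * y_coeff (m - 1) * tw (-1) h = 0"
  using assms by (simp_all only: wt1_def prod.inject)

lemma wt2_cocycleD:
  assumes "wt2 m f g h l = (0, 0, 0, 0)"
  shows "tw 1 (f * x_coeff (m + 1)) - g * tw (m + 1) (x_coeff (m + 1)) - tw 1 (delta m) * h = 0"
    "y_coeff (m - 1) * tw (-1) g - f * tw m (y_coeff (m - 1)) - delta m * l = 0"
    "zeta m * f - y_coeff m * tw (-1) h - l * tw m (x_coeff m) = 0"
    "q_const * zeta m * g - h * tw (m + 1) (y_coeff m) - tw 1 (l * x_coeff m) = 0"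
  using assms by (simp_all only: wt2_def prod.inject)

lemma wt3_cocycleD:
  assumes "wt3 m f g h l = (0, 0, 0, 0)"
  shows "y_coeff m * tw (-1) f + g * tw m (x_coeff m) - delta m * h = 0"
    "f * tw (m + 1) (y_coeff m) + tw 1 (g * x_coeff m) - tw 1 (delta m) * l = 0"
    "q_const * zeta m * f - tw 1 (h * x_coeff (m + 1)) + l * tw (m + 1) (x_coeff (m + 1)) = 0"
    "zeta m * g + h * tw m (y_coeff (m - 1)) - y_coeff (m - 1) * tw (-1) l = 0"
  using assms by (simp_all only: wt3_def prod.inject)

lemma tw_eq_0 [simp]: "tw m f = 0 \<longleftrightarrow> f = 0"
proof
  assume "tw m f = 0"
  then have "tw (- m) (tw m f) = 0"
    by simp
  then show "f = 0"
    by (simp only: tw_simps add.left_inverse)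
qed simp

lemma tw_inject: "tw m f = tw m g \<longleftrightarrow> f = g"
  using tw_eq_0[of m "f - g"] by (simp del: tw_eq_0)

end

section \<open>Exactness in nonzero weights and in high degrees\<close>

locale gwa_generic = gwa_data q p for q :: "'k::field" and p +
  assumes q_not_root_of_unity: "\<forall>m>0. q ^ m \<noteq> 1"
    and degree_pos: "degree p \<ge> 1"
    and no_multiple_roots: "coprime p (pderiv p)"
begin

text \<open>A Bezout relation makes p' invertible modulo p.\<close>

lemma p_dvd_pderiv_mult:
  assumes "p dvd pderiv p * h"
  shows "p dvd h"
proof -
  obtain u v where "u * p + v * pderiv p = 1"
    using coprime_poly_bezout[OF no_multiple_roots] .
  then have "h = (u * p + v * pderiv p) * h"
    by simp
  also have "\<dots> = p * (u * h) + v * (pderiv p * h)"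
    by (simp add: algebra_simps)
  finally have "h = p * (u * h) + v * (pderiv p * h)" .
  then show ?thesis
    using assms by (metis dvd_add dvd_mult dvd_triv_left)
qed

lemma p_nonzero: "p \<noteq> 0"
  using degree_pos by auto

lemma q_power_int_neq_1: "m \<noteq> 0 \<Longrightarrow> q powi m \<noteq> 1"
  using q_not_root_of_unity[rule_format, of "nat m"] q_not_root_of_unity[rule_format, of "nat (- m)"]
  by (auto simp: power_int_def power_inverse)

lemma q_power_eq_iff: "q ^ i = q ^ j \<longleftrightarrow> i = j"
proof -
  have "q powi (int i - int j) = q ^ i / q ^ j"
    using q_nonzero by (simp add: power_int_diff)
  then show ?thesis
    using q_power_int_neq_1[of "int i - int j"] q_nonzero by auto
qed

lemma q_neq_1: "q \<noteq> 1"
  using q_power_eq_iff[of 1 0] by simp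

text \<open>For m nonzero, \<open>zeta m\<close> is a nonzero multiple of z, so its multiples have
  no constant term. This is how leftover constants are shown to vanish.\<close>

lemma zeta_const_eq_0:
  assumes "m \<noteq> 0" "zeta m * f = [:c:]"
  shows "f = 0 \<and> c = 0"
proof -
  have "pCons 0 (Polynomial.smult (1 - q powi m) f) = [:c:]"
    using assms(2) by (simp add: zeta_def)
  then show ?thesis
    using q_power_int_neq_1[OF assms(1)] by simp
qed

lemma zeta_division:
  assumes "m \<noteq> 0"
  obtains f c where "h = zeta m * f + [:c:]"
proof -
  obtain c g where h: "h = pCons c g"
    by (cases h)
  have "h = zeta m * Polynomial.smult (inverse (1 - q powi m)) g + [:c:]"
    using q_power_int_neq_1[OF assms] by (simp add: h zeta_def)
  then show ?thesis
    by (rule that)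
qed

text \<open>For m \<ge> 0 the first and third equations contain g and l multiplied by (a twist of) 1
  or p, which can be cancelled. For m \<le> -1 the second and third do the same for g and h. The
  lemma upgrades agreement in two components to equality with a coboundary.\<close>

lemma wt2_unique:
  assumes "wt2 m f g h l = (0, 0, 0, 0)" "wt2 m f' g' h' l' = (0, 0, 0, 0)"
  shows "m \<ge> 0 \<Longrightarrow> f = f' \<Longrightarrow> h = h' \<Longrightarrow> g = g' \<and> l = l'"
    and "m \<le> -1 \<Longrightarrow> f = f' \<Longrightarrow> l = l' \<Longrightarrow> g = g' \<and> h = h'"
proof -
  assume *: "m \<ge> 0" "f = f'" "h = h'"
  have "g * tw (m + 1) (x_coeff (m + 1)) = g' * tw (m + 1) (x_coeff (m + 1))"
    using trans[OF wt2_cocycleD(1)[OF assms(1)] wt2_cocycleD(1)[OF assms(2), symmetric]]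
    unfolding *(2,3) by simp
  moreover have "l * tw m (x_coeff m) = l' * tw m (x_coeff m)"
    using trans[OF wt2_cocycleD(3)[OF assms(1)] wt2_cocycleD(3)[OF assms(2), symmetric]]
    unfolding *(2,3) by simp
  ultimately show "g = g' \<and> l = l'"
    using p_nonzero by (simp add: x_coeff_def split: if_splits)
next
  assume *: "m \<le> -1" "f = f'" "l = l'"
  have "y_coeff (m - 1) * tw (-1) g = y_coeff (m - 1) * tw (-1) g'"
    using trans[OF wt2_cocycleD(2)[OF assms(1)] wt2_cocycleD(2)[OF assms(2), symmetric]]
    unfolding *(2,3) by simp
  moreover have "y_coeff m * tw (-1) h = y_coeff m * tw (-1) h'"
    using trans[OF wt2_cocycleD(3)[OF assms(1)] wt2_cocycleD(3)[OF assms(2), symmetric]]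
    unfolding *(2,3) by simp
  ultimately show "g = g' \<and> h = h'"
    using p_nonzero by (simp add: y_coeff_def tw_inject split: if_splits)
qed

lemma wt3_unique:
  assumes "wt3 m f g h l = (0, 0, 0, 0)" "wt3 m f' g' h' l' = (0, 0, 0, 0)"
  shows "m \<ge> 0 \<Longrightarrow> f = f' \<Longrightarrow> h = h' \<Longrightarrow> g = g' \<and> l = l'"
    and "m \<le> -1 \<Longrightarrow> g = g' \<Longrightarrow> h = h' \<Longrightarrow> f = f' \<and> l = l'"
proof -
  assume *: "m \<ge> 0" "f = f'" "h = h'"
  have "l * tw (m + 1) (x_coeff (m + 1)) = l' * tw (m + 1) (x_coeff (m + 1))"
    using trans[OF wt3_cocycleD(3)[OF assms(1)] wt3_cocycleD(3)[OF assms(2), symmetric]]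
    unfolding *(2,3) by simp
  moreover have "g * tw m (x_coeff m) = g' * tw m (x_coeff m)"
    using trans[OF wt3_cocycleD(1)[OF assms(1)] wt3_cocycleD(1)[OF assms(2), symmetric]]
    unfolding *(2,3) by simp
  ultimately show "g = g' \<and> l = l'"
    using p_nonzero by (simp add: x_coeff_def split: if_splits)
next
  assume *: "m \<le> -1" "g = g'" "h = h'"
  have "y_coeff m * tw (-1) f = y_coeff m * tw (-1) f'"
    using trans[OF wt3_cocycleD(1)[OF assms(1)] wt3_cocycleD(1)[OF assms(2), symmetric]]
    unfolding *(2,3) by simp
  moreover have "y_coeff (m - 1) * tw (-1) l = y_coeff (m - 1) * tw (-1) l'"
    using trans[OF wt3_cocycleD(4)[OF assms(1)] wt3_cocycleD(4)[OF assms(2), symmetric]]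
    unfolding *(2,3) by simp
  ultimately show "f = f' \<and> l = l'"
    using p_nonzero by (simp add: y_coeff_def tw_inject split: if_splits)
qed

text \<open>The third component of \<open>wt0 m e\<close> is \<open>zeta m * e\<close>, so e is
  found by dividing h by \<open>zeta m\<close>, up to a constant; f and g are then determined
  because \<open>zeta m\<close> is nonzero.\<close>

lemma wt1_exact:
  assumes m: "m \<noteq> 0" and cocycle: "wt1 m f g h = (0, 0, 0, 0)"
  shows "\<exists>e. wt0 m e = (f, g, h)"
proof -
  obtain e c where h: "h = zeta m * e + [:c:]"
    using zeta_division[OF m] by blast
  obtain f' g' where d: "wt0 m e = (f', g', zeta m * e)"
    by (simp add: wt0_def)
  note cocycle' = wt_complex(1)[OF d]
  define C where "C = [:c:]"
  have C: "tw k C = C" for k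
    by (simp add: C_def)
  have h': "h = zeta m * e + C"
    by (simp add: h C_def)
  \<comment> \<open>Subtracting the cocycle equations of the coboundary expresses the constant (1 -
    q) c, up to sign, as a multiple of \<open>zeta m\<close>. The equation with structure
    coefficient 1 is used: the third for m \<ge> 1, the fourth for m \<le> -1.\<close>
  have c: "c = 0"
  proof (cases "m \<ge> 1")
    case True
    then have "q_const * zeta m * f + q_const * h - tw 1 h =
        q_const * zeta m * f' + q_const * (zeta m * e) - tw 1 (zeta m * e)"
      using wt1_cocycleD(3)[OF cocycle] wt1_cocycleD(3)[OF cocycle'] by (simp add: x_coeff_def)
    then have "zeta m * (q_const * (f - f')) = C - q_const * C"
      by (simp add: h' C algebra_simps)
    also have "\<dots> = [:c * (1 - q):]"
      by (simp add: C_def q_const_def algebra_simps)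
    finally show ?thesis
      using zeta_const_eq_0[OF m] q_neq_1 by fastforce
  next
    case False
    then have "zeta m * g + h - q_const * tw (-1) h =
        zeta m * g' + zeta m * e - q_const * tw (-1) (zeta m * e)"
      using m wt1_cocycleD(4)[OF cocycle] wt1_cocycleD(4)[OF cocycle'] by (simp add: y_coeff_def)
    then have "zeta m * (g - g') = q_const * C - C"
      by (simp add: h' C algebra_simps)
    also have "\<dots> = [:c * (q - 1):]"
      by (simp add: C_def q_const_def algebra_simps)
    finally show ?thesis
      using zeta_const_eq_0[OF m] q_neq_1 by fastforce
  qed
  have "q_const * zeta m * f = q_const * zeta m * f'" "zeta m * g = zeta m * g'"
    using trans[OF wt1_cocycleD(3)[OF cocycle] wt1_cocycleD(3)[OF cocycle', symmetric]]
      trans[OF wt1_cocycleD(4)[OF cocycle] wt1_cocycleD(4)[OF cocycle', symmetric]]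
    by (simp_all add: h c)
  moreover have "zeta m \<noteq> 0"
    using q_power_int_neq_1[OF m] by (simp add: zeta_def)
  ultimately have "f = f'" "g = g'"
    by simp_all
  then show ?thesis
    using d by (auto simp: h c)
qed

text \<open>For m \<ge> 0 the components f and h are matched, for m \<le> -1 the components g and h,
  so that \<open>wt3_unique\<close> gives the rest.\<close>

lemma wt3_exact:
  assumes cocycle: "wt3 m f g h l = (0, 0, 0, 0)"
  shows "\<exists>F G H L. wt2 m F G H L = (f, g, h, l)"
proof -
  consider "m \<ge> 0" | "m \<le> -1"
    by linarith
  then show ?thesis
  proof cases
    case 1
    \<comment> \<open>With first and third arguments 0, the third component of \<open>wt2\<close> is
      this product. In weight 0 it is a multiple of p, and the first cocycle equation shows that p
      divides p' h, hence h.\<close>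
    have "\<exists>L. - L * tw m (x_coeff m) = h"
    proof (cases "m = 0")
      case True
      have "p * tw (-1) f + g * p - pderiv p * h = 0"
        using wt3_cocycleD(1)[OF cocycle] unfolding True
        by (simp only: x_coeff_def y_coeff_def delta_0 tw_simps) simp
      then have "p dvd pderiv p * h"
        by (metis dvd_add dvd_triv_left dvd_triv_right eq_iff_diff_eq_0)
      then obtain k where "h = p * k"
        using p_dvd_pderiv_mult by blast
      then show ?thesis
        using True by (intro exI[of _ "- k"]) (simp add: x_coeff_def)
    next
      case False
      then show ?thesis
        using 1 by (intro exI[of _ "- h"]) (simp add: x_coeff_def)
    qed
    then obtain L where L: "- L * tw m (x_coeff m) = h"
      by blast
    obtain g' l' where d: "wt2 m 0 (- f) 0 L = (f, g', h, l')"
      using 1 L by (simp add: wt2_def x_coeff_def)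
    show ?thesis
      using d wt3_unique(1)[OF cocycle wt_complex(3)[OF d] 1] by metis
  next
    case 2
    \<comment> \<open>Here both y-coefficients are 1: the first argument -g produces g in the second
      component, and the third argument is solved from the third component.\<close>
    obtain f' l' where d: "wt2 m (- g) 0 (tw 1 (- zeta m * g - h)) 0 = (f', g, h, l')"
      using 2 by (simp add: wt2_def y_coeff_def)
    show ?thesis
      using d wt3_unique(2)[OF cocycle wt_complex(3)[OF d] 2] by metis
  qed
qed

text \<open>The third and fourth arguments of \<open>wt3\<close> are independent, so H can serve the
  first component while L repairs the third. In weight 0 the first component takes values in p k[z]
  + p' k[z], which is everything by Bezout.\<close>

lemma wt2_exact:
  assumes cocycle: "wt2 m f g h l = (0, 0, 0, 0)"
  shows "\<exists>F G H L. wt3 m F G H L = (f, g, h, l)"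
proof -
  consider "m \<ge> 0" | "m \<le> -1"
    by linarith
  then show ?thesis
  proof cases
    case 1
    have "\<exists>G H. G * tw m (x_coeff m) - delta m * H = f"
    proof (cases "m = 0")
      case True
      obtain u v where "u * p + v * pderiv p = 1"
        using coprime_poly_bezout[OF no_multiple_roots] .
      then have "(u * p + v * pderiv p) * f = f"
        by simp
      then have "(u * f) * p - pderiv p * (- (v * f)) = f"
        by (simp add: algebra_simps)
      then show ?thesis
        using True by (intro exI[of _ "u * f"] exI[of _ "- (v * f)"]) (simp add: x_coeff_def delta_0)
    next
      case False
      then show ?thesis
        using 1 by (intro exI[of _ f] exI[of _ 0]) (simp add: x_coeff_def)
    qed
    then obtain G H where GH: "G * tw m (x_coeff m) - delta m * H = f"
      by blast
    \<comment> \<open>With first argument 0 and x-coefficient 1 the third component is L -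
      \<sigma>(H); the last argument is chosen to make it h.\<close>
    obtain g' l' where d: "wt3 m 0 G H (h + tw 1 H) = (f, g', h, l')"
      using 1 GH by (simp add: wt3_def x_coeff_def)
    show ?thesis
      using d wt2_unique(1)[OF cocycle wt_complex(4)[OF d] 1] by metis
  next
    case 2
    obtain g' h' where d: "wt3 m (tw 1 f) 0 0 (- tw 1 l) = (f, g', h', l)"
      using 2 by (simp add: wt3_def y_coeff_def)
    show ?thesis
      using d wt2_unique(2)[OF cocycle wt_complex(4)[OF d] 2] by metis
  qed
qed

text \<open>In degree 2 a single H enters both the third and the fourth component, so it cannot be
  adjusted for each separately. For m nonzero, \<open>zeta m\<close> reaches everything but the
  constants in both; H absorbs one constant and the cocycle condition removes the other.\<close>

lemma wt2_exact':
  assumes m: "m \<noteq> 0" and cocycle: "wt2 m f g h l = (0, 0, 0, 0)"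
  shows "\<exists>F G H. wt1 m F G H = (f, g, h, l)"
proof -
  have zeta: "zeta m \<noteq> 0"
    using q_power_int_neq_1[OF m] by (simp add: zeta_def)
  have qi: "q_const * [:inverse q:] = 1"
    by (simp add: q_const_def q_nonzero one_pCons)
  consider "m \<ge> 1" | "m \<le> -1"
    using m by linarith
  then show ?thesis
  proof cases
    case 1
    obtain e c where h: "h = zeta m * e + [:c:]"
      using zeta_division[OF m] by blast
    \<comment> \<open>A constant H contributes q H - \<sigma>(H) = (q - 1) H to the third component,
      which has to equal c.\<close>
    define H where "H = [:c / (q - 1):]"
    \<comment> \<open>The fourth component is now matched up to a constant d. Comparing the third
      cocycle equations below gives \<open>zeta m * (f - f') = [:d:]\<close>, whence d = 0 and f =
      f'.\<close>
    obtain G d where l: "l - (H * tw m p - q_const * p * H) = zeta m * G + [:d:]"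
      using zeta_division[OF m] by blast
    have "q_const * zeta m * ([:inverse q:] * e) = zeta m * e"
      using qi by (metis mult.assoc mult.commute mult_1)
    moreover have "(q - 1) * (c / (q - 1)) = c"
      using q_neq_1 by simp
    then have "q * (c / (q - 1)) - c / (q - 1) = c"
      by (simp only: left_diff_distrib mult_1_left)
    then have "q_const * H - H = [:c:]"
      by (simp add: H_def q_const_def mult.commute)
    ultimately have "q_const * zeta m * ([:inverse q:] * e) + (q_const * H - H) = h"
      by (simp only: h)
    moreover have H: "tw k H = H" for k
      by (simp add: H_def)
    ultimately have "q_const * zeta m * ([:inverse q:] * e) + q_const * H * tw (m + 1) (x_coeff (m + 1))
        - tw 1 (H * x_coeff (m + 1)) = h"
      using 1 by (simp only: x_coeff_def) (simp add: add_diff_eq)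
    moreover have "zeta m * G + H * tw m (y_coeff (m - 1)) - q_const * y_coeff (m - 1) * tw (-1) H =
        l - [:d:]"
      using 1 l H by (simp add: y_coeff_def algebra_simps)
    ultimately obtain f' g' where D: "wt1 m ([:inverse q:] * e) G H = (f', g', h, l - [:d:])"
      by (simp only: wt1_def)
    note cocycle' = wt_complex(2)[OF D]
    have "zeta m * f = y_coeff m * tw (-1) h + l" "zeta m * f' = y_coeff m * tw (-1) h + l - [:d:]"
      using wt2_cocycleD(3)[OF cocycle] wt2_cocycleD(3)[OF cocycle'] 1
      by (simp_all add: x_coeff_def algebra_simps)
    then have "zeta m * (f - f') = [:d:]"
      by (simp add: algebra_simps)
    then have "f - f' = 0 \<and> d = 0"
      by (rule zeta_const_eq_0[OF m])
    then have "f = f'" "d = 0"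
      by simp_all
    moreover from this have "g = g'"
      using wt2_unique(1)[OF cocycle cocycle'] 1 by simp
    ultimately show ?thesis
      using D by auto
  next
    case 2
    obtain e c where l: "l = zeta m * e + [:c:]"
      using zeta_division[OF m] by blast
    \<comment> \<open>The roles are exchanged: for negative m the fourth component has structure
      coefficient 1 and a constant H contributes (1 - q) H to it, while the third is matched up to a
      constant.\<close>
    define H where "H = [:c / (1 - q):]"
    obtain F d where h: "h - (q_const * H * tw (m + 1) (x_coeff (m + 1)) - tw 1 (H * x_coeff (m + 1))) =
        zeta m * F + [:d:]"
      using zeta_division[OF m] by blast
    have "q_const * zeta m * ([:inverse q:] * F) = zeta m * F"
      using qi by (metis mult.assoc mult.commute mult_1)
    then have "q_const * zeta m * ([:inverse q:] * F) + q_const * H * tw (m + 1) (x_coeff (m + 1))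
        - tw 1 (H * x_coeff (m + 1)) = h - [:d:]"
      using h by (simp add: algebra_simps)
    moreover have "(1 - q) * (c / (1 - q)) = c"
      using q_neq_1 by simp
    then have "c / (1 - q) - q * (c / (1 - q)) = c"
      by (simp only: left_diff_distrib mult_1_left)
    then have "H - q_const * H = [:c:]"
      by (simp add: H_def q_const_def mult.commute)
    then have "zeta m * e + H - q_const * H = l"
      by (simp add: l algebra_simps)
    then have "zeta m * e + H * tw m (y_coeff (m - 1)) - q_const * y_coeff (m - 1) * tw (-1) H = l"
      using 2 by (simp add: y_coeff_def H_def)
    ultimately obtain f' g' where D: "wt1 m ([:inverse q:] * F) e H = (f', g', h - [:d:], l)"
      by (simp add: wt1_def)
    note cocycle' = wt_complex(2)[OF D]
    have "zeta m * f = tw (-1) h + l * tw m p" "zeta m * f' = tw (-1) h + l * tw m p - [:d:]"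
      using wt2_cocycleD(3)[OF cocycle] wt2_cocycleD(3)[OF cocycle'] 2
      by (simp_all add: x_coeff_def y_coeff_def algebra_simps)
    then have "zeta m * (f - f') = [:d:]"
      by (simp add: algebra_simps)
    then have "f - f' = 0 \<and> d = 0"
      by (rule zeta_const_eq_0[OF m])
    then have "f = f'" "d = 0"
      by simp_all
    moreover from this have "g = g'"
      using wt2_unique(2)[OF cocycle cocycle'] 2 by simp
    ultimately show ?thesis
      using D by auto
  qed
qed

end

section \<open>Assembling homogeneous preimages\<close>

lemma poly_mapping_eq_shift:
  "F = G \<longleftrightarrow> (\<forall>m. Poly_Mapping.lookup F (m + k) = Poly_Mapping.lookup G (m + k))" for k :: int
proof
  assume *: "\<forall>m. Poly_Mapping.lookup F (m + k) = Poly_Mapping.lookup G (m + k)"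
  show "F = G"
    using *[rule_format, of "_ - k"] by (intro poly_mapping_eqI) simp
qed simp

lemma poly_mapping_shift_exists:
  fixes f :: "int \<Rightarrow> 'a::zero"
  assumes "finite {m. f m \<noteq> 0}"
  obtains F where "\<And>m. Poly_Mapping.lookup F (m + k) = f m"
proof -
  have "{m. f (m - k) \<noteq> 0} \<subseteq> (\<lambda>m. m + k) ` {m. f m \<noteq> 0}"
    by (auto intro!: image_eqI[of _ _ "_ - k"])
  then have "finite {m. f (m - k) \<noteq> 0}"
    using assms by (meson finite_imageI finite_subset)
  then show thesis
    by (intro that[of "Abs_poly_mapping (\<lambda>m. f (m - k))"]) simp
qed

text \<open>Homogeneous preimages assemble to a preimage, since they can be taken to be zero in almost
  all degrees.\<close>

lemma graded_choice:
  fixes P :: "int \<Rightarrow> 'a::zero \<Rightarrow> 'a \<Rightarrow> 'a \<Rightarrow> 'a \<Rightarrow> bool"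
  assumes ex: "\<And>m. \<exists>a b c d. P m a b c d" and fin: "finite {m. \<not> P m 0 0 0 0}"
  obtains F G H L where "\<And>m. P m (Poly_Mapping.lookup F (m + i)) (Poly_Mapping.lookup G (m + j))
    (Poly_Mapping.lookup H (m + k)) (Poly_Mapping.lookup L (m + l))"
proof -
  have "\<forall>m. \<exists>a b c d. P m a b c d \<and> (P m 0 0 0 0 \<longrightarrow> a = 0 \<and> b = 0 \<and> c = 0 \<and> d = 0)"
    using ex by metis
  then obtain a b c d where *: "\<And>m. P m (a m) (b m) (c m) (d m)"
    "\<And>m. P m 0 0 0 0 \<Longrightarrow> a m = 0 \<and> b m = 0 \<and> c m = 0 \<and> d m = 0"
    by metis
  have "finite {m. a m \<noteq> 0}" "finite {m. b m \<noteq> 0}" "finite {m. c m \<noteq> 0}" "finite {m. d m \<noteq> 0}"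
    using * by (auto intro!: finite_subset[OF _ fin])
  then obtain F G H L where "\<And>m. Poly_Mapping.lookup F (m + i) = a m"
    "\<And>m. Poly_Mapping.lookup G (m + j) = b m" "\<And>m. Poly_Mapping.lookup H (m + k) = c m"
    "\<And>m. Poly_Mapping.lookup L (m + l) = d m"
    by (metis poly_mapping_shift_exists)
  then show thesis
    using *(1) by (intro that[of F G H L]) simp
qed

lemma finite_lookup_shift: "finite {m. Poly_Mapping.lookup F (m + k) \<noteq> 0}" for k :: int
proof -
  have "{m. Poly_Mapping.lookup F (m + k) \<noteq> 0} \<subseteq> (\<lambda>m. m - k) ` Poly_Mapping.keys F"
    by (auto simp: in_keys_iff intro!: image_eqI[of _ _ "_ + k"])
  then show ?thesis
    by (meson finite_imageI finite_keys finite_subset)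
qed

lemma submodule_zero:
  assumes "Module.module class_ring V"
  shows "submodule class_ring {\<zero>\<^bsub>V\<^esub>} V"
proof -
  interpret Module.module class_ring V by fact
  show ?thesis
    using assms smult_r_null[simplified] by unfold_locales auto
qed

context gwa_data
begin

text \<open>The commutators with z and \<sigma>(z) act on coefficients in weights m, m + 1 and m -
  1; all of them reduce to \<open>zeta m\<close> or q times it.\<close>

lemma zeta_mult:
  "[:0, 1:] * f - f * tw m [:0, 1:] = zeta m * f"
  "[:0, q:] * f - f * tw (m + 1) [:0, 1:] = q_const * zeta m * f"
  "[:0, 1:] * f - f * tw (m - 1) [:0, q:] = zeta m * f"
  "[:0, q:] * f - f * tw m [:0, q:] = q_const * zeta m * f"
proof -
  have tw: "tw k [:0, c:] = [:0, c * q powi k:]" for k c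
    by (simp add: tw_def twist_def pcompose_pCons)
  have q: "q powi (m + 1) = q * q powi m" "q * q powi (m - 1) = q powi m"
    using q_nonzero power_int_add_1'[of q m] power_int_add_1'[of q "m - 1"] by simp_all
  have eq: "[:0, a:] * f - f * [:0, b:] = [:0, a - b:] * f" for a b
    by (simp add: smult_diff_left mult.commute[of f])
  have zeta: "q_const * zeta m = [:0, q - q * q powi m:]"
    by (simp add: q_const_def zeta_def algebra_simps)
  show "[:0, 1:] * f - f * tw m [:0, 1:] = zeta m * f"
    "[:0, q:] * f - f * tw (m + 1) [:0, 1:] = q_const * zeta m * f"
    "[:0, 1:] * f - f * tw (m - 1) [:0, q:] = zeta m * f"
    "[:0, q:] * f - f * tw m [:0, q:] = q_const * zeta m * f"
    unfolding tw eq zeta by (simp_all only: zeta_def q mult_1)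
qed

lemma model_diff0_eq_iff:
  "model_diff0 F = [a, b, c] \<longleftrightarrow>
    (\<forall>m. wt0 m (Poly_Mapping.lookup F m) =
      (Poly_Mapping.lookup a (m + 1), Poly_Mapping.lookup b (m - 1), Poly_Mapping.lookup c m))"
proof -
  have "model_diff0 F = [a, b, c] \<longleftrightarrow>
    (\<forall>m. Poly_Mapping.lookup (model_diff0 F ! 0) (m + 1) = Poly_Mapping.lookup a (m + 1) \<and>
      Poly_Mapping.lookup (model_diff0 F ! 1) (m - 1) = Poly_Mapping.lookup b (m - 1) \<and>
      Poly_Mapping.lookup (model_diff0 F ! 2) m = Poly_Mapping.lookup c m)"
    using poly_mapping_eq_shift[of "model_diff0 F ! 0" a 1]
      poly_mapping_eq_shift[of "model_diff0 F ! 1" b "-1"]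
      poly_mapping_eq_shift[of "model_diff0 F ! 2" c 0]
    by (auto simp: model_diff0_def)
  also have "\<dots> \<longleftrightarrow> (\<forall>m. wt0 m (Poly_Mapping.lookup F m) =
      (Poly_Mapping.lookup a (m + 1), Poly_Mapping.lookup b (m - 1), Poly_Mapping.lookup c m))"
    unfolding model_diff0_def wt0_def prod.inject nth_Cons_0 nth_Cons_Suc One_nat_def numeral_2_eq_2
    by (simp only: lookup_minus lookup_action zeta_mult add_diff_cancel diff_add_cancel)
  finally show ?thesis .
qed

text \<open>The two patterns of shifts reflect that x and y have weights 1 and -1: after an odd
  number of differentials beyond the first the last two entries are shifted, otherwise the first
  two.\<close>

lemma model_diff_eq_iff:
  "[a', b', c', d'] = [a, b, c, d] \<longleftrightarrow>
    (\<forall>m. Poly_Mapping.lookup a' m = Poly_Mapping.lookup a m \<and>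
      Poly_Mapping.lookup b' m = Poly_Mapping.lookup b m \<and>
      Poly_Mapping.lookup c' (m + 1) = Poly_Mapping.lookup c (m + 1) \<and>
      Poly_Mapping.lookup d' (m - 1) = Poly_Mapping.lookup d (m - 1))"
  "[a', b', c', d'] = [a, b, c, d] \<longleftrightarrow>
    (\<forall>m. Poly_Mapping.lookup a' (m + 1) = Poly_Mapping.lookup a (m + 1) \<and>
      Poly_Mapping.lookup b' (m - 1) = Poly_Mapping.lookup b (m - 1) \<and>
      Poly_Mapping.lookup c' m = Poly_Mapping.lookup c m \<and>
      Poly_Mapping.lookup d' m = Poly_Mapping.lookup d m)"
  for a b c d a' b' c' d' :: "'k graded"
  using poly_mapping_eq_shift[of a' a 0] poly_mapping_eq_shift[of b' b 0]
    poly_mapping_eq_shift[of c' c 0] poly_mapping_eq_shift[of d' d 0]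
    poly_mapping_eq_shift[of a' a 1] poly_mapping_eq_shift[of b' b "-1"]
    poly_mapping_eq_shift[of c' c 1] poly_mapping_eq_shift[of d' d "-1"]
  by auto

lemmas weight_simps = lookup_action lookup_delta_act zeta_mult
  lookup_minus lookup_add lookup_uminus add_diff_cancel diff_add_cancel add_0_right diff_zero
  tw_simps(9) uminus_add_conv_diff mult.assoc add_diff_eq

lemmas q_const_simps = q_const_def[symmetric] tw_q_const mult.commute[of _ q_const] mult.left_commute[of _ q_const]

lemma model_diff1_eq_iff:
  "model_diff1 F G H = [a, b, c, d] \<longleftrightarrow>
    (\<forall>m. wt1 m (Poly_Mapping.lookup F (m + 1)) (Poly_Mapping.lookup G (m - 1)) (Poly_Mapping.lookup H m) =
      (Poly_Mapping.lookup a m, Poly_Mapping.lookup b m,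
       Poly_Mapping.lookup c (m + 1), Poly_Mapping.lookup d (m - 1)))"
  unfolding model_diff1_def model_diff_eq_iff(1) wt1_def prod.inject
  by (simp only: weight_simps; (simp only: q_const_simps)?)

lemma model_diff2_eq_iff:
  "model_diff2 F G H L = [a, b, c, d] \<longleftrightarrow>
    (\<forall>m. wt2 m (Poly_Mapping.lookup F m) (Poly_Mapping.lookup G m)
        (Poly_Mapping.lookup H (m + 1)) (Poly_Mapping.lookup L (m - 1)) =
      (Poly_Mapping.lookup a (m + 1), Poly_Mapping.lookup b (m - 1),
       Poly_Mapping.lookup c m, Poly_Mapping.lookup d m))"
  unfolding model_diff2_def model_diff_eq_iff(2) wt2_def prod.inject
  by (simp only: weight_simps; (simp only: q_const_simps)?)

lemma model_diff3_eq_iff: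
  "model_diff3 F G H L = [a, b, c, d] \<longleftrightarrow>
    (\<forall>m. wt3 m (Poly_Mapping.lookup F (m + 1)) (Poly_Mapping.lookup G (m - 1))
        (Poly_Mapping.lookup H m) (Poly_Mapping.lookup L m) =
      (Poly_Mapping.lookup a m, Poly_Mapping.lookup b m,
       Poly_Mapping.lookup c (m + 1), Poly_Mapping.lookup d (m - 1)))"
  unfolding model_diff3_def model_diff_eq_iff(1) wt3_def prod.inject
  by (simp only: weight_simps; (simp only: q_const_simps)?)

section \<open>The complex as a complex of vector spaces\<close>

lemma S_term_module: "Module.module class_ring (S_term q p n)"
  by (simp add: S_term_def module_power_space module_gwa)

lemma length_1_cases: "length v = Suc 0 \<longleftrightarrow> (\<exists>a. v = [a])"
  and length_3_cases: "length v = 3 \<longleftrightarrow> (\<exists>a b c. v = [a, b, c])"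
  and length_4_cases: "length v = 4 \<longleftrightarrow> (\<exists>a b c d. v = [a, b, c, d])"
  by (auto simp: length_Suc_conv numeral_3_eq_3 eval_nat_numeral)

lemma S_term_carrier:
  "v \<in> carrier (S_term q p 0) \<longleftrightarrow> (\<exists>F. v = [gwa_of F])"
  "v \<in> carrier (S_term q p (Suc 0)) \<longleftrightarrow> (\<exists>F G H. v = [gwa_of F, gwa_of G, gwa_of H])"
  "n \<ge> 2 \<Longrightarrow> v \<in> carrier (S_term q p n) \<longleftrightarrow> (\<exists>F G H L. v = [gwa_of F, gwa_of G, gwa_of H, gwa_of L])"
proof -
  have *: "v \<in> carrier (S_term q p n) \<longleftrightarrow>
      (\<exists>Fs. v = map gwa_of Fs \<and> length Fs = (if n = 0 then 1 else if n = 1 then 3 else 4))" for n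
    by (auto simp: S_term_def range_map_gwa_of)
  show "v \<in> carrier (S_term q p 0) \<longleftrightarrow> (\<exists>F. v = [gwa_of F])"
    unfolding * by (auto simp: length_1_cases intro: exI[of _ "[_]"])
  show "v \<in> carrier (S_term q p (Suc 0)) \<longleftrightarrow> (\<exists>F G H. v = [gwa_of F, gwa_of G, gwa_of H])"
    unfolding * by (auto simp: length_3_cases intro: exI[of _ "[_, _, _]"])
  show "v \<in> carrier (S_term q p n) \<longleftrightarrow> (\<exists>F G H L. v = [gwa_of F, gwa_of G, gwa_of H, gwa_of L])"
    if "n \<ge> 2"
    using that unfolding * by (auto simp: length_4_cases intro: exI[of _ "[_, _, _, _]"])
qed

lemma S_term_zero:
  "\<zero>\<^bsub>S_term q p 0\<^esub> = map gwa_of [0]"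
  "\<zero>\<^bsub>S_term q p (Suc 0)\<^esub> = map gwa_of [0, 0, 0]"
  "n \<ge> 2 \<Longrightarrow> \<zero>\<^bsub>S_term q p n\<^esub> = map gwa_of [0, 0, 0, 0]"
  by (simp_all add: S_term_def map_gwa_of_zero eval_nat_numeral)

lemma S_term_add: "map gwa_of Fs \<oplus>\<^bsub>S_term q p n\<^esub> map gwa_of Gs = map gwa_of (map2 (+) Fs Gs)"
  and S_term_scale: "c \<odot>\<^bsub>S_term q p n\<^esub> map gwa_of Fs = map gwa_of (map (left_poly [:c:]) Fs)"
  by (simp_all add: S_term_def map_gwa_of_add map_gwa_of_scale)

lemma S_term_ops:
  "[gwa_of F] \<oplus>\<^bsub>S_term q p n\<^esub> [gwa_of F'] = [gwa_of (F + F')]"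
  "[gwa_of F, gwa_of G, gwa_of H] \<oplus>\<^bsub>S_term q p n\<^esub> [gwa_of F', gwa_of G', gwa_of H'] =
    [gwa_of (F + F'), gwa_of (G + G'), gwa_of (H + H')]"
  "[gwa_of F, gwa_of G, gwa_of H, gwa_of L] \<oplus>\<^bsub>S_term q p n\<^esub>
      [gwa_of F', gwa_of G', gwa_of H', gwa_of L'] =
    [gwa_of (F + F'), gwa_of (G + G'), gwa_of (H + H'), gwa_of (L + L')]"
  "c \<odot>\<^bsub>S_term q p n\<^esub> [gwa_of F] = [gwa_of (left_poly [:c:] F)]"
  "c \<odot>\<^bsub>S_term q p n\<^esub> [gwa_of F, gwa_of G, gwa_of H] =
    [gwa_of (left_poly [:c:] F), gwa_of (left_poly [:c:] G), gwa_of (left_poly [:c:] H)]"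
  "c \<odot>\<^bsub>S_term q p n\<^esub> [gwa_of F, gwa_of G, gwa_of H, gwa_of L] =
    [gwa_of (left_poly [:c:] F), gwa_of (left_poly [:c:] G), gwa_of (left_poly [:c:] H),
     gwa_of (left_poly [:c:] L)]"
  by (simp_all add: S_term_def add_power_space smult_power_space gwa_of_add gwa_of_scale)

lemma model_diff_add:
  "model_diff0 (F + F') = map2 (+) (model_diff0 F) (model_diff0 F')"
  "model_diff1 (F + F') (G + G') (H + H') = map2 (+) (model_diff1 F G H) (model_diff1 F' G' H')"
  "model_diff2 (F + F') (G + G') (H + H') (L + L') =
    map2 (+) (model_diff2 F G H L) (model_diff2 F' G' H' L')"
  "model_diff3 (F + F') (G + G') (H + H') (L + L') =
    map2 (+) (model_diff3 F G H L) (model_diff3 F' G' H' L')"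
  by (auto simp: model_diff0_def model_diff1_def model_diff2_def model_diff3_def
      intro!: poly_mapping_eqI simp: lookup_add lookup_minus smult_add_right algebra_simps)

lemma model_diff_scale:
  "model_diff0 (left_poly [:c:] F) = map (left_poly [:c:]) (model_diff0 F)"
  "model_diff1 (left_poly [:c:] F) (left_poly [:c:] G) (left_poly [:c:] H) =
    map (left_poly [:c:]) (model_diff1 F G H)"
  "model_diff2 (left_poly [:c:] F) (left_poly [:c:] G) (left_poly [:c:] H) (left_poly [:c:] L) =
    map (left_poly [:c:]) (model_diff2 F G H L)"
  "model_diff3 (left_poly [:c:] F) (left_poly [:c:] G) (left_poly [:c:] H) (left_poly [:c:] L) =
    map (left_poly [:c:]) (model_diff3 F G H L)"
  by (auto simp: model_diff0_def model_diff1_def model_diff2_def model_diff3_def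
      intro!: poly_mapping_eqI simp: lookup_add lookup_minus smult_add_right smult_diff_right
      mult.commute)

lemma length_model_diff [simp]:
  "length (model_diff0 F) = 3" "length (model_diff1 F G H) = 4"
  "length (model_diff2 F G H L) = 4" "length (model_diff3 F G H L) = 4"
  by (simp_all add: model_diff0_def model_diff1_def model_diff2_def model_diff3_def)

lemma S_diff_module_hom: "mod_hom class_ring (S_term q p n) (S_term q p (Suc n)) (S_diff q p n)"
proof -
  consider "n = 0" | "n = Suc 0" | "n \<ge> 2" "even n" | "n \<ge> 2" "odd n"
    by (cases n rule: S_matrix.cases) auto
  then have "S_diff q p n \<in> LinearCombinations.module_hom class_ring (S_term q p n) (S_term q p (Suc n))"
  proof cases
    case 1
    have "map gwa_of Fs \<in> carrier (S_term q p (Suc 0))" if "length Fs = 3" for Fs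
      using that by (auto simp: S_term_def range_map_gwa_of)
    then show ?thesis
      unfolding 1 LinearCombinations.module_hom_def
      by (auto simp: S_term_carrier(1) S_diff_0 S_term_add S_term_scale S_term_ops model_diff_add model_diff_scale
          simp del: map_map)
  next
    case 2
    have "map gwa_of Fs \<in> carrier (S_term q p (Suc (Suc 0)))" if "length Fs = 4" for Fs
      using that by (auto simp: S_term_def range_map_gwa_of)
    then show ?thesis
      unfolding 2 LinearCombinations.module_hom_def
      by (auto simp: S_term_carrier(2) S_diff_1 S_term_add S_term_scale S_term_ops model_diff_add model_diff_scale
          simp del: map_map)
  next
    case 3
    have "map gwa_of Fs \<in> carrier (S_term q p (Suc n))" if "length Fs = 4" for Fs
      using that 3 by (auto simp: S_term_def range_map_gwa_of)
    then show ?thesis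
      unfolding LinearCombinations.module_hom_def
      using 3
      by (auto simp: S_term_carrier(3) S_diff_even S_term_add S_term_scale S_term_ops model_diff_add model_diff_scale
          simp del: map_map)
  next
    case 4
    have "map gwa_of Fs \<in> carrier (S_term q p (Suc n))" if "length Fs = 4" for Fs
      using that 4 by (auto simp: S_term_def range_map_gwa_of)
    then show ?thesis
      unfolding LinearCombinations.module_hom_def
      using 4
      by (auto simp: S_term_carrier(3) S_diff_odd S_term_add S_term_scale S_term_ops model_diff_add model_diff_scale
          simp del: map_map)
  qed
  then show ?thesis
    by (simp add: mod_hom_def mod_hom_axioms_def S_term_module)
qed

lemma cocycles_submodule:
  "submodule class_ring (cocycles (S_term q p) (S_diff q p) n) (S_term q p n)"
proof -
  interpret mod_hom class_ring "S_term q p n" "S_term q p (Suc n)" "S_diff q p n"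
    by (rule S_diff_module_hom)
  show ?thesis
    using ker_is_submodule by (simp add: ker_def cocycles_def)
qed

lemma coboundaries_submodule:
  "submodule class_ring (coboundaries (S_term q p) (S_diff q p) n) (S_term q p n)"
proof (cases n)
  case 0
  then show ?thesis
    using submodule_zero[OF S_term_module[of 0]] by simp
next
  case (Suc k)
  interpret mod_hom class_ring "S_term q p k" "S_term q p (Suc k)" "S_diff q p k"
    by (rule S_diff_module_hom)
  show ?thesis
    using im_is_submodule by (simp add: im_def Suc)
qed

end

section \<open>Reduction to weight zero\<close>

context gwa_data
begin

abbreviation "complex_cocycles \<equiv> cocycles (S_term q p) (S_diff q p)"
abbreviation "complex_coboundaries \<equiv> coboundaries (S_term q p) (S_diff q p)"

lemma cocycles_iff:
  "v \<in> complex_cocycles 0 \<longleftrightarrow>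
    (\<exists>F. v = [gwa_of F] \<and> (\<forall>m. wt0 m (Poly_Mapping.lookup F m) = (0, 0, 0)))"
  "v \<in> complex_cocycles (Suc 0) \<longleftrightarrow>
    (\<exists>F G H. v = [gwa_of F, gwa_of G, gwa_of H] \<and>
      (\<forall>m. wt1 m (Poly_Mapping.lookup F (m + 1)) (Poly_Mapping.lookup G (m - 1))
        (Poly_Mapping.lookup H m) = (0, 0, 0, 0)))"
  "n \<ge> 2 \<Longrightarrow> even n \<Longrightarrow> v \<in> complex_cocycles n \<longleftrightarrow>
    (\<exists>F G H L. v = [gwa_of F, gwa_of G, gwa_of H, gwa_of L] \<and>
      (\<forall>m. wt2 m (Poly_Mapping.lookup F m) (Poly_Mapping.lookup G m)
        (Poly_Mapping.lookup H (m + 1)) (Poly_Mapping.lookup L (m - 1)) = (0, 0, 0, 0)))"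
  "n \<ge> 2 \<Longrightarrow> odd n \<Longrightarrow> v \<in> complex_cocycles n \<longleftrightarrow>
    (\<exists>F G H L. v = [gwa_of F, gwa_of G, gwa_of H, gwa_of L] \<and>
      (\<forall>m. wt3 m (Poly_Mapping.lookup F (m + 1)) (Poly_Mapping.lookup G (m - 1))
        (Poly_Mapping.lookup H m) (Poly_Mapping.lookup L m) = (0, 0, 0, 0)))"
proof -
  note simps = cocycles_def S_term_carrier S_term_zero(2,3) inj_map_gwa_of
  show "v \<in> complex_cocycles 0 \<longleftrightarrow>
      (\<exists>F. v = [gwa_of F] \<and> (\<forall>m. wt0 m (Poly_Mapping.lookup F m) = (0, 0, 0)))"
    using model_diff0_eq_iff[of _ 0 0 0] by (auto simp: simps S_diff_0 simp del: list.map)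
  show "v \<in> complex_cocycles (Suc 0) \<longleftrightarrow>
      (\<exists>F G H. v = [gwa_of F, gwa_of G, gwa_of H] \<and>
        (\<forall>m. wt1 m (Poly_Mapping.lookup F (m + 1)) (Poly_Mapping.lookup G (m - 1))
          (Poly_Mapping.lookup H m) = (0, 0, 0, 0)))"
    using model_diff1_eq_iff[of _ _ _ 0 0 0 0] by (auto simp: simps S_diff_1 simp del: list.map)
  show "v \<in> complex_cocycles n \<longleftrightarrow>
      (\<exists>F G H L. v = [gwa_of F, gwa_of G, gwa_of H, gwa_of L] \<and>
        (\<forall>m. wt2 m (Poly_Mapping.lookup F m) (Poly_Mapping.lookup G m)
          (Poly_Mapping.lookup H (m + 1)) (Poly_Mapping.lookup L (m - 1)) = (0, 0, 0, 0)))"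
    if "n \<ge> 2" "even n"
    using model_diff2_eq_iff[of _ _ _ _ 0 0 0 0] that
    by (auto simp: simps S_diff_even simp del: list.map)
  show "v \<in> complex_cocycles n \<longleftrightarrow>
      (\<exists>F G H L. v = [gwa_of F, gwa_of G, gwa_of H, gwa_of L] \<and>
        (\<forall>m. wt3 m (Poly_Mapping.lookup F (m + 1)) (Poly_Mapping.lookup G (m - 1))
          (Poly_Mapping.lookup H m) (Poly_Mapping.lookup L m) = (0, 0, 0, 0)))"
    if "n \<ge> 2" "odd n"
    using model_diff3_eq_iff[of _ _ _ _ 0 0 0 0] that
    by (auto simp: simps S_diff_odd simp del: list.map)
qed

lemma coboundaries_iff:
  "[gwa_of a, gwa_of b, gwa_of c] \<in> complex_coboundaries (Suc 0) \<longleftrightarrow>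
    (\<exists>F. \<forall>m. wt0 m (Poly_Mapping.lookup F m) =
      (Poly_Mapping.lookup a (m + 1), Poly_Mapping.lookup b (m - 1), Poly_Mapping.lookup c m))"
  "[gwa_of a, gwa_of b, gwa_of c, gwa_of d] \<in> complex_coboundaries (Suc (Suc 0)) \<longleftrightarrow>
    (\<exists>F G H. \<forall>m. wt1 m (Poly_Mapping.lookup F (m + 1)) (Poly_Mapping.lookup G (m - 1))
        (Poly_Mapping.lookup H m) =
      (Poly_Mapping.lookup a m, Poly_Mapping.lookup b m,
       Poly_Mapping.lookup c (m + 1), Poly_Mapping.lookup d (m - 1)))"
  "n \<ge> 2 \<Longrightarrow> even n \<Longrightarrow> [gwa_of a, gwa_of b, gwa_of c, gwa_of d] \<in> complex_coboundaries (Suc n) \<longleftrightarrow>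
    (\<exists>F G H L. \<forall>m. wt2 m (Poly_Mapping.lookup F m) (Poly_Mapping.lookup G m)
        (Poly_Mapping.lookup H (m + 1)) (Poly_Mapping.lookup L (m - 1)) =
      (Poly_Mapping.lookup a (m + 1), Poly_Mapping.lookup b (m - 1),
       Poly_Mapping.lookup c m, Poly_Mapping.lookup d m))"
  "n \<ge> 2 \<Longrightarrow> odd n \<Longrightarrow> [gwa_of a, gwa_of b, gwa_of c, gwa_of d] \<in> complex_coboundaries (Suc n) \<longleftrightarrow>
    (\<exists>F G H L. \<forall>m. wt3 m (Poly_Mapping.lookup F (m + 1)) (Poly_Mapping.lookup G (m - 1))
        (Poly_Mapping.lookup H m) (Poly_Mapping.lookup L m) =
      (Poly_Mapping.lookup a m, Poly_Mapping.lookup b m,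
       Poly_Mapping.lookup c (m + 1), Poly_Mapping.lookup d (m - 1)))"
proof -
  note simps = coboundaries.simps image_iff Bex_def S_term_carrier
  have l3: "[gwa_of a, gwa_of b, gwa_of c] = map gwa_of Fs \<longleftrightarrow> Fs = [a, b, c]"
    and l4: "[gwa_of a, gwa_of b, gwa_of c, gwa_of d] = map gwa_of Fs \<longleftrightarrow> Fs = [a, b, c, d]"
    for Fs
    using inj_map_gwa_of[of "[a, b, c]" Fs] inj_map_gwa_of[of "[a, b, c, d]" Fs] by auto
  have "[gwa_of a, gwa_of b, gwa_of c] \<in> complex_coboundaries (Suc 0) \<longleftrightarrow>
      (\<exists>F. model_diff0 F = [a, b, c])"
    by (auto simp: simps S_diff_0 l3)
  then show "[gwa_of a, gwa_of b, gwa_of c] \<in> complex_coboundaries (Suc 0) \<longleftrightarrow>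
    (\<exists>F. \<forall>m. wt0 m (Poly_Mapping.lookup F m) =
      (Poly_Mapping.lookup a (m + 1), Poly_Mapping.lookup b (m - 1), Poly_Mapping.lookup c m))"
    unfolding model_diff0_eq_iff .
  have "[gwa_of a, gwa_of b, gwa_of c, gwa_of d] \<in> complex_coboundaries (Suc (Suc 0)) \<longleftrightarrow>
      (\<exists>F G H. model_diff1 F G H = [a, b, c, d])"
    using l4 by (force simp: simps S_diff_1)
  then show "[gwa_of a, gwa_of b, gwa_of c, gwa_of d] \<in> complex_coboundaries (Suc (Suc 0)) \<longleftrightarrow>
    (\<exists>F G H. \<forall>m. wt1 m (Poly_Mapping.lookup F (m + 1)) (Poly_Mapping.lookup G (m - 1))
        (Poly_Mapping.lookup H m) =
      (Poly_Mapping.lookup a m, Poly_Mapping.lookup b m,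
       Poly_Mapping.lookup c (m + 1), Poly_Mapping.lookup d (m - 1)))"
    unfolding model_diff1_eq_iff .
  have "[gwa_of a, gwa_of b, gwa_of c, gwa_of d] \<in> complex_coboundaries (Suc n) \<longleftrightarrow>
      (\<exists>F G H L. model_diff2 F G H L = [a, b, c, d])" if "n \<ge> 2" "even n"
    using l4 that by (force simp: simps S_diff_even)
  then show "n \<ge> 2 \<Longrightarrow> even n \<Longrightarrow>
    [gwa_of a, gwa_of b, gwa_of c, gwa_of d] \<in> complex_coboundaries (Suc n) \<longleftrightarrow>
    (\<exists>F G H L. \<forall>m. wt2 m (Poly_Mapping.lookup F m) (Poly_Mapping.lookup G m)
        (Poly_Mapping.lookup H (m + 1)) (Poly_Mapping.lookup L (m - 1)) =
      (Poly_Mapping.lookup a (m + 1), Poly_Mapping.lookup b (m - 1),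
       Poly_Mapping.lookup c m, Poly_Mapping.lookup d m))"
    unfolding model_diff2_eq_iff .
  have "[gwa_of a, gwa_of b, gwa_of c, gwa_of d] \<in> complex_coboundaries (Suc n) \<longleftrightarrow>
      (\<exists>F G H L. model_diff3 F G H L = [a, b, c, d])" if "n \<ge> 2" "odd n"
    using l4 that by (force simp: simps S_diff_odd)
  then show "n \<ge> 2 \<Longrightarrow> odd n \<Longrightarrow>
    [gwa_of a, gwa_of b, gwa_of c, gwa_of d] \<in> complex_coboundaries (Suc n) \<longleftrightarrow>
    (\<exists>F G H L. \<forall>m. wt3 m (Poly_Mapping.lookup F (m + 1)) (Poly_Mapping.lookup G (m - 1))
        (Poly_Mapping.lookup H m) (Poly_Mapping.lookup L m) =
      (Poly_Mapping.lookup a m, Poly_Mapping.lookup b m,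
       Poly_Mapping.lookup c (m + 1), Poly_Mapping.lookup d (m - 1)))"
    unfolding model_diff3_eq_iff .
qed

lemma wt_zero:
  "wt0 m 0 = (0, 0, 0)" "wt1 m 0 0 0 = (0, 0, 0, 0)"
  "wt2 m 0 0 0 0 = (0, 0, 0, 0)" "wt3 m 0 0 0 0 = (0, 0, 0, 0)"
  by (simp_all add: wt0_def wt1_def wt2_def wt3_def)

lemma finite_support4:
  fixes F G H L :: "'k graded" and i j k l :: int
  assumes "\<And>m. Poly_Mapping.lookup F (m + i) = 0 \<Longrightarrow> Poly_Mapping.lookup G (m + j) = 0 \<Longrightarrow>
    Poly_Mapping.lookup H (m + k) = 0 \<Longrightarrow> Poly_Mapping.lookup L (m + l) = 0 \<Longrightarrow> m \<noteq> 0 \<Longrightarrow> P m"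
  shows "finite {m. \<not> P m}"
proof -
  have "{m. \<not> P m} \<subseteq> {0} \<union> {m. Poly_Mapping.lookup F (m + i) \<noteq> 0} \<union>
      {m. Poly_Mapping.lookup G (m + j) \<noteq> 0} \<union> {m. Poly_Mapping.lookup H (m + k) \<noteq> 0} \<union>
      {m. Poly_Mapping.lookup L (m + l) \<noteq> 0}"
    using assms by blast
  then show ?thesis
    by (rule finite_subset) (auto simp: finite_lookup_shift)
qed

lemma homogeneous_finsum:
  assumes "finite I"
  shows "(\<Oplus>\<^bsub>S_term q p (Suc 0)\<^esub>i\<in>I. c i \<odot>\<^bsub>S_term q p (Suc 0)\<^esub>
      [gwa_of (Poly_Mapping.single 1 (f i)), gwa_of (Poly_Mapping.single (-1) (g i)),
       gwa_of (Poly_Mapping.single 0 (h i))]) =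
      [gwa_of (Poly_Mapping.single 1 (\<Sum>i\<in>I. Polynomial.smult (c i) (f i))),
       gwa_of (Poly_Mapping.single (-1) (\<Sum>i\<in>I. Polynomial.smult (c i) (g i))),
       gwa_of (Poly_Mapping.single 0 (\<Sum>i\<in>I. Polynomial.smult (c i) (h i)))]" (is ?deg1)
    and "(\<Oplus>\<^bsub>S_term q p (Suc (Suc 0))\<^esub>i\<in>I. c i \<odot>\<^bsub>S_term q p (Suc (Suc 0))\<^esub>
      [gwa_of (Poly_Mapping.single 0 (f i)), gwa_of (Poly_Mapping.single 0 (g i)),
       gwa_of (Poly_Mapping.single 1 (h i)), gwa_of (Poly_Mapping.single (-1) (l i))]) =
      [gwa_of (Poly_Mapping.single 0 (\<Sum>i\<in>I. Polynomial.smult (c i) (f i))),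
       gwa_of (Poly_Mapping.single 0 (\<Sum>i\<in>I. Polynomial.smult (c i) (g i))),
       gwa_of (Poly_Mapping.single 1 (\<Sum>i\<in>I. Polynomial.smult (c i) (h i))),
       gwa_of (Poly_Mapping.single (-1) (\<Sum>i\<in>I. Polynomial.smult (c i) (l i)))]" (is ?deg2)
proof -
  interpret V1: Module.module class_ring "S_term q p (Suc 0)"
    by (rule S_term_module)
  interpret V2: Module.module class_ring "S_term q p (Suc (Suc 0))"
    by (rule S_term_module)
  have term1: "c i \<odot>\<^bsub>S_term q p (Suc 0)\<^esub>
      [gwa_of (Poly_Mapping.single 1 (f i)), gwa_of (Poly_Mapping.single (-1) (g i)),
       gwa_of (Poly_Mapping.single 0 (h i))] =
      [gwa_of (Poly_Mapping.single 1 (Polynomial.smult (c i) (f i))),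
       gwa_of (Poly_Mapping.single (-1) (Polynomial.smult (c i) (g i))),
       gwa_of (Poly_Mapping.single 0 (Polynomial.smult (c i) (h i)))]" (is "_ = ?t1 i") for i
    by (simp add: S_term_ops gen_act_single)
  have mem1: "?t1 i \<in> carrier (S_term q p (Suc 0))" for i
    unfolding S_term_carrier by blast
  show ?deg1
    unfolding term1 using assms
  proof (induction I)
    case empty
    show ?case
      by (simp add: S_term_zero)
  next
    case (insert i I)
    have "?t1 \<in> I \<rightarrow> carrier (S_term q p (Suc 0))"
      using mem1 by blast
    from V1.M.finsum_insert[OF insert.hyps this mem1] show ?case
      using insert by (simp add: S_term_ops single_add)
  qed
  have term2: "c i \<odot>\<^bsub>S_term q p (Suc (Suc 0))\<^esub>
      [gwa_of (Poly_Mapping.single 0 (f i)), gwa_of (Poly_Mapping.single 0 (g i)),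
       gwa_of (Poly_Mapping.single 1 (h i)), gwa_of (Poly_Mapping.single (-1) (l i))] =
      [gwa_of (Poly_Mapping.single 0 (Polynomial.smult (c i) (f i))),
       gwa_of (Poly_Mapping.single 0 (Polynomial.smult (c i) (g i))),
       gwa_of (Poly_Mapping.single 1 (Polynomial.smult (c i) (h i))),
       gwa_of (Poly_Mapping.single (-1) (Polynomial.smult (c i) (l i)))]" (is "_ = ?t2 i") for i
    by (simp add: S_term_ops gen_act_single)
  have two: "2 \<le> Suc (Suc 0)"
    by simp
  have mem2: "?t2 i \<in> carrier (S_term q p (Suc (Suc 0)))" for i
    unfolding S_term_carrier(3)[OF two] by (intro exI) (rule refl)
  show ?deg2
    unfolding term2 using assms
  proof (induction I)
    case empty
    show ?case
      by (simp add: S_term_zero)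
  next
    case (insert i I)
    have "?t2 \<in> I \<rightarrow> carrier (S_term q p (Suc (Suc 0)))"
      using mem2 by blast
    from V2.M.finsum_insert[OF insert.hyps this mem2] show ?case
      using insert by (simp add: S_term_ops single_add)
  qed
qed

lemma lookup_single_shift:
  "Poly_Mapping.lookup (Poly_Mapping.single k f) (m + k) = (if m = 0 then f else 0)" for k m :: int
  by (simp add: lookup_single when_def)

lemma coboundary_is_cocycle:
  "complex_coboundaries (Suc 0) \<subseteq> complex_cocycles (Suc 0)"
  "complex_coboundaries (Suc (Suc 0)) \<subseteq> complex_cocycles (Suc (Suc 0))"
proof -
  have sub: "complex_coboundaries n \<subseteq> carrier (S_term q p n)" for n
    using coboundaries_submodule[of n] by (simp add: submodule_def)
  show "complex_coboundaries (Suc 0) \<subseteq> complex_cocycles (Suc 0)"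
  proof
    fix v assume v: "v \<in> complex_coboundaries (Suc 0)"
    then obtain a b c where abc: "v = [gwa_of a, gwa_of b, gwa_of c]"
      using sub S_term_carrier(2) by blast
    then show "v \<in> complex_cocycles (Suc 0)"
      using v wt_complex(1) unfolding abc coboundaries_iff(1) cocycles_iff(2) by blast
  qed
  show "complex_coboundaries (Suc (Suc 0)) \<subseteq> complex_cocycles (Suc (Suc 0))"
  proof
    fix v assume v: "v \<in> complex_coboundaries (Suc (Suc 0))"
    have two: "Suc (Suc 0) \<ge> 2" "even (Suc (Suc 0))"
      by auto
    have "v \<in> carrier (S_term q p (Suc (Suc 0)))"
      using v sub by blast
    then obtain a b c d where abcd: "v = [gwa_of a, gwa_of b, gwa_of c, gwa_of d]"
      unfolding S_term_carrier(3)[OF two(1)] by blast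
    show "v \<in> complex_cocycles (Suc (Suc 0))"
      using v wt_complex(2) unfolding abcd coboundaries_iff(2) cocycles_iff(3)[OF two] by blast
  qed
qed

end

context gwa_generic
begin

text \<open>From degree 3 on the incoming differential has four arguments, so
  \<open>wt3_exact\<close> and \<open>wt2_exact\<close> supply preimages in every weight, including
  0.\<close>

lemma cocycles_eq_coboundaries:
  assumes "n \<ge> 3"
  shows "complex_cocycles n \<subseteq> complex_coboundaries n"
proof
  fix v assume v: "v \<in> complex_cocycles n"
  obtain k where n: "n = Suc k" "k \<ge> 2"
    using assms by (cases n) auto
  show "v \<in> complex_coboundaries n"
  proof (cases "even k")
    case True
    then obtain f g h l where fghl: "v = [gwa_of f, gwa_of g, gwa_of h, gwa_of l]"
      and c: "\<And>m. wt3 m (Poly_Mapping.lookup f (m + 1)) (Poly_Mapping.lookup g (m - 1))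
        (Poly_Mapping.lookup h m) (Poly_Mapping.lookup l m) = (0, 0, 0, 0)"
      using v n cocycles_iff(4)[of n v] by auto
    define P where "P m a b c d \<longleftrightarrow> wt2 m a b c d =
      (Poly_Mapping.lookup f (m + 1), Poly_Mapping.lookup g (m - 1),
       Poly_Mapping.lookup h m, Poly_Mapping.lookup l m)" for m a b c d
    have "\<exists>a b c d. P m a b c d" for m
      unfolding P_def by (rule wt3_exact[OF c])
    moreover have "finite {m. \<not> P m 0 0 0 0}"
      by (rule finite_support4[of f 1 g "-1" h 0 l 0]) (simp add: P_def wt_zero)
    ultimately obtain F G H L where "\<And>m. P m (Poly_Mapping.lookup F (m + 0)) (Poly_Mapping.lookup G (m + 0))
        (Poly_Mapping.lookup H (m + 1)) (Poly_Mapping.lookup L (m + -1))"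
      by (rule graded_choice[where i = 0 and j = 0 and k = 1 and l = "-1"]) (rule that)
    then show ?thesis
      unfolding fghl n(1) coboundaries_iff(3)[OF n(2) True] by (auto simp: P_def)
  next
    case False
    then obtain f g h l where fghl: "v = [gwa_of f, gwa_of g, gwa_of h, gwa_of l]"
      and c: "\<And>m. wt2 m (Poly_Mapping.lookup f m) (Poly_Mapping.lookup g m)
        (Poly_Mapping.lookup h (m + 1)) (Poly_Mapping.lookup l (m - 1)) = (0, 0, 0, 0)"
      using v n cocycles_iff(3)[of n v] by auto
    define P where "P m a b c d \<longleftrightarrow> wt3 m a b c d =
      (Poly_Mapping.lookup f m, Poly_Mapping.lookup g m,
       Poly_Mapping.lookup h (m + 1), Poly_Mapping.lookup l (m - 1))" for m a b c d
    have "\<exists>a b c d. P m a b c d" for m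
      unfolding P_def by (rule wt2_exact[OF c])
    moreover have "finite {m. \<not> P m 0 0 0 0}"
      by (rule finite_support4[of f 0 g 0 h 1 l "-1"]) (simp add: P_def wt_zero)
    ultimately obtain F G H L where "\<And>m. P m (Poly_Mapping.lookup F (m + 1)) (Poly_Mapping.lookup G (m + -1))
        (Poly_Mapping.lookup H (m + 0)) (Poly_Mapping.lookup L (m + 0))"
      by (rule graded_choice[where i = 1 and j = "-1" and k = 0 and l = 0]) (rule that)
    then show ?thesis
      unfolding fghl n(1) coboundaries_iff(4)[OF n(2) False] by (auto simp: P_def)
  qed
qed

lemma cohomology_trivial:
  assumes "n \<ge> 3"
  shows "carrier (cohomology (S_term q p) (S_diff q p) n) =
    {\<zero>\<^bsub>cohomology (S_term q p) (S_diff q p) n\<^esub>}"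
  using cohomology_trivialI[OF coboundaries_submodule cocycles_eq_coboundaries[OF assms]]
    cocycles_submodule[of n] by (simp add: submodule_def)

text \<open>By \<open>wt1_exact\<close> the nonzero weights contribute nothing, so a basis of the
  weight 0 part is a basis of the whole cohomology. Weight 0 means that the entries are multiples of
  x, y and 1.\<close>

lemma represents_basis_deg1:
  fixes wf wg wh :: "nat \<Rightarrow> 'k poly"
  assumes fin: "finite I"
    and cocycle: "\<And>i. i \<in> I \<Longrightarrow> wt1 0 (wf i) (wg i) (wh i) = (0, 0, 0, 0)"
    and span: "\<And>f g h. wt1 0 f g h = (0, 0, 0, 0) \<Longrightarrow> \<exists>c e. wt0 0 e =
      (f - (\<Sum>i\<in>I. Polynomial.smult (c i) (wf i)), g - (\<Sum>i\<in>I. Polynomial.smult (c i) (wg i)),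
       h - (\<Sum>i\<in>I. Polynomial.smult (c i) (wh i)))"
    and indep: "\<And>c e i. wt0 0 e =
      (\<Sum>i\<in>I. Polynomial.smult (c i) (wf i), \<Sum>i\<in>I. Polynomial.smult (c i) (wg i),
       \<Sum>i\<in>I. Polynomial.smult (c i) (wh i)) \<Longrightarrow> i \<in> I \<Longrightarrow> c i = 0"
  shows "represents_basis (S_term q p) (S_diff q p) (Suc 0)
    ((\<lambda>i. [gwa_of (Poly_Mapping.single 1 (wf i)), gwa_of (Poly_Mapping.single (-1) (wg i)),
       gwa_of (Poly_Mapping.single 0 (wh i))]) ` I)"
proof (rule represents_basisI[OF cocycles_submodule coboundaries_submodule coboundary_is_cocycle(1) fin])
  have shift: "Poly_Mapping.lookup (Poly_Mapping.single (-1) f) (m - 1) = (if m = 0 then f else 0)"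
    "Poly_Mapping.lookup (Poly_Mapping.single 0 f) m = (if m = 0 then f else 0)"
    for f :: "'k poly" and m :: int
    using lookup_single_shift[of "-1" f m] lookup_single_shift[of 0 f m] by simp_all
  note shift = shift lookup_single_shift[of 1]
  show "[gwa_of (Poly_Mapping.single 1 (wf i)), gwa_of (Poly_Mapping.single (-1) (wg i)),
       gwa_of (Poly_Mapping.single 0 (wh i))] \<in> complex_cocycles (Suc 0)" if "i \<in> I" for i
    unfolding cocycles_iff(2) using cocycle[OF that] wt_zero
    by (intro exI conjI refl) (auto simp: shift)
  show "\<exists>b\<in>complex_coboundaries (Suc 0). \<exists>c. v = b \<oplus>\<^bsub>S_term q p (Suc 0)\<^esub>
      (\<Oplus>\<^bsub>S_term q p (Suc 0)\<^esub>i\<in>I. c i \<odot>\<^bsub>S_term q p (Suc 0)\<^esub>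
        [gwa_of (Poly_Mapping.single 1 (wf i)), gwa_of (Poly_Mapping.single (-1) (wg i)),
         gwa_of (Poly_Mapping.single 0 (wh i))])"
    if cv: "v \<in> complex_cocycles (Suc 0)" for v
  proof -
    obtain f g h where fgh: "v = [gwa_of f, gwa_of g, gwa_of h]"
      and v: "\<And>m. wt1 m (Poly_Mapping.lookup f (m + 1)) (Poly_Mapping.lookup g (m - 1))
          (Poly_Mapping.lookup h m) = (0, 0, 0, 0)"
      using cv unfolding cocycles_iff(2) by blast
    obtain c e where ce: "wt0 0 e =
      (Poly_Mapping.lookup f 1 - (\<Sum>i\<in>I. Polynomial.smult (c i) (wf i)),
       Poly_Mapping.lookup g (-1) - (\<Sum>i\<in>I. Polynomial.smult (c i) (wg i)),
       Poly_Mapping.lookup h 0 - (\<Sum>i\<in>I. Polynomial.smult (c i) (wh i)))"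
      using span[OF v[of 0, simplified]] by blast
    \<comment> \<open>Subtracting the combination of representatives changes only the part of weight
      0.\<close>
    define f' where "f' = f - Poly_Mapping.single 1 (\<Sum>i\<in>I. Polynomial.smult (c i) (wf i))"
    define g' where "g' = g - Poly_Mapping.single (-1) (\<Sum>i\<in>I. Polynomial.smult (c i) (wg i))"
    define h' where "h' = h - Poly_Mapping.single 0 (\<Sum>i\<in>I. Polynomial.smult (c i) (wh i))"
    define P where "P m a \<longleftrightarrow> wt0 m a =
      (Poly_Mapping.lookup f' (m + 1), Poly_Mapping.lookup g' (m - 1), Poly_Mapping.lookup h' m)"
      for m a
    have "\<exists>a. P m a" for m
    proof (cases "m = 0")
      case True
      then show ?thesis
        using ce by (auto simp: P_def f'_def g'_def h'_def lookup_minus)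
    next
      case False
      then show ?thesis
        using wt1_exact[OF False v[of m]]
        by (auto simp: P_def f'_def g'_def h'_def lookup_minus shift)
    qed
    moreover have "finite {m. \<not> P m 0}"
      by (rule finite_support4[of f' 1 g' "-1" h' 0 0 0]) (simp add: P_def wt_zero)
    ultimately obtain F G H L :: "'k graded" where "\<And>m. P m (Poly_Mapping.lookup F (m + 0))"
      using graded_choice[where P = "\<lambda>m a b c d. P m a" and i = 0] by meson
    then have b: "[gwa_of f', gwa_of g', gwa_of h'] \<in> complex_coboundaries (Suc 0)"
      unfolding coboundaries_iff by (auto simp: P_def)
    show ?thesis
      by (rule bexI[OF _ b], rule exI[of _ c], unfold homogeneous_finsum[OF fin])
        (simp add: S_term_ops fgh f'_def g'_def h'_def)
  qed
  show "c i = 0" if B: "(\<Oplus>\<^bsub>S_term q p (Suc 0)\<^esub>i\<in>I. c i \<odot>\<^bsub>S_term q p (Suc 0)\<^esub>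
        [gwa_of (Poly_Mapping.single 1 (wf i)), gwa_of (Poly_Mapping.single (-1) (wg i)),
         gwa_of (Poly_Mapping.single 0 (wh i))]) \<in> complex_coboundaries (Suc 0)"
      and i: "i \<in> I" for c i
  proof -
    obtain F where F: "\<And>m. wt0 m (Poly_Mapping.lookup F m) =
      (Poly_Mapping.lookup (Poly_Mapping.single 1 (\<Sum>i\<in>I. Polynomial.smult (c i) (wf i))) (m + 1),
       Poly_Mapping.lookup (Poly_Mapping.single (-1) (\<Sum>i\<in>I. Polynomial.smult (c i) (wg i))) (m - 1),
       Poly_Mapping.lookup (Poly_Mapping.single 0 (\<Sum>i\<in>I. Polynomial.smult (c i) (wh i))) m)"
      using B unfolding homogeneous_finsum[OF fin] coboundaries_iff by blast
    show ?thesis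
      by (rule indep[OF _ i]) (use F[of 0] in simp)
  qed
qed

text \<open>This is the same reduction to weight 0, now by \<open>wt2_exact'\<close>; the entries of
  weight 0 are multiples of 1, 1, x and y.\<close>

lemma represents_basis_deg2:
  fixes wf wg wh wl :: "nat \<Rightarrow> 'k poly"
  assumes fin: "finite I"
    and cocycle: "\<And>i. i \<in> I \<Longrightarrow> wt2 0 (wf i) (wg i) (wh i) (wl i) = (0, 0, 0, 0)"
    and span: "\<And>f g h l. wt2 0 f g h l = (0, 0, 0, 0) \<Longrightarrow> \<exists>c F G H. wt1 0 F G H =
      (f - (\<Sum>i\<in>I. Polynomial.smult (c i) (wf i)), g - (\<Sum>i\<in>I. Polynomial.smult (c i) (wg i)),
       h - (\<Sum>i\<in>I. Polynomial.smult (c i) (wh i)), l - (\<Sum>i\<in>I. Polynomial.smult (c i) (wl i)))"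
    and indep: "\<And>c F G H i. wt1 0 F G H =
      (\<Sum>i\<in>I. Polynomial.smult (c i) (wf i), \<Sum>i\<in>I. Polynomial.smult (c i) (wg i),
       \<Sum>i\<in>I. Polynomial.smult (c i) (wh i), \<Sum>i\<in>I. Polynomial.smult (c i) (wl i)) \<Longrightarrow>
      i \<in> I \<Longrightarrow> c i = 0"
  shows "represents_basis (S_term q p) (S_diff q p) (Suc (Suc 0))
    ((\<lambda>i. [gwa_of (Poly_Mapping.single 0 (wf i)), gwa_of (Poly_Mapping.single 0 (wg i)),
       gwa_of (Poly_Mapping.single 1 (wh i)), gwa_of (Poly_Mapping.single (-1) (wl i))]) ` I)"
proof (rule represents_basisI[OF cocycles_submodule coboundaries_submodule coboundary_is_cocycle(2) fin])
  have shift: "Poly_Mapping.lookup (Poly_Mapping.single (-1) f) (m - 1) = (if m = 0 then f else 0)"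
    "Poly_Mapping.lookup (Poly_Mapping.single 0 f) m = (if m = 0 then f else 0)"
    for f :: "'k poly" and m :: int
    using lookup_single_shift[of "-1" f m] lookup_single_shift[of 0 f m] by simp_all
  note shift = shift lookup_single_shift[of 1]
  have two: "Suc (Suc 0) \<ge> 2" "even (Suc (Suc 0))"
    by auto
  show "[gwa_of (Poly_Mapping.single 0 (wf i)), gwa_of (Poly_Mapping.single 0 (wg i)),
       gwa_of (Poly_Mapping.single 1 (wh i)), gwa_of (Poly_Mapping.single (-1) (wl i))]
      \<in> complex_cocycles (Suc (Suc 0))" if "i \<in> I" for i
    unfolding cocycles_iff(3)[OF two] using cocycle[OF that] wt_zero
    by (intro exI conjI refl) (auto simp: shift)
  show "\<exists>b\<in>complex_coboundaries (Suc (Suc 0)). \<exists>c. v = b \<oplus>\<^bsub>S_term q p (Suc (Suc 0))\<^esub>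
      (\<Oplus>\<^bsub>S_term q p (Suc (Suc 0))\<^esub>i\<in>I. c i \<odot>\<^bsub>S_term q p (Suc (Suc 0))\<^esub>
        [gwa_of (Poly_Mapping.single 0 (wf i)), gwa_of (Poly_Mapping.single 0 (wg i)),
         gwa_of (Poly_Mapping.single 1 (wh i)), gwa_of (Poly_Mapping.single (-1) (wl i))])"
    if cv: "v \<in> complex_cocycles (Suc (Suc 0))" for v
  proof -
    obtain f g h l where fghl: "v = [gwa_of f, gwa_of g, gwa_of h, gwa_of l]"
      and v: "\<And>m. wt2 m (Poly_Mapping.lookup f m) (Poly_Mapping.lookup g m)
          (Poly_Mapping.lookup h (m + 1)) (Poly_Mapping.lookup l (m - 1)) = (0, 0, 0, 0)"
      using cv unfolding cocycles_iff(3)[OF two] by blast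
    obtain c F0 G0 H0 where ce: "wt1 0 F0 G0 H0 =
      (Poly_Mapping.lookup f 0 - (\<Sum>i\<in>I. Polynomial.smult (c i) (wf i)),
       Poly_Mapping.lookup g 0 - (\<Sum>i\<in>I. Polynomial.smult (c i) (wg i)),
       Poly_Mapping.lookup h 1 - (\<Sum>i\<in>I. Polynomial.smult (c i) (wh i)),
       Poly_Mapping.lookup l (-1) - (\<Sum>i\<in>I. Polynomial.smult (c i) (wl i)))"
      using span[OF v[of 0, simplified]] by blast
    define f' where "f' = f - Poly_Mapping.single 0 (\<Sum>i\<in>I. Polynomial.smult (c i) (wf i))"
    define g' where "g' = g - Poly_Mapping.single 0 (\<Sum>i\<in>I. Polynomial.smult (c i) (wg i))"
    define h' where "h' = h - Poly_Mapping.single 1 (\<Sum>i\<in>I. Polynomial.smult (c i) (wh i))"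
    define l' where "l' = l - Poly_Mapping.single (-1) (\<Sum>i\<in>I. Polynomial.smult (c i) (wl i))"
    define P where "P m a b c \<longleftrightarrow> wt1 m a b c =
      (Poly_Mapping.lookup f' m, Poly_Mapping.lookup g' m, Poly_Mapping.lookup h' (m + 1),
       Poly_Mapping.lookup l' (m - 1))"
      for m a b c
    have "\<exists>a b c. P m a b c" for m
    proof (cases "m = 0")
      case True
      then show ?thesis
        using ce by (auto simp: P_def f'_def g'_def h'_def l'_def lookup_minus)
    next
      case False
      then show ?thesis
        using wt2_exact'[OF False v[of m]]
        by (auto simp: P_def f'_def g'_def h'_def l'_def lookup_minus shift)
    qed
    moreover have "finite {m. \<not> P m 0 0 0}"
      by (rule finite_support4[of f' 0 g' 0 h' 1 l' "-1"]) (simp add: P_def wt_zero)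
    ultimately obtain F G H L :: "'k graded" where "\<And>m. P m (Poly_Mapping.lookup F (m + 1))
        (Poly_Mapping.lookup G (m + -1)) (Poly_Mapping.lookup H (m + 0))"
      using graded_choice[where P = "\<lambda>m a b c d. P m a b c" and i = 1 and j = "-1" and k = 0]
      by meson
    then have b: "[gwa_of f', gwa_of g', gwa_of h', gwa_of l'] \<in> complex_coboundaries (Suc (Suc 0))"
      unfolding coboundaries_iff by (auto simp: P_def)
    show ?thesis
      by (rule bexI[OF _ b], rule exI[of _ c], unfold homogeneous_finsum[OF fin])
        (simp add: S_term_ops fghl f'_def g'_def h'_def l'_def)
  qed
  show "c i = 0" if B: "(\<Oplus>\<^bsub>S_term q p (Suc (Suc 0))\<^esub>i\<in>I. c i \<odot>\<^bsub>S_term q p (Suc (Suc 0))\<^esub>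
        [gwa_of (Poly_Mapping.single 0 (wf i)), gwa_of (Poly_Mapping.single 0 (wg i)),
         gwa_of (Poly_Mapping.single 1 (wh i)), gwa_of (Poly_Mapping.single (-1) (wl i))])
      \<in> complex_coboundaries (Suc (Suc 0))"
      and i: "i \<in> I" for c i
  proof -
    obtain F G H where F: "\<And>m. wt1 m (Poly_Mapping.lookup F (m + 1)) (Poly_Mapping.lookup G (m - 1))
        (Poly_Mapping.lookup H m) =
      (Poly_Mapping.lookup (Poly_Mapping.single 0 (\<Sum>i\<in>I. Polynomial.smult (c i) (wf i))) m,
       Poly_Mapping.lookup (Poly_Mapping.single 0 (\<Sum>i\<in>I. Polynomial.smult (c i) (wg i))) m,
       Poly_Mapping.lookup (Poly_Mapping.single 1 (\<Sum>i\<in>I. Polynomial.smult (c i) (wh i))) (m + 1),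
       Poly_Mapping.lookup (Poly_Mapping.single (-1) (\<Sum>i\<in>I. Polynomial.smult (c i) (wl i))) (m - 1))"
      using B unfolding homogeneous_finsum[OF fin] coboundaries_iff by blast
    show ?thesis
      by (rule indep[OF _ i]) (use F[of 0] in simp)
  qed
qed

end

section \<open>Weight zero\<close>

text \<open>Operators that act diagonally on coefficients are inverted with this below.\<close>

lemma coeff_scaling_exists: "\<exists>e. \<forall>i. coeff e i = a i * coeff (f :: 'a::comm_semiring_0 poly) i"
proof -
  have "coeff (\<Sum>i\<le>degree f. monom (a i * coeff f i) i) j = a j * coeff f j" for j
    by (auto simp: coeff_sum coeff_eq_0 not_le)
  then show ?thesis
    by blast
qed

lemma coeff_sum_powers:
  assumes "finite J"
  shows "coeff (\<Sum>i\<in>J. Polynomial.smult (k i) ([:0, 1:] ^ i)) j =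
    (if j \<in> J then k j else (0 :: 'a::comm_ring_1))"
proof -
  have "[:0, 1:] ^ i = monom (1 :: 'a) i" for i
    by (simp add: monom_altdef)
  then show ?thesis
    using assms by (simp add: coeff_sum if_distrib[of "(*) _"] cong: if_cong)
qed

context gwa_data
begin

lemma wt_0:
  "wt0 0 e = (tw 1 e - e, tw (-1) e - e, 0)"
  "wt1 0 f g h =
    (p * (tw (-1) f + g) - pderiv p * h, f * tw 1 p + tw 1 (g * p) - q_const * tw 1 (pderiv p) * h,
     q_const * h - tw 1 h, h - q_const * tw (-1) h)"
  "wt2 0 f g h l =
    (tw 1 f - g - tw 1 (pderiv p) * h, tw (-1) g - f - pderiv p * l,
     - (p * (tw (-1) h + l)), - (h * tw 1 p) - tw 1 (l * p))"
  by (simp_all add: wt0_def wt1_def wt2_def x_coeff_def y_coeff_def delta_0 algebra_simps)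

lemma coeff_tw_1: "coeff (tw 1 f) i = q ^ i * coeff f i"
  by (simp add: tw_def)

lemma coeff_q_const: "coeff (q_const * f) i = q * coeff f i"
  by (simp add: q_const_def)

end

context gwa_generic
begin

lemma tw_fixed: "tw 1 f = f \<Longrightarrow> f = [:coeff f 0:]"
proof (rule poly_eqI)
  fix i assume "tw 1 f = f"
  then have "q ^ i * coeff f i = coeff f i"
    by (metis coeff_tw_1)
  then show "coeff f i = coeff [:coeff f 0:] i"
    using q_power_eq_iff[of i 0] by (cases i) auto
qed

text \<open>The map \<sigma> - id multiplies the coefficient of z^i by q^i - 1, which vanishes only
  for i = 0.\<close>

lemma tw_minus_id_onto:
  obtains e where "f = tw 1 e - e + [:coeff f 0:]"
proof -
  obtain e where e: "\<And>i. coeff e i = (if i = 0 then 0 else 1 / (q ^ i - 1)) * coeff f i"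
    using coeff_scaling_exists[of "\<lambda>i. if i = 0 then 0 else 1 / (q ^ i - 1)" f] by blast
  have "f = tw 1 e - e + [:coeff f 0:]"
  proof (rule poly_eqI)
    fix i
    show "coeff f i = coeff (tw 1 e - e + [:coeff f 0:]) i"
    proof (cases i)
      case (Suc j)
      have "q ^ i - 1 \<noteq> 0"
        using q_power_eq_iff[of i 0] Suc by simp
      then have "(q ^ i - 1) * coeff e i = coeff f i"
        using Suc by (simp add: e)
      then show ?thesis
        by (simp add: Suc coeff_tw_1 left_diff_distrib)
    qed (simp add: coeff_tw_1)
  qed
  then show thesis
    by (rule that)
qed

text \<open>The map q - \<sigma> multiplies the coefficient of z^i by q - q^i, which vanishes only
  for i = 1.\<close>

lemma q_minus_tw_onto:
  obtains e where "f = q_const * e - tw 1 e + [:0, coeff f 1:]"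
proof -
  obtain e where e: "\<And>i. coeff e i = (if i = 1 then 0 else 1 / (q - q ^ i)) * coeff f i"
    using coeff_scaling_exists[of "\<lambda>i. if i = 1 then 0 else 1 / (q - q ^ i)" f] by blast
  have "f = q_const * e - tw 1 e + [:0, coeff f 1:]"
  proof (rule poly_eqI)
    fix i
    show "coeff f i = coeff (q_const * e - tw 1 e + [:0, coeff f 1:]) i"
    proof (cases "i = 1")
      case False
      have "q - q ^ i \<noteq> 0"
        using q_power_eq_iff[of 1 i] False by simp
      then have "(q - q ^ i) * coeff e i = coeff f i"
        using False by (simp add: e)
      moreover have "coeff [:0, coeff f 1:] i = 0"
        using False by (simp add: coeff_pCons split: nat.split)
      ultimately show ?thesis
        by (simp add: coeff_tw_1 coeff_q_const left_diff_distrib)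
    qed (simp add: coeff_tw_1 coeff_q_const)
  qed
  then show thesis
    by (rule that)
qed

text \<open>The exponent i = 1 is both the only one missing from the image of q - \<sigma> and the
  only one in its kernel.\<close>

lemma q_minus_tw_kernel:
  assumes "q_const * e - tw 1 e = [:0, c:]"
  shows "c = 0 \<and> e = [:0, coeff e 1:]"
proof -
  have eq: "q * coeff e i - q ^ i * coeff e i = coeff [:0, c:] i" for i
    using arg_cong[OF assms, of "\<lambda>f. coeff f i"] by (simp add: coeff_tw_1 coeff_q_const)
  have c: "c = 0"
    using eq[of 1] by simp
  have "e = [:0, coeff e 1:]"
  proof (rule poly_eqI)
    fix i
    show "coeff e i = coeff [:0, coeff e 1:] i"
    proof (cases "i = 1")
      case False
      then have "(q - q ^ i) * coeff e i = 0" "q - q ^ i \<noteq> 0"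
        using eq[of i] q_power_eq_iff[of 1 i] by (simp_all add: c left_diff_distrib)
      then show ?thesis
        using False by (simp add: coeff_pCons split: nat.split)
    qed simp
  qed
  with c show ?thesis
    by blast
qed

text \<open>Since p has degree at least 1, the cofactor must be constant. This separates the two
  cases of the theorem.\<close>

lemma p_dvd_linear:
  assumes "p dvd [:0, c:]" "c \<noteq> 0"
  shows "p \<sim>\<^sub>p [:0, 1:]"
proof -
  obtain k where k: "[:0, c:] = p * k"
    using assms(1) ..
  then have "k \<noteq> 0"
    using assms(2) by auto
  then have "degree p + degree k = 1"
    using k p_nonzero assms(2) degree_mult_eq[of p k] by (metis One_nat_def degree_pCons_eq_if pCons_eq_0_iff)
  then have "degree k = 0"
    using degree_pos by simp
  then obtain d where d: "k = [:d:]"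
    by (rule degree_eq_zeroE)
  then have "d \<noteq> 0"
    using \<open>k \<noteq> 0\<close> by simp
  then have "p = Polynomial.smult (c / d) [:0, 1:]"
    using arg_cong[OF k, of "Polynomial.smult (inverse d)"] by (simp add: d field_simps)
  then show ?thesis
    unfolding poly_similar_def using \<open>d \<noteq> 0\<close> assms(2) by (intro exI[of _ "c / d"]) simp
qed

text \<open>A cocycle of degree 0 commutes with z, so \<open>zeta m\<close> kills its part of weight
  m and only weight 0 survives; commuting with x then makes that part a fixed point of \<sigma>,
  that is, a constant.\<close>

lemma represents_basis_0:
  "represents_basis (S_term q p) (S_diff q p) 0 {[gwa_of graded_one]}"
proof -
  interpret V: Module.module class_ring "S_term q p 0"
    by (rule S_term_module)
  have one: "wt0 m (Poly_Mapping.lookup graded_one m) = (0, 0, 0)" for m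
    by (cases "m = 0") (simp_all add: graded_one_def wt_0 wt_zero lookup_one)
  have finsum: "(\<Oplus>\<^bsub>S_term q p 0\<^esub>i\<in>{0}. c i \<odot>\<^bsub>S_term q p 0\<^esub> [gwa_of graded_one]) =
      [gwa_of (left_poly [:c 0:] graded_one)]" for c :: "nat \<Rightarrow> 'k"
  proof -
    have "[gwa_of F] \<in> carrier (S_term q p 0)" for F
      using S_term_carrier(1) by blast
    then show ?thesis
      by (simp add: S_term_ops)
  qed
  have "represents_basis (S_term q p) (S_diff q p) 0 ((\<lambda>i :: nat. [gwa_of graded_one]) ` {0})"
  proof (rule represents_basisI[OF cocycles_submodule coboundaries_submodule])
    show "[gwa_of graded_one] \<in> complex_cocycles 0"
      using one by (auto simp: cocycles_iff)
    have "[gwa_of 0] \<in> complex_cocycles 0"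
      unfolding cocycles_iff by (intro exI[of _ 0]) (simp add: wt_zero)
    then show "complex_coboundaries 0 \<subseteq> complex_cocycles 0"
      by (simp add: S_term_zero)
    show "\<exists>b\<in>complex_coboundaries 0. \<exists>c. v = b \<oplus>\<^bsub>S_term q p 0\<^esub>
        (\<Oplus>\<^bsub>S_term q p 0\<^esub>i\<in>{0 :: nat}. c i \<odot>\<^bsub>S_term q p 0\<^esub> [gwa_of graded_one])"
      if cv: "v \<in> complex_cocycles 0" for v
    proof -
      obtain F where F: "v = [gwa_of F]" "\<And>m. wt0 m (Poly_Mapping.lookup F m) = (0, 0, 0)"
        using cv unfolding cocycles_iff by blast
      have zero: "Poly_Mapping.lookup F m = 0" if "m \<noteq> 0" for m
        using F(2)[of m] zeta_const_eq_0[OF that, of "Poly_Mapping.lookup F m" 0] by (simp add: wt0_def)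
      define f where "f = Poly_Mapping.lookup F 0"
      have f: "f = [:coeff f 0:]"
        using F(2)[of 0] by (intro tw_fixed) (simp add: wt_0 f_def)
      have "F = Poly_Mapping.single 0 f"
        using zero by (intro poly_mapping_eqI) (auto simp: lookup_single when_def f_def)
      also have "\<dots> = left_poly [:coeff f 0:] graded_one"
        unfolding graded_one_def gen_act_single f[symmetric] by simp
      finally have "v = [gwa_of 0] \<oplus>\<^bsub>S_term q p 0\<^esub> [gwa_of (left_poly [:coeff f 0:] graded_one)]"
        by (simp add: F(1) S_term_ops)
      then show ?thesis
        unfolding finsum by (intro bexI[of _ "[gwa_of 0]"] exI[of _ "\<lambda>_. coeff f 0"])
          (simp_all add: S_term_zero)
    qed
    show "c i = 0" if "(\<Oplus>\<^bsub>S_term q p 0\<^esub>i\<in>{0 :: nat}. c i \<odot>\<^bsub>S_term q p 0\<^esub> [gwa_of graded_one])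
        \<in> complex_coboundaries 0" "i \<in> {0}" for c i
    proof -
      have "left_poly [:c 0:] graded_one = 0"
        using that(1) unfolding finsum by (simp add: S_term_zero)
      then have "Poly_Mapping.lookup (left_poly [:c 0:] graded_one) 0 = 0"
        by simp
      then show ?thesis
        using that(2) by (simp add: graded_one_def lookup_one)
    qed
  qed simp
  then show ?thesis
    by simp
qed

text \<open>The third equation places h in the kernel of q - \<sigma>, which is spanned by
  z.\<close>

lemma wt1_0_cocycle:
  assumes "wt1 0 f g h = (0, 0, 0, 0)"
  obtains c where "h = [:0, c:]" "p * (tw (-1) f + g) = pderiv p * [:0, c:]"
proof -
  have "q_const * h - tw 1 h = [:0, 0:]"
    using assms by (simp add: wt_0)
  then have h: "h = [:0, coeff h 1:]"
    using q_minus_tw_kernel by blast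
  moreover have "p * (tw (-1) f + g) = pderiv p * h"
    using assms by (simp add: wt_0)
  ultimately show thesis
    using that[of "coeff h 1"] by simp
qed

lemma represents_basis_1:
  assumes "\<not> p \<sim>\<^sub>p [:0, 1:]"
  shows "represents_basis (S_term q p) (S_diff q p) (Suc 0)
    {[gwa_of (Poly_Mapping.single 1 1), gwa_of (Poly_Mapping.single (-1) (-1)), gwa_of 0]}"
proof -
  have "represents_basis (S_term q p) (S_diff q p) (Suc 0)
    ((\<lambda>i :: nat. [gwa_of (Poly_Mapping.single 1 1), gwa_of (Poly_Mapping.single (-1) (-1)),
      gwa_of (Poly_Mapping.single 0 0)]) ` {0})"
  proof (rule represents_basis_deg1)
    show "wt1 0 1 (-1) 0 = (0, 0, 0, 0)"
      by (simp add: wt_0)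
    fix f g h assume wt: "wt1 0 f g h = (0, 0, 0, 0)"
    obtain c where c: "h = [:0, c:]" "p * (tw (-1) f + g) = pderiv p * [:0, c:]"
      using wt1_0_cocycle[OF wt] .
    \<comment> \<open>Thus p divides c z, which is impossible for c nonzero unless p is similar to
      z.\<close>
    then have "p dvd pderiv p * [:0, c:]"
      by (metis dvd_triv_left)
    then have "p dvd [:0, c:]"
      by (rule p_dvd_pderiv_mult)
    then have c0: "c = 0"
      using p_dvd_linear assms by blast
    then have g: "g = - tw (-1) f"
      using c(2) p_nonzero by (simp add: add_eq_0_iff)
    \<comment> \<open>The first component is a coboundary up to a constant. Applying -\<sigma>^(-1)
      shows that the same e works for g, with the opposite constant: this is a multiple of (x, -y,
      0).\<close>
    obtain e where f: "f = tw 1 e - e + [:coeff f 0:]"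
      by (rule tw_minus_id_onto)
    have "tw (-1) f = tw (-1) (tw 1 e - e + [:coeff f 0:])"
      by (rule arg_cong[OF f])
    then have "g = tw (-1) e - e - [:coeff f 0:]"
      by (simp add: g)
    moreover have "f - [:coeff f 0:] = tw 1 e - e"
      using f by (metis add_diff_cancel_right')
    ultimately show "\<exists>c e. wt0 0 e = (f - (\<Sum>i\<in>{0 :: nat}. Polynomial.smult (c i) 1),
        g - (\<Sum>i\<in>{0 :: nat}. Polynomial.smult (c i) (-1)), h - (\<Sum>i\<in>{0 :: nat}. Polynomial.smult (c i) 0))"
      by (intro exI[of _ "\<lambda>_. coeff f 0"] exI[of _ e]) (simp add: wt_0 c c0)
  next
    fix c :: "nat \<Rightarrow> 'k" and e and i :: nat
    assume "wt0 0 e = (\<Sum>i\<in>{0}. Polynomial.smult (c i) 1, \<Sum>i\<in>{0}. Polynomial.smult (c i) (- 1),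
      \<Sum>i\<in>{0}. Polynomial.smult (c i) 0)" "i \<in> {0}"
    then have "coeff (tw 1 e - e) 0 = c i"
      by (simp add: wt_0)
    then show "c i = 0"
      by (simp add: coeff_tw_1)
  qed simp
  then show ?thesis
    by simp
qed

lemma represents_basis_1_linear:
  assumes "p \<sim>\<^sub>p [:0, 1:]" and char: "(2 :: 'k) \<noteq> 0"
  shows "represents_basis (S_term q p) (S_diff q p) (Suc 0)
    {[gwa_of (Poly_Mapping.single 1 1), gwa_of (Poly_Mapping.single (-1) (-1)), gwa_of 0],
     [gwa_of (Poly_Mapping.single 1 1), gwa_of (Poly_Mapping.single (-1) 1),
      gwa_of (Poly_Mapping.single 0 [:0, 2:])]}"
proof -
  obtain a where a: "a \<noteq> 0" "p = [:0, a:]"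
    using assms(1) by (auto simp: poly_similar_def)
  define wg :: "nat \<Rightarrow> 'k poly" where "wg i = (if i = 0 then - 1 else 1)" for i
  define wh :: "nat \<Rightarrow> 'k poly" where "wh i = (if i = 0 then 0 else [:0, 2:])" for i
  have "represents_basis (S_term q p) (S_diff q p) (Suc 0)
    ((\<lambda>i. [gwa_of (Poly_Mapping.single 1 1), gwa_of (Poly_Mapping.single (-1) (wg i)),
      gwa_of (Poly_Mapping.single 0 (wh i))]) ` {0, 1})"
  proof (rule represents_basis_deg1)
    have tw: "tw k [:0, c:] = [:0, c * q powi k:]" for k c
      by (simp add: tw_def twist_def pcompose_pCons)
    show "wt1 0 1 (wg i) (wh i) = (0, 0, 0, 0)" if "i \<in> {0, 1}" for i
      unfolding wt_0 using that q_nonzero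
      by (auto simp: wg_def wh_def a tw pderiv_pCons q_const_def power_int_minus numeral_poly)
    fix f g h assume wt: "wt1 0 f g h = (0, 0, 0, 0)"
    obtain c where c: "h = [:0, c:]" "p * (tw (-1) f + g) = pderiv p * [:0, c:]"
      using wt1_0_cocycle[OF wt] .
    \<comment> \<open>Now p = a z and p' = a, so z p' is p itself and c stays free; it yields the
      second class.\<close>
    have "pderiv p * [:0, c:] = p * [:c:]"
      by (simp add: a pderiv_pCons mult.commute)
    then have "p * (tw (-1) f + g) = p * [:c:]"
      by (simp only: c(2))
    then have "tw (-1) f + g = [:c:]"
      using p_nonzero mult_left_cancel by blast
    then have g: "g = [:c:] - tw (-1) f"
      by (simp add: eq_diff_eq add.commute)
    obtain e where f: "f = tw 1 e - e + [:coeff f 0:]"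
      by (rule tw_minus_id_onto)
    have "tw (-1) f = tw (-1) (tw 1 e - e + [:coeff f 0:])"
      by (rule arg_cong[OF f])
    then have g': "g = tw (-1) e - e + [:c - coeff f 0:]"
      by (simp add: g)
    have f': "f - [:coeff f 0:] = tw 1 e - e"
      using f by (metis add_diff_cancel_right')
    \<comment> \<open>The coefficients solve k0 + k1 = \<open>coeff f 0\<close> and k1 - k0 = c -
      \<open>coeff f 0\<close>; the third component 2 k1 z = c z is then right as well. Division by
      2 is needed here.\<close>
    define k :: "nat \<Rightarrow> 'k" where "k i = (if i = 0 then coeff f 0 - c / 2 else c / 2)" for i
    have half: "c / 2 + c / 2 = c"
      using char by (simp add: add_divide_distrib[symmetric] mult_2[symmetric])
    show "\<exists>c e. wt0 0 e = (f - (\<Sum>i\<in>{0, 1}. Polynomial.smult (c i) 1),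
        g - (\<Sum>i\<in>{0, 1}. Polynomial.smult (c i) (wg i)), h - (\<Sum>i\<in>{0, 1}. Polynomial.smult (c i) (wh i)))"
    proof (intro exI[of _ k] exI[of _ e])
      have "(\<Sum>i\<in>{0, 1}. Polynomial.smult (k i) 1) = [:coeff f 0:]"
        by (simp add: k_def one_pCons)
      moreover have "(\<Sum>i\<in>{0, 1}. Polynomial.smult (k i) (wg i)) = [:c - coeff f 0:]"
        using half by (simp add: k_def wg_def one_pCons algebra_simps)
      moreover have "(\<Sum>i\<in>{0, 1}. Polynomial.smult (k i) (wh i)) = h"
        using char by (simp add: k_def wh_def c(1))
      ultimately show "wt0 0 e = (f - (\<Sum>i\<in>{0, 1}. Polynomial.smult (k i) 1),
          g - (\<Sum>i\<in>{0, 1}. Polynomial.smult (k i) (wg i)), h - (\<Sum>i\<in>{0, 1}. Polynomial.smult (k i) (wh i)))"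
        using g' by (simp only: f' wt_0) simp
    qed
  next
    fix c :: "nat \<Rightarrow> 'k" and e and i :: nat
    assume wt: "wt0 0 e = (\<Sum>i\<in>{0, 1}. Polynomial.smult (c i) 1, \<Sum>i\<in>{0, 1}. Polynomial.smult (c i) (wg i),
      \<Sum>i\<in>{0, 1}. Polynomial.smult (c i) (wh i))" and i: "i \<in> {0, 1}"
    \<comment> \<open>Coboundaries of weight 0 have third component 0, so 2 c1 z = 0.\<close>
    have c1: "c 1 = 0"
      using wt char by (simp add: wt_0 wh_def)
    have "coeff (tw 1 e - e) 0 = c 0 + c 1"
      using wt by (simp add: wt_0)
    then have "c 0 = 0"
      by (simp add: coeff_tw_1 c1[simplified])
    then show "c i = 0"
      using c1 i by auto
  qed simp
  then show ?thesis
    by (simp add: wg_def wh_def insert_commute)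
qed

text \<open>The assumptions on J say that the powers z^i with i in J form a basis of k[z] modulo p
  k[z] + k z p'. This subspace is the set of first components of coboundaries once H is confined to
  the kernel k z of q - \<sigma>; the extra class accounts for the cokernel of q - \<sigma> in the
  third component.\<close>

lemma represents_basis_2:
  fixes J :: "nat set"
  defines "n \<equiv> degree p"
  assumes J: "J \<subseteq> {..<n}"
    and spanJ: "\<And>f. \<exists>k u e. f = (\<Sum>i\<in>J. Polynomial.smult (k i) ([:0, 1:] ^ i)) + p * u - pderiv p * [:0, e:]"
    and indepJ: "\<And>k u e i. (\<Sum>i\<in>J. Polynomial.smult (k i) ([:0, 1:] ^ i)) = p * u - pderiv p * [:0, e:] \<Longrightarrow>
      i \<in> J \<Longrightarrow> k i = 0"
  shows "represents_basis (S_term q p) (S_diff q p) (Suc (Suc 0))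
    (insert [gwa_of 0, gwa_of (Poly_Mapping.single 0 (tw 1 ([:0, 1:] * pderiv p))),
        gwa_of (Poly_Mapping.single 1 [:0, - q:]), gwa_of (Poly_Mapping.single (-1) [:0, 1:])]
      {[gwa_of (Poly_Mapping.single 0 ([:0, 1:] ^ i)), gwa_of (Poly_Mapping.single 0 (tw 1 ([:0, 1:] ^ i))),
        gwa_of 0, gwa_of 0] | i. i \<in> J})"
proof -
  have fin: "finite J" and nJ: "n \<notin> J"
    using J finite_subset by auto
  \<comment> \<open>The extra class is given the index n, which is free because J lies below
    n.\<close>
  define wf :: "nat \<Rightarrow> 'k poly" where "wf i = (if i = n then 0 else [:0, 1:] ^ i)" for i
  define wg :: "nat \<Rightarrow> 'k poly" where
    "wg i = (if i = n then tw 1 ([:0, 1:] * pderiv p) else tw 1 ([:0, 1:] ^ i))" for i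
  define wh :: "nat \<Rightarrow> 'k poly" where "wh i = (if i = n then [:0, - q:] else 0)" for i
  define wl :: "nat \<Rightarrow> 'k poly" where "wl i = (if i = n then [:0, 1:] else 0)" for i
  define S where "S k = (\<Sum>i\<in>J. Polynomial.smult (k i) ([:0, 1:] ^ i))" for k :: "nat \<Rightarrow> 'k"
  have tw: "tw k [:0, c:] = [:0, c * q powi k:]" for k c
    by (simp add: tw_def twist_def pcompose_pCons)
  have tw_z: "tw 1 ([:0, 1:] * f) = [:0, q:] * tw 1 f" for f
    by (simp only: tw_simps(7) tw mult_1 power_int_1_right)
  have sums: "(\<Sum>i\<in>insert n J. Polynomial.smult (c i) (wf i)) = S c"
    "(\<Sum>i\<in>insert n J. Polynomial.smult (c i) (wg i)) =
      [:0, c n * q:] * tw 1 (pderiv p) + tw 1 (S c)"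
    "(\<Sum>i\<in>insert n J. Polynomial.smult (c i) (wh i)) = [:0, - (c n * q):]"
    "(\<Sum>i\<in>insert n J. Polynomial.smult (c i) (wl i)) = [:0, c n:]" for c
  proof -
    have ne: "i \<noteq> n" if "i \<in> J" for i
      using that nJ by blast
    show "(\<Sum>i\<in>insert n J. Polynomial.smult (c i) (wf i)) = S c"
      using fin nJ ne by (simp add: S_def wf_def)
    have "(\<Sum>i\<in>J. Polynomial.smult (c i) (wg i)) = tw 1 (S c)"
      unfolding S_def tw_sum using ne by (intro sum.cong) (auto simp: wg_def)
    then show "(\<Sum>i\<in>insert n J. Polynomial.smult (c i) (wg i)) =
        [:0, c n * q:] * tw 1 (pderiv p) + tw 1 (S c)"
      using fin nJ tw_z by (simp add: wg_def mult.commute)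
    show "(\<Sum>i\<in>insert n J. Polynomial.smult (c i) (wh i)) = [:0, - (c n * q):]"
      "(\<Sum>i\<in>insert n J. Polynomial.smult (c i) (wl i)) = [:0, c n:]"
      using fin nJ ne by (simp_all add: wh_def wl_def)
  qed
  have "represents_basis (S_term q p) (S_diff q p) (Suc (Suc 0))
    ((\<lambda>i. [gwa_of (Poly_Mapping.single 0 (wf i)), gwa_of (Poly_Mapping.single 0 (wg i)),
       gwa_of (Poly_Mapping.single 1 (wh i)), gwa_of (Poly_Mapping.single (-1) (wl i))]) ` insert n J)"
  proof (rule represents_basis_deg2)
    show "finite (insert n J)"
      using fin by simp
    show "wt2 0 (wf i) (wg i) (wh i) (wl i) = (0, 0, 0, 0)" if "i \<in> insert n J" for i
    proof (cases "i = n")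
      case True
      have "p * (tw (-1) (wh i) + wl i) = 0"
        using True q_nonzero by (simp add: wh_def wl_def tw power_int_minus)
      moreover have "- (wh i * tw 1 p) - tw 1 (wl i * p) = 0"
      proof -
        have "wh i = [:0, - q:]" "wl i = [:0, 1:]"
          using True by (simp_all add: wh_def wl_def)
        then show ?thesis
          by (simp only: tw_z) simp
      qed
      moreover have "tw 1 (wf i) - wg i - tw 1 (pderiv p) * wh i = 0"
      proof -
        have "wg i = tw 1 ([:0, 1:] * pderiv p)"
          by (simp only: wg_def True simp_thms if_True)
        moreover have "wf i = 0" "wh i = [:0, - q:]"
          using True by (simp_all add: wf_def wh_def)
        ultimately show ?thesis
          by (simp only: tw_z) (simp add: mult.commute)
      qed
      moreover have "tw (-1) (wg i) - wf i - pderiv p * wl i = 0"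
        unfolding wf_def wg_def wl_def using True by (simp only: if_True tw_simps) (simp add: mult.commute)
      ultimately show ?thesis
        by (simp only: wt_0 minus_zero)
    next
      case False
      then show ?thesis
        by (simp add: wt_0 wf_def wg_def wh_def wl_def)
    qed
    fix f g h l assume wt: "wt2 0 f g h l = (0, 0, 0, 0)"
    show "\<exists>c F G H. wt1 0 F G H = (f - (\<Sum>i\<in>insert n J. Polynomial.smult (c i) (wf i)),
        g - (\<Sum>i\<in>insert n J. Polynomial.smult (c i) (wg i)),
        h - (\<Sum>i\<in>insert n J. Polynomial.smult (c i) (wh i)),
        l - (\<Sum>i\<in>insert n J. Polynomial.smult (c i) (wl i)))"
      unfolding sums
    proof -
      \<comment> \<open>This kills the third component up to a multiple of z.\<close>
      obtain H1 where H1: "h = q_const * H1 - tw 1 H1 + [:0, coeff h 1:]"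
        by (rule q_minus_tw_onto)
      \<comment> \<open>Adding e z to H1 leaves q H - \<sigma>(H) unchanged, so e remains available
        for adjusting the first component by a multiple of z p'.\<close>
      obtain k u e where kue: "f + pderiv p * H1 = S k + p * u - pderiv p * [:0, e:]"
        using spanJ unfolding S_def by blast
      \<comment> \<open>The extra class has third component -q z, because -xz = -q zx; this
        determines its coefficient.\<close>
      define c where "c i = (if i = n then - coeff h 1 / q else k i)" for i
      have "S c = S k"
        unfolding S_def using nJ by (intro sum.cong) (auto simp: c_def)
      define T where "T = [:0, coeff h 1:]"
      define E where "E = [:0, e:]"
      have cn: "[:0, c n * q:] = - T" "[:0, - (c n * q):] = T" "q_const * [:0, c n:] = - T"
        using q_nonzero by (simp_all add: c_def T_def q_const_def)
      have tw_E: "tw 1 E = q_const * E" "q_const * tw (-1) E = E"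
        using q_nonzero by (simp_all add: E_def tw q_const_def power_int_minus)
      have tw_T: "tw (-1) T = - [:0, c n:]"
        using q_nonzero by (simp add: c_def T_def tw power_int_minus divide_inverse)
      have f: "f - S c = p * u - pderiv p * (H1 + E)"
        using kue unfolding \<open>S c = S k\<close> E_def[symmetric] by (simp add: algebra_simps)
      have h: "h = q_const * (H1 + E) - tw 1 (H1 + E) + T"
        using H1 by (simp add: tw_E T_def algebra_simps)
      \<comment> \<open>The cocycle equations express g through f and h, and l through h, so the
        second and fourth components follow from the first and third.\<close>
      have g: "g = tw 1 f - tw 1 (pderiv p) * h"
        using wt by (simp add: wt_0 algebra_simps)
      have "p * (tw (-1) h + l) = 0"
        using wt by (simp add: wt_0)
      then have l: "l = - tw (-1) h"
        using p_nonzero by (simp add: add_eq_0_iff)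
      have "tw 1 (f - S c) = tw 1 (p * u - pderiv p * (H1 + E))"
        by (rule arg_cong[OF f])
      then have "g - (- T * tw 1 (pderiv p) + tw 1 (S c)) =
          tw 1 (u * p) - q_const * tw 1 (pderiv p) * (H1 + E)"
        unfolding g by (simp add: h algebra_simps)
      moreover have "l - [:0, c n:] = H1 + E - q_const * tw (-1) (H1 + E)"
        unfolding l by (simp add: h tw_T algebra_simps)
      moreover have "h - T = q_const * (H1 + E) - tw 1 (H1 + E)"
        by (simp add: h)
      ultimately have "wt1 0 0 u (H1 + E) =
          (f - S c, g - ([:0, c n * q:] * tw 1 (pderiv p) + tw 1 (S c)), h - [:0, - (c n * q):], l - [:0, c n:])"
        unfolding cn f wt_0 by (simp add: mult.commute)
      then show "\<exists>c F G H. wt1 0 F G H =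
          (f - S c, g - ([:0, c n * q:] * tw 1 (pderiv p) + tw 1 (S c)), h - [:0, - (c n * q):], l - [:0, c n:])"
        by blast
    qed
  next
    fix c F G H i
    assume wt: "wt1 0 F G H = (\<Sum>i\<in>insert n J. Polynomial.smult (c i) (wf i),
        \<Sum>i\<in>insert n J. Polynomial.smult (c i) (wg i), \<Sum>i\<in>insert n J. Polynomial.smult (c i) (wh i),
        \<Sum>i\<in>insert n J. Polynomial.smult (c i) (wl i))" and i: "i \<in> insert n J"
    then have "q_const * H - tw 1 H = [:0, - (c n * q):]"
      unfolding sums by (simp add: wt_0)
    \<comment> \<open>Since z is not in the image of q - \<sigma>, the extra class has coefficient
      0, and H is a multiple of z as \<open>indepJ\<close> requires.\<close>
    from q_minus_tw_kernel[OF this] have cn: "c n = 0" and H: "H = [:0, coeff H 1:]"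
      using q_nonzero by simp_all
    have "S c = p * (tw (-1) F + G) - pderiv p * H"
      using wt unfolding sums by (simp add: wt_0)
    then have "S c = p * (tw (-1) F + G) - pderiv p * [:0, coeff H 1:]"
      using H by simp
    then have "c j = 0" if "j \<in> J" for j
      unfolding S_def using indepJ that by blast
    then show "c i = 0"
      using cn i by auto
  qed
  moreover have "(\<lambda>i. [gwa_of (Poly_Mapping.single 0 (wf i)), gwa_of (Poly_Mapping.single 0 (wg i)),
       gwa_of (Poly_Mapping.single 1 (wh i)), gwa_of (Poly_Mapping.single (-1) (wl i))]) ` J =
      {[gwa_of (Poly_Mapping.single 0 ([:0, 1:] ^ i)), gwa_of (Poly_Mapping.single 0 (tw 1 ([:0, 1:] ^ i))),
        gwa_of 0, gwa_of 0] | i. i \<in> J}"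
    unfolding image_def using nJ
    by (intro Collect_cong) (auto simp: wf_def wg_def wh_def wl_def intro!: bexI)
  ultimately show ?thesis
    by (simp only: image_insert) (simp only: wf_def wg_def wh_def wl_def simp_thms if_True single_zero)
qed

lemma represents_basis_2_nonlinear:
  defines "n \<equiv> degree p"
  assumes not_z: "\<not> p \<sim>\<^sub>p [:0, 1:]"
  shows "represents_basis (S_term q p) (S_diff q p) (Suc (Suc 0))
    (insert [gwa_of 0, gwa_of (Poly_Mapping.single 0 (tw 1 ([:0, 1:] * pderiv p))),
        gwa_of (Poly_Mapping.single 1 [:0, - q:]), gwa_of (Poly_Mapping.single (-1) [:0, 1:])]
      {[gwa_of (Poly_Mapping.single 0 ([:0, 1:] ^ i)), gwa_of (Poly_Mapping.single 0 (tw 1 ([:0, 1:] ^ i))),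
        gwa_of 0, gwa_of 0] | i. i \<in> {i. i < n \<and> i \<noteq> n - ell p}})"
proof -
  \<comment> \<open>The coefficient of z^(n-j) in n p - z p' is j times \<open>a_j\<close>, so the
    first nonvanishing one, at j = \<open>ell p\<close>, gives the degree. Modulo p this is a
    representative of -z p' of degree below n.\<close>
  define r where "r = Polynomial.smult (of_nat n) p - [:0, 1:] * pderiv p"
  have coeff_r: "coeff r i = of_nat (n - i) * coeff p i" for i
  proof -
    have "coeff ([:0, 1:] * pderiv p) i = of_nat i * coeff p i"
      by (cases i) (simp_all add: coeff_pderiv)
    then have "coeff r i = (of_nat n - of_nat i) * coeff p i"
      by (simp add: r_def left_diff_distrib)
    then show ?thesis
      by (cases "i \<le> n") (simp_all add: of_nat_diff coeff_eq_0 n_def)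
  qed
  \<comment> \<open>If r were 0, then p would divide z p', hence z, and be similar to z.\<close>
  have "r \<noteq> 0"
  proof
    assume "r = 0"
    then have "pderiv p * [:0, 1:] = p * [:of_nat n:]"
      by (simp add: r_def mult.commute)
    then have "p dvd pderiv p * [:0, 1:]"
      by (metis dvd_triv_left)
    then show False
      using p_dvd_pderiv_mult p_dvd_linear[of 1] not_z by simp
  qed
  then obtain i where i: "coeff r i \<noteq> 0"
    by (auto simp: poly_eq_iff)
  then have "i \<le> n"
    by (rule contrapos_np) (simp add: coeff_r)
  let ?Q = "\<lambda>j. j \<le> degree p \<and> of_nat j * coeff p (degree p - j) \<noteq> 0"
  have "?Q (n - i)"
    using i \<open>i \<le> n\<close> unfolding coeff_r by (simp add: n_def)
  then have ell: "ell p \<le> n" "of_nat (ell p) * coeff p (n - ell p) \<noteq> 0"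
    using LeastI[of ?Q] unfolding ell_def n_def by blast+
  define m where "m = n - ell p"
  \<comment> \<open>The index j = 0 never qualifies because of the factor j, so \<open>ell p\<close>
    is positive.\<close>
  have m: "m < n"
    using ell degree_pos by (cases "ell p") (auto simp: m_def n_def)
  have r_m: "coeff r m \<noteq> 0"
    using ell by (simp add: coeff_r m_def)
  have r_0: "coeff r j = 0" if "j > m" for j
  proof (cases "j \<le> n")
    case True
    then have "n - j < ell p"
      using that by (simp add: m_def)
    then have "\<not> ?Q (n - j)"
      unfolding ell_def by (rule not_less_Least)
    then show ?thesis
      using True by (simp add: coeff_r n_def)
  next
    case False
    then show ?thesis
      by (simp add: coeff_r)
  qed
  define J where "J = {i. i < n \<and> i \<noteq> m}"
  have finJ: "finite J"
    by (simp add: J_def)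
  have "represents_basis (S_term q p) (S_diff q p) (Suc (Suc 0))
    (insert [gwa_of 0, gwa_of (Poly_Mapping.single 0 (tw 1 ([:0, 1:] * pderiv p))),
        gwa_of (Poly_Mapping.single 1 [:0, - q:]), gwa_of (Poly_Mapping.single (-1) [:0, 1:])]
      {[gwa_of (Poly_Mapping.single 0 ([:0, 1:] ^ i)), gwa_of (Poly_Mapping.single 0 (tw 1 ([:0, 1:] ^ i))),
        gwa_of 0, gwa_of 0] | i. i \<in> J})"
  proof (rule represents_basis_2)
    show "J \<subseteq> {..<degree p}"
      by (auto simp: J_def n_def)
    show "\<exists>k u e. f = (\<Sum>i\<in>J. Polynomial.smult (k i) ([:0, 1:] ^ i)) + p * u - pderiv p * [:0, e:]" for f
    proof -
      define f1 where "f1 = f mod p"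
      have f1: "coeff f1 j = 0" if "j \<ge> n" for j
        using degree_mod_less[OF p_nonzero, of f] that coeff_eq_0[of f1 j]
        by (auto simp: f1_def n_def)
      \<comment> \<open>After reduction modulo p, the power z^m missing from J is eliminated with
        the leading term of r.\<close>
      define s where "s = coeff f1 m / coeff r m"
      define f2 where "f2 = f1 - Polynomial.smult s r"
      have "f2 = (\<Sum>i\<in>J. Polynomial.smult (coeff f2 i) ([:0, 1:] ^ i))"
      proof (rule poly_eqI)
        fix j
        have "coeff f2 j = 0" if "j \<notin> J"
          using that f1 r_0 r_m m unfolding J_def f2_def s_def
          by (cases "j = m") auto
        then show "coeff f2 j = coeff (\<Sum>i\<in>J. Polynomial.smult (coeff f2 i) ([:0, 1:] ^ i)) j"
          by (simp add: coeff_sum_powers[OF finJ])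
      qed
      moreover have "f = f2 + p * (f div p + [:s * of_nat n:]) - pderiv p * [:0, s:]"
      proof -
        have "Polynomial.smult s r = p * [:s * of_nat n:] - pderiv p * [:0, s:]"
          by (simp add: r_def smult_diff_right mult.commute)
        moreover have "f = p * (f div p) + f1"
          by (simp add: f1_def)
        ultimately show ?thesis
          by (simp add: f2_def distrib_left algebra_simps)
      qed
      ultimately show ?thesis
        by metis
    qed
    show "k i = 0" if eq: "(\<Sum>i\<in>J. Polynomial.smult (k i) ([:0, 1:] ^ i)) = p * u - pderiv p * [:0, e:]"
      and i: "i \<in> J" for k u e i
    proof -
      define S where "S = (\<Sum>i\<in>J. Polynomial.smult (k i) ([:0, 1:] ^ i))"
      have S: "coeff S j = (if j \<in> J then k j else 0)" for j
        unfolding S_def by (rule coeff_sum_powers[OF finJ])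
      define v where "v = u - [:e * of_nat n:]"
      have "pderiv p * [:0, e:] = Polynomial.smult (e * of_nat n) p - Polynomial.smult e r"
        by (simp add: r_def smult_diff_right mult.commute)
      then have Sv: "S = p * v + Polynomial.smult e r"
        using eq by (simp add: S_def v_def right_diff_distrib mult.commute)
      \<comment> \<open>Both \<open>S\<close> and r have degree below n, whereas a nonzero multiple
        of p has degree at least n.\<close>
      have "v = 0"
      proof (rule ccontr)
        assume "v \<noteq> 0"
        then have "coeff (p * v) (n + degree v) \<noteq> 0"
          using p_nonzero by (simp add: n_def coeff_mult_degree_sum)
        moreover have "coeff (p * v) (n + degree v) = coeff S (n + degree v) - e * coeff r (n + degree v)"
          by (simp add: Sv)
        moreover have "coeff S (n + degree v) = 0"
          by (simp add: S J_def)
        moreover have "coeff r (n + degree v) = 0"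
          using m by (intro r_0) simp
        ultimately show False
          by simp
      qed
      \<comment> \<open>As m is not in J, the left side is 0, and r has a nonzero coefficient at m;
        hence e = 0.\<close>
      then have "coeff S m = e * coeff r m"
        by (simp add: Sv)
      then have "e = 0"
        using r_m by (simp add: S J_def)
      then have "coeff S i = 0"
        by (simp add: Sv \<open>v = 0\<close>)
      then show ?thesis
        using i by (simp add: S)
    qed
  qed
  then show ?thesis
    by (simp add: J_def m_def)
qed

text \<open>Here z p' = p, so the subspace to be divided out is (p) = (z) and the quotient is
  spanned by 1.\<close>

lemma represents_basis_2_linear:
  assumes "p \<sim>\<^sub>p [:0, 1:]"
  shows "represents_basis (S_term q p) (S_diff q p) (Suc (Suc 0))
    {[gwa_of 0, gwa_of (Poly_Mapping.single 0 (tw 1 p)),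
        gwa_of (Poly_Mapping.single 1 [:0, - q:]), gwa_of (Poly_Mapping.single (-1) [:0, 1:])],
     [gwa_of graded_one, gwa_of graded_one, gwa_of 0, gwa_of 0]}"
proof -
  obtain a where a: "a \<noteq> 0" "p = [:0, a:]"
    using assms by (auto simp: poly_similar_def)
  have z: "[:0, 1:] * pderiv p = p"
    by (simp add: a pderiv_pCons)
  have "represents_basis (S_term q p) (S_diff q p) (Suc (Suc 0))
    (insert [gwa_of 0, gwa_of (Poly_Mapping.single 0 (tw 1 ([:0, 1:] * pderiv p))),
        gwa_of (Poly_Mapping.single 1 [:0, - q:]), gwa_of (Poly_Mapping.single (-1) [:0, 1:])]
      {[gwa_of (Poly_Mapping.single 0 ([:0, 1:] ^ i)), gwa_of (Poly_Mapping.single 0 (tw 1 ([:0, 1:] ^ i))),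
        gwa_of 0, gwa_of 0] | i. i \<in> {0}})"
  proof (rule represents_basis_2)
    show "{0} \<subseteq> {..<degree p}"
      using degree_pos by auto
    show "\<exists>k u e. f = (\<Sum>i\<in>{0}. Polynomial.smult (k i) ([:0, 1:] ^ i)) + p * u - pderiv p * [:0, e:]" for f
    proof -
      obtain b g where f: "f = pCons b g"
        by (cases f)
      have "f = Polynomial.smult b ([:0, 1:] ^ 0) + p * Polynomial.smult (inverse a) g - pderiv p * [:0, 0:]"
        using a by (simp add: f one_pCons)
      then show ?thesis
        by (intro exI[of _ "\<lambda>_. b"] exI[of _ "Polynomial.smult (inverse a) g"] exI[of _ 0]) simp
    qed
    show "k i = 0" if eq: "(\<Sum>i\<in>{0}. Polynomial.smult (k i) ([:0, 1:] ^ i)) = p * u - pderiv p * [:0, e:]"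
      and i: "i \<in> {0}" for k u e and i :: nat
    proof -
      have "k 0 = coeff (\<Sum>i\<in>{0}. Polynomial.smult (k i) ([:0, 1:] ^ i)) 0"
        by simp
      also have "\<dots> = coeff (p * u - pderiv p * [:0, e:]) 0"
        by (simp only: eq)
      also have "\<dots> = 0"
        by (simp add: a pderiv_pCons)
      finally show ?thesis
        using i by simp
    qed
  qed
  then show ?thesis
    unfolding z by (simp add: graded_one_def)
qed

end

theorem theorem2:
  fixes q :: "'k::field" and p :: "'k poly"
  assumes char: "CHAR('k) \<noteq> 2"
    and q_nonzero: "q \<noteq> 0"
    and q_not_root_of_unity: "\<forall>m>0. q ^ m \<noteq> 1"
    and degree: "degree p \<ge> 1"
    and no_multiple_roots: "coprime p (pderiv p)"
  shows
    "let n = degree p;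
         A = gwa q p;
         x = gwa_x q p;
         y = gwa_y q p;
         z = gwa_z q p;
         zp = [:0, 1:];
         pol = gwa_poly q p;
         \<sigma> = twist q;
         basis = represents_basis (S_term q p) (S_diff q p)
     in
      (\<not> p \<sim>\<^sub>p zp \<longrightarrow>
         basis 0 {[\<one>\<^bsub>A\<^esub>]} \<and>
         basis 1 {[x, \<ominus>\<^bsub>A\<^esub> y, \<zero>\<^bsub>A\<^esub>]} \<and>
         basis 2 ({[\<zero>\<^bsub>A\<^esub>, pol (\<sigma> (zp * pderiv p)), \<ominus>\<^bsub>A\<^esub> (x \<otimes>\<^bsub>A\<^esub> z), z \<otimes>\<^bsub>A\<^esub> y]} \<union>
                  {[pol (zp ^ i), pol (\<sigma> (zp ^ i)), \<zero>\<^bsub>A\<^esub>, \<zero>\<^bsub>A\<^esub>] | i. i < n \<and> i \<noteq> n - ell p})) \<and>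
      (p \<sim>\<^sub>p zp \<longrightarrow>
         basis 0 {[\<one>\<^bsub>A\<^esub>]} \<and>
         basis 1 {[x, \<ominus>\<^bsub>A\<^esub> y, \<zero>\<^bsub>A\<^esub>], [x, y, 2 \<odot>\<^bsub>A\<^esub> z]} \<and>
         basis 2 {[\<zero>\<^bsub>A\<^esub>, pol (\<sigma> p), \<ominus>\<^bsub>A\<^esub> (x \<otimes>\<^bsub>A\<^esub> z), z \<otimes>\<^bsub>A\<^esub> y],
                  [\<one>\<^bsub>A\<^esub>, \<one>\<^bsub>A\<^esub>, \<zero>\<^bsub>A\<^esub>, \<zero>\<^bsub>A\<^esub>]}) \<and>
      (\<forall>j\<ge>3. carrier (cohomology (S_term q p) (S_diff q p) j) =
               {\<zero>\<^bsub>cohomology (S_term q p) (S_diff q p) j\<^esub>})"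
proof -
  interpret gwa_generic q p
    by unfold_locales (fact assms)+
  \<comment> \<open>If 2 = 0, the characteristic divides 2 without being 2, so it would be 1, which
    is impossible in a field. The fact serves the independence of (x, y, 2z) in
    \<open>represents_basis_1_linear\<close>.\<close>
  have two: "(2 :: 'k) \<noteq> 0"
  proof
    assume "(2 :: 'k) = 0"
    then have "CHAR('k) dvd 2"
      using of_nat_eq_0_iff_char_dvd[of 2, where 'a = 'k] by simp
    then have "CHAR('k) = 1"
      using char two_is_prime_nat prime_nat_iff by metis
    then show False
      using of_nat_CHAR[where 'a = 'k] by simp
  qed
  have tw_z: "tw 1 [:0, 1:] = [:0, q:]"
    using twist_z[symmetric] by (simp add: twist_eq_tw)
  have y: "\<ominus>\<^bsub>gwa q p\<^esub> gwa_y q p = gwa_of (Poly_Mapping.single (-1) (-1))"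
    by (simp add: gwa_of_elements gwa_of_uminus single_uminus)
  have z: "2 \<odot>\<^bsub>gwa q p\<^esub> gwa_z q p = gwa_of (Poly_Mapping.single 0 [:0, 2:])"
    by (simp add: gwa_of_elements gwa_of_scale gen_act_single)
  have xz: "\<ominus>\<^bsub>gwa q p\<^esub> (gwa_x q p \<otimes>\<^bsub>gwa q p\<^esub> gwa_z q p) = gwa_of (Poly_Mapping.single 1 [:0, - q:])"
    unfolding gwa_of_elements(4) gwa_of_mult gwa_of_uminus gen_act_single
    by (simp add: x_coeff_def tw_z flip: single_uminus)
  have zy: "gwa_z q p \<otimes>\<^bsub>gwa q p\<^esub> gwa_y q p = gwa_of (Poly_Mapping.single (-1) [:0, 1:])"
    unfolding gwa_of_elements(3) gwa_poly_const(1)[symmetric] gwa_of_mult gen_act_single by simp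
  show ?thesis
    unfolding Let_def y z xz zy
    unfolding gwa_of_elements(1,2,3,5) gwa_of_zero twist_eq_tw One_nat_def numeral_2_eq_2
    using represents_basis_0 represents_basis_1 represents_basis_1_linear[OF _ two]
      represents_basis_2_nonlinear represents_basis_2_linear cohomology_trivial
    by simp
qed

end
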